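(* The operator $\mathcal{A}_2$ is dissipative on $\mathcal{H}_2$, with $\mathrm{Re}\langle\mathcal{A}_2y,y\rangle_{\mathcal{H}_2}=-\frac{\gamma_2}{\kappa_2}\|q_2\|^2$ for $y=(u_1,u_2,v_1,v_2,\theta_2,q_2)\in\mathcal{D}(\mathcal{A}_2)$; moreover $0\in\rho(\mathcal{A}_2)$ and $i\mathbb{R}\subset\rho(\mathcal{A}_2)$. Consequently $\mathcal{A}_2$ generates a $C_0$-semigroup of contractions $(S_2(t))_{t\ge0}$ on $\mathcal{H}_2$, which is strongly stable: $\lim_{t\to\infty}\|S_2(t)y^0\|_{\mathcal{H}_2}=0$ for every $y^0\in\mathcal{H}_2$.
   Context: Let $\ell_1,\ell_2>0$ and positive constants $\alpha_1,\alpha_2,\beta_2,\gamma_2,\delta_2,\tau_2,\kappa_2$. $\|\cdot\|$ denotes the $L^2$ norm on the relevant interval; primes denote $x$-derivatives. Let $V=\{(f_1,f_2)\in H^1(0,\ell_1)\times H^2(0,\ell_2): f_1(\ell_1)=0,\ f_2(\ell_2)=0,\ f_1(0)=f_2(0),\ f_2'(0)=0\}$. Let $\mathcal{H}_2=V\times L^2(0,\ell_1)\times L^2(0,\ell_2)\times L^2(0,\ell_2)\times L^2(0,\ell_2)$ with elements $(f_1,f_2,g_1,g_2,h_2,d_2)$ and norm $\|\cdot\|_{\mathcal{H}_2}^2=\alpha_1\|f_1'\|^2+\|g_1\|^2+\frac{\delta_2}{\beta_2}\big(\alpha_2\|f_2''\|^2+\|g_2\|^2\big)+\|h_2\|^2+\frac{\gamma_2\tau_2}{\kappa_2}\|d_2\|^2$.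 Define $\mathcal{D}(\mathcal{A}_2)$ as the set of $(u_1,u_2,v_1,v_2,\theta_2,q_2)\in\mathcal{H}_2$ with $u_1\in H^2(0,\ell_1)$, $(v_1,v_2)\in V$, $\theta_2\in H^1_0(0,\ell_2)$, $q_2\in H^1(0,\ell_2)$, $\alpha_2u_2''-\beta_2\theta_2\in H^2(0,\ell_2)$, $u_2''(\ell_2)=0$ and $\frac{\delta_2}{\beta_2}(\alpha_2u_2''-\beta_2\theta_2)'(0)=\alpha_1u_1'(0)$, and $\mathcal{A}_2(u_1,u_2,v_1,v_2,\theta_2,q_2)=\big(v_1,\ v_2,\ \alpha_1u_1'',\ (-\alpha_2u_2''+\beta_2\theta_2)'',\ -\delta_2v_2''-\gamma_2q_2',\ -\tfrac1{\tau_2}q_2-\tfrac{\kappa_2}{\tau_2}\theta_2'\big)$. This is the first-order formulation of the elastic string $u_{1,tt}-\alpha_1u_{1,xx}=0$ on $(0,\ell_1)$ coupled at $x=0$ with the thermoelastic beam (Cattaneo law) $u_{2,tt}+\alpha_2u_{2,xxxx}-\beta_2\theta_{2,xx}=0$, $\theta_{2,t}+\gamma_2q_{2,x}+\delta_2u_{2,txx}=0$, $\tau_2q_{2,t}+q_2+\kappa_2\theta_{2,x}=0$ on $(0,\ell_2)$, with $u_1(0)=u_2(0)$, $\theta_2(0)=\theta_2(\ell_2)=0$, $u_{2,x}(0)=0$, $\frac{\delta_2}{\beta_2}(\alpha_2u_{2,xxx}(0)-\beta_2\theta_{2,x}(0))=\alpha_1u_{1,x}(0)$, $u_1(\ell_1)=u_2(\ell_2)=u_{2,xx}(\ell_2)=0$.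 *)

theory Defs
  imports "HOL-Analysis.Analysis"
begin

record prm =
  ell1 :: real
  ell2 :: real
  alpha1 :: real
  alpha2 :: real
  beta2 :: real
  gamma2 :: real
  delta2 :: real
  tau2 :: real
  kappa2 :: real

definition pos_prm :: "prm \<Rightarrow> bool" where
  "pos_prm P \<longleftrightarrow> 0 < ell1 P \<and> 0 < ell2 P \<and> 0 < alpha1 P \<and> 0 < alpha2 P \<and> 0 < beta2 P
     \<and> 0 < gamma2 P \<and> 0 < delta2 P \<and> 0 < tau2 P \<and> 0 < kappa2 P"

text \<open>Functions are genuine functions real => complex; elements of L^2 are
  identified up to equality almost everywhere (see Heq below).\<close>

definition L2 :: "real \<Rightarrow> real \<Rightarrow> (real \<Rightarrow> complex) \<Rightarrow> bool" where
  "L2 a b f \<longleftrightarrow> f \<in> borel_measurable (lebesgue_on {a..b})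
     \<and> integrable (lebesgue_on {a..b}) (\<lambda>x. (cmod (f x))\<^sup>2)"

definition l2inner :: "real \<Rightarrow> real \<Rightarrow> (real \<Rightarrow> complex) \<Rightarrow> (real \<Rightarrow> complex) \<Rightarrow> complex" where
  "l2inner a b f g = integral\<^sup>L (lebesgue_on {a..b}) (\<lambda>x. f x * cnj (g x))"

definition l2norm :: "real \<Rightarrow> real \<Rightarrow> (real \<Rightarrow> complex) \<Rightarrow> real" where
  "l2norm a b f = sqrt (integral\<^sup>L (lebesgue_on {a..b}) (\<lambda>x. (cmod (f x))\<^sup>2))"

text \<open>H^1(a,b): L^2 functions which agree a.e. with an absolutely continuous
  function F(x) = F(a) + int_a^x g with g in L^2 (standard characterisation of the
  Sobolev space H^1 on a bounded interval).\<close>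

definition H1 :: "real \<Rightarrow> real \<Rightarrow> (real \<Rightarrow> complex) \<Rightarrow> bool" where
  "H1 a b f \<longleftrightarrow> L2 a b f \<and> (\<exists>g F. L2 a b g \<and> continuous_on {a..b} F
      \<and> (\<forall>x\<in>{a..b}. F x = F a + integral\<^sup>L (lebesgue_on {a..x}) g)
      \<and> (AE x in lebesgue_on {a..b}. f x = F x))"

definition crep :: "real \<Rightarrow> real \<Rightarrow> (real \<Rightarrow> complex) \<Rightarrow> real \<Rightarrow> complex" where
  "crep a b f = (SOME F. continuous_on {a..b} F \<and> (AE x in lebesgue_on {a..b}. f x = F x))"

definition wd :: "real \<Rightarrow> real \<Rightarrow> (real \<Rightarrow> complex) \<Rightarrow> real \<Rightarrow> complex" where
  "wd a b f = (SOME g. L2 a b g \<and>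
     (\<forall>x\<in>{a..b}. crep a b f x = crep a b f a + integral\<^sup>L (lebesgue_on {a..x}) g))"

definition H2 :: "real \<Rightarrow> real \<Rightarrow> (real \<Rightarrow> complex) \<Rightarrow> bool" where
  "H2 a b f \<longleftrightarrow> H1 a b f \<and> H1 a b (wd a b f)"

definition H10 :: "real \<Rightarrow> real \<Rightarrow> (real \<Rightarrow> complex) \<Rightarrow> bool" where
  "H10 a b f \<longleftrightarrow> H1 a b f \<and> crep a b f a = 0 \<and> crep a b f b = 0"

datatype st = St (cu1: "real \<Rightarrow> complex") (cu2: "real \<Rightarrow> complex")
  (cv1: "real \<Rightarrow> complex") (cv2: "real \<Rightarrow> complex")
  (cth: "real \<Rightarrow> complex") (cq: "real \<Rightarrow> complex")

definition st_lin :: "complex \<Rightarrow> st \<Rightarrow> complex \<Rightarrow> st \<Rightarrow> st" where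
  "st_lin a y b z = St (\<lambda>x. a * cu1 y x + b * cu1 z x) (\<lambda>x. a * cu2 y x + b * cu2 z x)
     (\<lambda>x. a * cv1 y x + b * cv1 z x) (\<lambda>x. a * cv2 y x + b * cv2 z x)
     (\<lambda>x. a * cth y x + b * cth z x) (\<lambda>x. a * cq y x + b * cq z x)"

definition st_diff :: "st \<Rightarrow> st \<Rightarrow> st" where
  "st_diff y z = st_lin 1 y (-1) z"

definition inV :: "prm \<Rightarrow> (real \<Rightarrow> complex) \<Rightarrow> (real \<Rightarrow> complex) \<Rightarrow> bool" where
  "inV P f1 f2 \<longleftrightarrow> H1 0 (ell1 P) f1 \<and> H2 0 (ell2 P) f2
     \<and> crep 0 (ell1 P) f1 (ell1 P) = 0 \<and> crep 0 (ell2 P) f2 (ell2 P) = 0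
     \<and> crep 0 (ell1 P) f1 0 = crep 0 (ell2 P) f2 0
     \<and> crep 0 (ell2 P) (wd 0 (ell2 P) f2) 0 = 0"

definition inH :: "prm \<Rightarrow> st \<Rightarrow> bool" where
  "inH P y \<longleftrightarrow> inV P (cu1 y) (cu2 y) \<and> L2 0 (ell1 P) (cv1 y) \<and> L2 0 (ell2 P) (cv2 y)
     \<and> L2 0 (ell2 P) (cth y) \<and> L2 0 (ell2 P) (cq y)"

definition Heq :: "prm \<Rightarrow> st \<Rightarrow> st \<Rightarrow> bool" where
  "Heq P y z \<longleftrightarrow>
     (AE x in lebesgue_on {0..ell1 P}. cu1 y x = cu1 z x)
   \<and> (AE x in lebesgue_on {0..ell2 P}. cu2 y x = cu2 z x)
   \<and> (AE x in lebesgue_on {0..ell1 P}. cv1 y x = cv1 z x)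
   \<and> (AE x in lebesgue_on {0..ell2 P}. cv2 y x = cv2 z x)
   \<and> (AE x in lebesgue_on {0..ell2 P}. cth y x = cth z x)
   \<and> (AE x in lebesgue_on {0..ell2 P}. cq y x = cq z x)"

abbreviation d1 :: "prm \<Rightarrow> (real \<Rightarrow> complex) \<Rightarrow> real \<Rightarrow> complex" where
  "d1 P f \<equiv> wd 0 (ell1 P) f"
abbreviation d2 :: "prm \<Rightarrow> (real \<Rightarrow> complex) \<Rightarrow> real \<Rightarrow> complex" where
  "d2 P f \<equiv> wd 0 (ell2 P) f"

definition Hnorm :: "prm \<Rightarrow> st \<Rightarrow> real" where
  "Hnorm P y = sqrt (alpha1 P * (l2norm 0 (ell1 P) (d1 P (cu1 y)))\<^sup>2 + (l2norm 0 (ell1 P) (cv1 y))\<^sup>2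
     + delta2 P / beta2 P * (alpha2 P * (l2norm 0 (ell2 P) (d2 P (d2 P (cu2 y))))\<^sup>2
                              + (l2norm 0 (ell2 P) (cv2 y))\<^sup>2)
     + (l2norm 0 (ell2 P) (cth y))\<^sup>2
     + gamma2 P * tau2 P / kappa2 P * (l2norm 0 (ell2 P) (cq y))\<^sup>2)"

definition Hinner :: "prm \<Rightarrow> st \<Rightarrow> st \<Rightarrow> complex" where
  "Hinner P y z = of_real (alpha1 P) * l2inner 0 (ell1 P) (d1 P (cu1 y)) (d1 P (cu1 z))
     + l2inner 0 (ell1 P) (cv1 y) (cv1 z)
     + of_real (delta2 P / beta2 P) *
         (of_real (alpha2 P) * l2inner 0 (ell2 P) (d2 P (d2 P (cu2 y))) (d2 P (d2 P (cu2 z)))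
          + l2inner 0 (ell2 P) (cv2 y) (cv2 z))
     + l2inner 0 (ell2 P) (cth y) (cth z)
     + of_real (gamma2 P * tau2 P / kappa2 P) * l2inner 0 (ell2 P) (cq y) (cq z)"

definition wfun :: "prm \<Rightarrow> st \<Rightarrow> real \<Rightarrow> complex" where
  "wfun P y = (\<lambda>x. of_real (alpha2 P) * d2 P (d2 P (cu2 y)) x - of_real (beta2 P) * cth y x)"

definition inD :: "prm \<Rightarrow> st \<Rightarrow> bool" where
  "inD P y \<longleftrightarrow> inH P y \<and> H2 0 (ell1 P) (cu1 y) \<and> inV P (cv1 y) (cv2 y)
     \<and> H10 0 (ell2 P) (cth y) \<and> H1 0 (ell2 P) (cq y)
     \<and> H2 0 (ell2 P) (wfun P y)
     \<and> crep 0 (ell2 P) (d2 P (d2 P (cu2 y))) (ell2 P) = 0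
     \<and> of_real (delta2 P / beta2 P) * crep 0 (ell2 P) (d2 P (wfun P y)) 0
         = of_real (alpha1 P) * crep 0 (ell1 P) (d1 P (cu1 y)) 0"

definition A2 :: "prm \<Rightarrow> st \<Rightarrow> st" where
  "A2 P y = St (cv1 y) (cv2 y)
     (\<lambda>x. of_real (alpha1 P) * d1 P (d1 P (cu1 y)) x)
     (\<lambda>x. - d2 P (d2 P (wfun P y)) x)
     (\<lambda>x. - of_real (delta2 P) * d2 P (d2 P (cv2 y)) x - of_real (gamma2 P) * d2 P (cq y) x)
     (\<lambda>x. - of_real (1 / tau2 P) * cq y x - of_real (kappa2 P / tau2 P) * d2 P (cth y) x)"

definition in_resolvent :: "prm \<Rightarrow> complex \<Rightarrow> bool" where
  "in_resolvent P lam \<longleftrightarrow>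
     (\<forall>F. inH P F \<longrightarrow> (\<exists>y. inD P y \<and> Heq P (st_lin lam y (-1) (A2 P y)) F))
   \<and> (\<exists>C. \<forall>y. inD P y \<longrightarrow> Hnorm P y \<le> C * Hnorm P (st_lin lam y (-1) (A2 P y)))"

definition C0_contraction_semigroup_gen :: "prm \<Rightarrow> (real \<Rightarrow> st \<Rightarrow> st) \<Rightarrow> bool" where
  "C0_contraction_semigroup_gen P S \<longleftrightarrow>
     (\<forall>t y. 0 \<le> t \<longrightarrow> inH P y \<longrightarrow> inH P (S t y))
   \<and> (\<forall>t y z. 0 \<le> t \<longrightarrow> inH P y \<longrightarrow> inH P z \<longrightarrow> Heq P y z \<longrightarrow> Heq P (S t y) (S t z))
   \<and> (\<forall>t a b y z. 0 \<le> t \<longrightarrow> inH P y \<longrightarrow> inH P z \<longrightarrow>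
         Heq P (S t (st_lin a y b z)) (st_lin a (S t y) b (S t z)))
   \<and> (\<forall>y. inH P y \<longrightarrow> Heq P (S 0 y) y)
   \<and> (\<forall>t s y. 0 \<le> t \<longrightarrow> 0 \<le> s \<longrightarrow> inH P y \<longrightarrow> Heq P (S (t + s) y) (S t (S s y)))
   \<and> (\<forall>t y. 0 \<le> t \<longrightarrow> inH P y \<longrightarrow> Hnorm P (S t y) \<le> Hnorm P y)
   \<and> (\<forall>y. inH P y \<longrightarrow> ((\<lambda>t. Hnorm P (st_diff (S t y) y)) \<longlongrightarrow> 0) (at_right 0))
   \<and> (\<forall>y. inH P y \<longrightarrow>
        ((\<exists>z. inH P z \<and> ((\<lambda>t. Hnorm P (st_diff (st_lin (of_real (1/t)) (S t y) (- of_real (1/t)) y) z))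
                 \<longlongrightarrow> 0) (at_right 0)) \<longleftrightarrow> inD P y))
   \<and> (\<forall>y. inD P y \<longrightarrow>
        ((\<lambda>t. Hnorm P (st_diff (st_lin (of_real (1/t)) (S t y) (- of_real (1/t)) y) (A2 P y)))
           \<longlongrightarrow> 0) (at_right 0))"

definition strongly_stable :: "prm \<Rightarrow> (real \<Rightarrow> st \<Rightarrow> st) \<Rightarrow> bool" where
  "strongly_stable P S \<longleftrightarrow> (\<forall>y. inH P y \<longrightarrow> ((\<lambda>t. Hnorm P (S t y)) \<longlongrightarrow> 0) at_top)"

end

theory Submission
  imports Defs "HOL-Complex_Analysis.Great_Picard"
begin

text \<open>Integrating the equations explicitly shows that \<open>A2\<close> maps its domain onto the energy space, and the graph
  norm controls the \<open>H\<^sup>1\<close> norms of the six components \<open>u1', v1, u2'', v2, \<theta>, q\<close>, so bounded sets of the graph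
  norm are precompact. Dissipativity, surjectivity and precompactness alone give a bounded inverse and
  maximality; the semigroup is then the limit of the backward Euler scheme with dyadic steps.

  By precompactness of orbits, strong stability reduces to showing that an orbit of constant norm in the domain
  vanishes. On such an orbit the dissipation identity gives \<open>q = 0\<close>, and then the equations give
  \<open>\<theta> = 0\<close>, \<open>v2 = 0\<close> and \<open>u2''\<close> constant in time. A time increment of the orbit is hence a solution of
  the wave equation for the string with zero Cauchy data at the joint, and the multiplier \<open>(x - \<ell>\<^sub>1) u1'\<close>
  yields a functional decreasing at constant speed, which is impossible unless the increment is zero.
  Stability excludes imaginary eigenvalues, and with precompactness this puts the imaginary axis into the
  resolvent set.\<close>

section \<open>The Hilbert space of square integrable functions\<close>

text \<open>All of the analysis takes place in a real Hilbert space. The energy norm sees only u1',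
  v1, u2'', v2, theta and q, and the boundary conditions recover u1 and u2 from their derivatives.
  The energy space modulo \<open>Heq P\<close> thus becomes a closed subspace of one fixed type, and
  A2 an operator on that subspace. The inner product is the real part of the Hermitian one;
  multiplication by i survives as an isometry J commuting with the operator, and J x is orthogonal
  to x. On the imaginary axis the resolvent equation is then a bounded skew perturbation of a real
  problem.

  Two points shape the estimates. The derivative of w = alpha2 u2'' - beta2 theta is not part of the
  graph norm; it is bounded through w'' and its trace at the joint, which the transmission condition
  ties to u1'(0). And an orbit of constant norm could a priori carry a static bending u2'', in which
  case u1'(0) need not vanish and the multiplier on the string leaves a boundary term. Taking time
  increments removes the static part.\<close>

lemma borel_measurable_cnj [measurable (raw)]:
  "f \<in> borel_measurable M \<Longrightarrow> (\<lambda>x. cnj (f x)) \<in> borel_measurable M"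
  by (rule borel_measurable_continuous_on[OF continuous_on_cnj[OF continuous_on_id]])

lemma integral_mult_cnj_self:
  "(LINT t|M. f t * cnj (f t)) = of_real (LINT t|M. (cmod (f t))\<^sup>2)"
  by (simp only: complex_norm_square[symmetric] integral_complex_of_real)

definition sq_integrable :: "(real \<Rightarrow> complex) \<Rightarrow> bool" where
  "sq_integrable f \<longleftrightarrow> f \<in> borel_measurable lebesgue \<and> integrable lebesgue (\<lambda>x. (cmod (f x))\<^sup>2)"

lemma sq_integrable_mult:
  assumes "sq_integrable f" "sq_integrable g"
  shows "integrable lebesgue (\<lambda>x. f x * cnj (g x))"
proof (rule Bochner_Integration.integrable_bound[where f="\<lambda>x. (cmod (f x))\<^sup>2 + (cmod (g x))\<^sup>2"])
  show "integrable lebesgue (\<lambda>x. (cmod (f x))\<^sup>2 + (cmod (g x))\<^sup>2)"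
    using assms by (auto simp: sq_integrable_def)
  show "(\<lambda>x. f x * cnj (g x)) \<in> borel_measurable lebesgue"
    using assms unfolding sq_integrable_def
    by (intro borel_measurable_times borel_measurable_cnj) auto
  have "a * b \<le> a\<^sup>2 + b\<^sup>2" if "0 \<le> a" "0 \<le> b" for a b :: real
    using sum_squares_bound[of a b] that mult_nonneg_nonneg[of a b] by linarith
  then show "AE x in lebesgue. norm (f x * cnj (g x)) \<le> norm ((cmod (f x))\<^sup>2 + (cmod (g x))\<^sup>2)"
    by (simp add: norm_mult)
qed

lemma sq_integrable_add:
  assumes "sq_integrable f" "sq_integrable g"
  shows "sq_integrable (\<lambda>x. f x + g x)"
  unfolding sq_integrable_def
proof
  show "(\<lambda>x. f x + g x) \<in> borel_measurable lebesgue"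
    using assms by (auto simp: sq_integrable_def)
  show "integrable lebesgue (\<lambda>x. (cmod (f x + g x))\<^sup>2)"
  proof (rule Bochner_Integration.integrable_bound[where f="\<lambda>x. 2 * ((cmod (f x))\<^sup>2 + (cmod (g x))\<^sup>2)"])
    show "integrable lebesgue (\<lambda>x. 2 * ((cmod (f x))\<^sup>2 + (cmod (g x))\<^sup>2))"
      using assms by (auto simp: sq_integrable_def)
    show "(\<lambda>x. (cmod (f x + g x))\<^sup>2) \<in> borel_measurable lebesgue"
      using assms by (auto simp: sq_integrable_def)
    have "(cmod (a + b))\<^sup>2 \<le> 2 * ((cmod a)\<^sup>2 + (cmod b)\<^sup>2)" for a b
    proof -
      have "(cmod (a + b))\<^sup>2 \<le> (cmod a + cmod b)\<^sup>2"
        by (intro power_mono norm_triangle_ineq) auto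
      also have "\<dots> \<le> 2 * ((cmod a)\<^sup>2 + (cmod b)\<^sup>2)"
        using sum_squares_bound[of "cmod a" "cmod b"] by (simp add: power2_sum)
      finally show ?thesis .
    qed
    then show "AE x in lebesgue. norm ((cmod (f x + g x))\<^sup>2) \<le> norm (2 * ((cmod (f x))\<^sup>2 + (cmod (g x))\<^sup>2))"
      by simp
  qed
qed

lemma sq_integrable_cmult: "sq_integrable f \<Longrightarrow> sq_integrable (\<lambda>x. c * f x)"
  by (auto simp: sq_integrable_def norm_mult power_mult_distrib)

lemma sq_integrable_uminus: "sq_integrable f \<Longrightarrow> sq_integrable (\<lambda>x. - f x)"
  using sq_integrable_cmult[of f "-1"] by simp

lemma sq_integrable_diff: "sq_integrable f \<Longrightarrow> sq_integrable g \<Longrightarrow> sq_integrable (\<lambda>x. f x - g x)"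
  using sq_integrable_add[OF _ sq_integrable_uminus] by fastforce

lemma sq_integrable_zero: "sq_integrable (\<lambda>x. 0)"
  by (simp add: sq_integrable_def)

\<comment> \<open>Square integrability is taken over the whole line: the interval length is a
  parameter, on which a type cannot depend. Each interval enters later through extension by
  zero.\<close>
quotient_type l2 = "real \<Rightarrow> complex" / partial:
  "\<lambda>f g. sq_integrable f \<and> sq_integrable g \<and> (AE x in lebesgue. f x = g x)"
proof (rule part_equivpI)
  show "\<exists>x. sq_integrable x \<and> sq_integrable x \<and> (AE xa in lebesgue. x xa = x xa)"
    using sq_integrable_zero by auto
  show "symp (\<lambda>f g. sq_integrable f \<and> sq_integrable g \<and> (AE x in lebesgue. f x = g x))"
    by (auto intro!: sympI elim: eventually_mono)
  show "transp (\<lambda>f g. sq_integrable f \<and> sq_integrable g \<and> (AE x in lebesgue. f x = g x))"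
  proof (rule transpI)
    fix f g h
    assume "sq_integrable f \<and> sq_integrable g \<and> (AE x in lebesgue. f x = g x)"
      "sq_integrable g \<and> sq_integrable h \<and> (AE x in lebesgue. g x = h x)"
    moreover from this have "AE x in lebesgue. f x = g x" "AE x in lebesgue. g x = h x" by auto
    then have "AE x in lebesgue. f x = h x" by eventually_elim simp
    ultimately show "sq_integrable f \<and> sq_integrable h \<and> (AE x in lebesgue. f x = h x)"
      by blast
  qed
qed

text \<open>The Hilbert structure below is real; complex scalars are kept as a separate operation on
  classes, from which \<open>scaleR\<close> is derived.\<close>

lift_definition cscale :: "complex \<Rightarrow> l2 \<Rightarrow> l2" is "\<lambda>c f x. c * f x"
  by (auto intro: sq_integrable_cmult elim: eventually_mono)

instantiation l2 :: real_inner
begin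

lift_definition zero_l2 :: l2 is "\<lambda>x. 0"
  by (simp add: sq_integrable_zero)

lift_definition plus_l2 :: "l2 \<Rightarrow> l2 \<Rightarrow> l2" is "\<lambda>f g x. f x + g x"
  by (auto intro: sq_integrable_add elim: eventually_elim2)

lift_definition uminus_l2 :: "l2 \<Rightarrow> l2" is "\<lambda>f x. - f x"
  by (auto intro: sq_integrable_uminus elim: eventually_mono)

lift_definition minus_l2 :: "l2 \<Rightarrow> l2 \<Rightarrow> l2" is "\<lambda>f g x. f x - g x"
  by (auto intro: sq_integrable_diff elim: eventually_elim2)

definition scaleR_l2 :: "real \<Rightarrow> l2 \<Rightarrow> l2" where "scaleR_l2 r = cscale (of_real r)"

lift_definition inner_l2 :: "l2 \<Rightarrow> l2 \<Rightarrow> real" is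
  "\<lambda>f g. Re (integral\<^sup>L lebesgue (\<lambda>x. f x * cnj (g x)))"
proof (clarify, rule arg_cong[where f=Re], rule integral_cong_AE)
  fix f f' g g' :: "real \<Rightarrow> complex"
  assume *: "sq_integrable f" "sq_integrable f'" "sq_integrable g" "sq_integrable g'"
    "AE x in lebesgue. f x = f' x" "AE x in lebesgue. g x = g' x"
  show "(\<lambda>x. f x * cnj (g x)) \<in> borel_measurable lebesgue"
    "(\<lambda>x. f' x * cnj (g' x)) \<in> borel_measurable lebesgue"
    using * unfolding sq_integrable_def
    by (auto intro!: borel_measurable_times borel_measurable_cnj)
  show "AE x in lebesgue. f x * cnj (g x) = f' x * cnj (g' x)"
    using *(5,6) by eventually_elim simp
qed

definition norm_l2 :: "l2 \<Rightarrow> real" where "norm_l2 x = sqrt (inner x x)"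
definition sgn_l2 :: "l2 \<Rightarrow> l2" where "sgn_l2 x = inverse (norm x) *\<^sub>R x"
definition dist_l2 :: "l2 \<Rightarrow> l2 \<Rightarrow> real" where "dist_l2 x y = norm (x - y)"
definition uniformity_l2 :: "(l2 \<times> l2) filter" where
  "uniformity_l2 = (INF e\<in>{0<..}. principal {(x, y). dist x y < e})"
definition open_l2 :: "l2 set \<Rightarrow> bool" where
  "open_l2 U = (\<forall>x\<in>U. \<forall>\<^sub>F (x', y) in uniformity. x' = x \<longrightarrow> y \<in> U)"

instance
proof
  fix x y z :: l2 and a b r :: real and U :: "l2 set"
  show "x + y + z = x + (y + z)" by transfer (auto simp: add.assoc intro!: sq_integrable_add)
  show "x + y = y + x" by transfer (auto simp: add.commute intro!: sq_integrable_add)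
  show "0 + x = x" by transfer auto
  show "- x + x = 0" by transfer (auto simp: sq_integrable_zero)
  show "x - y = x + - y" by transfer (auto intro: sq_integrable_diff)
  show "a *\<^sub>R (x + y) = a *\<^sub>R x + a *\<^sub>R y"
    unfolding scaleR_l2_def by transfer (auto simp: distrib_left distrib_right intro!: sq_integrable_add sq_integrable_cmult)
  show "(a + b) *\<^sub>R x = a *\<^sub>R x + b *\<^sub>R x"
    unfolding scaleR_l2_def by transfer (auto simp: distrib_left distrib_right intro!: sq_integrable_add sq_integrable_cmult)
  show "a *\<^sub>R b *\<^sub>R x = (a * b) *\<^sub>R x"
    unfolding scaleR_l2_def by transfer (auto simp: mult.assoc intro!: sq_integrable_cmult)
  show "1 *\<^sub>R x = x" unfolding scaleR_l2_def by transfer auto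
  show "sgn x = inverse (norm x) *\<^sub>R x" by (simp add: sgn_l2_def)
  show "dist x y = norm (x - y)" by (simp add: dist_l2_def)
  show "norm x = sqrt (inner x x)" by (simp add: norm_l2_def)
  show "uniformity = (INF e\<in>{0<..}. principal {(x, y). dist (x::l2) y < e})"
    by (simp add: uniformity_l2_def)
  show "open U = (\<forall>x\<in>U. \<forall>\<^sub>F (x', y) in uniformity. x' = x \<longrightarrow> y \<in> U)"
    by (simp add: open_l2_def)
  show "inner x y = inner y x"
  proof (transfer, clarify)
    fix f g :: "real \<Rightarrow> complex"
    have "integral\<^sup>L lebesgue (\<lambda>x. f x * cnj (g x)) = cnj (integral\<^sup>L lebesgue (\<lambda>x. g x * cnj (f x)))"
      using Bochner_Integration.integral_cnj[of lebesgue "\<lambda>x. g x * cnj (f x)"] by (simp add: mult.commute)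
    then show "Re (LINT x|lebesgue. f x * cnj (g x)) = Re (LINT x|lebesgue. g x * cnj (f x))"
      by simp
  qed
  show "inner (x + y) z = inner x z + inner y z"
    by transfer (auto simp: algebra_simps sq_integrable_mult)
  show "inner (r *\<^sub>R x) y = r * inner x y"
    unfolding scaleR_l2_def by transfer (auto simp: mult.assoc)
  have *: "(LINT t|lebesgue. f t * cnj (f t)) = of_real (LINT t|lebesgue. (cmod (f t))\<^sup>2)" for f
    by (rule integral_mult_cnj_self)
  show "0 \<le> inner x x" by transfer (simp add: *)
  show "(inner x x = 0) = (x = 0)"
  proof (transfer, clarify)
    fix f assume f: "sq_integrable f"
    then have "(LINT t|lebesgue. (cmod (f t))\<^sup>2) = 0 \<longleftrightarrow> (AE t in lebesgue. (cmod (f t))\<^sup>2 = 0)"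
      by (intro integral_nonneg_eq_0_iff_AE) (auto simp: sq_integrable_def)
    then show "(Re (LINT x|lebesgue. f x * cnj (f x)) = 0) =
        (sq_integrable f \<and> sq_integrable (\<lambda>x. 0) \<and> (AE x in lebesgue. f x = 0))"
      using f by (simp add: * sq_integrable_zero)
  qed
qed

end

lemma norm_abs_l2:
  "sq_integrable f \<Longrightarrow> (norm (abs_l2 f))\<^sup>2 = (LINT t|lebesgue. (cmod (f t))\<^sup>2)"
proof -
  assume f: "sq_integrable f"
  have "(norm (abs_l2 f))\<^sup>2 = inner (abs_l2 f) (abs_l2 f)" by (rule power2_norm_eq_inner)
  also have "\<dots> = Re (LINT t|lebesgue. f t * cnj (f t))" using f by (intro inner_l2.abs_eq) auto
  also have "\<dots> = (LINT t|lebesgue. (cmod (f t))\<^sup>2)" by (simp add: integral_mult_cnj_self)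
  finally show ?thesis .
qed

lemma abs_l2_surj: obtains f where "sq_integrable f" "x = abs_l2 f"
  using Quotient3_abs_rep[OF Quotient3_l2, of x] Quotient3_rep_reflp[OF Quotient3_l2, of x] by metis

lemma abs_l2_diff: "sq_integrable f \<Longrightarrow> sq_integrable g \<Longrightarrow> abs_l2 f - abs_l2 g = abs_l2 (\<lambda>x. f x - g x)"
  by (simp add: minus_l2.abs_eq)

text \<open>Riesz-Fischer. A subsequence with geometrically small increments converges almost
  everywhere, and Fatou's lemma turns the pointwise limit into a limit in norm of the whole
  sequence.\<close>

instance l2 :: banach
proof
  fix X :: "nat \<Rightarrow> l2" assume X: "Cauchy X"
  have "\<exists>r. strict_mono r \<and> (\<forall>k. norm (X (r (Suc k)) - X (r k)) \<le> (1/2)^k)"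
  proof -
    have "\<exists>N. \<forall>m\<ge>N. \<forall>n\<ge>N. norm (X m - X n) < (1/2)^k" for k
      using X by (intro CauchyD) auto
    then obtain N where N: "\<And>k m n. m \<ge> N k \<Longrightarrow> n \<ge> N k \<Longrightarrow> norm (X m - X n) < (1/2)^k"
      by metis
    define r where "r k = (\<Sum>j\<le>k. N j + 1)" for k
    have "r k \<ge> N k" for k by (induct k) (auto simp: r_def)
    moreover have "r (Suc k) > r k" for k by (simp add: r_def)
    moreover then have "strict_mono r" by (simp add: strict_mono_Suc_iff)
    ultimately show ?thesis
      using N by (intro exI[of _ r]) (meson less_imp_le order.trans)
  qed
  then obtain r where r: "strict_mono r" "\<And>k. norm (X (r (Suc k)) - X (r k)) \<le> (1/2)^k" by blast
  have "\<exists>f. \<forall>n::nat. sq_integrable (f n) \<and> X n = abs_l2 (f n)"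
    by (intro choice allI) (metis abs_l2_surj)
  then obtain f where f: "\<And>n. sq_integrable (f n)" "\<And>n. X n = abs_l2 (f n)" by blast
  define d where "d k t = f (r (Suc k)) t - f (r k) t" for k t
  have d: "sq_integrable (d k)" for k
    unfolding d_def by (intro sq_integrable_diff f)
  have d2: "(LINT t|lebesgue. (cmod (d k t))\<^sup>2) \<le> (1/4)^k" for k
  proof -
    have "(LINT t|lebesgue. (cmod (d k t))\<^sup>2) = (norm (X (r (Suc k)) - X (r k)))\<^sup>2"
      using norm_abs_l2[OF d[of k]] unfolding d_def by (simp add: f abs_l2_diff)
    also have "\<dots> \<le> ((1/2)^k)\<^sup>2" by (intro power_mono r) auto
    also have "\<dots> = (1/4)^k" by (simp add: power2_eq_square flip: power_mult_distrib)
    finally show ?thesis .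
  qed
  \<comment> \<open>Summing with the weights \<open>2^k\<close> replaces Minkowski's inequality for infinite sums.\<close>
  have int: "integrable lebesgue (\<lambda>t. 2^k * (cmod (d k t))\<^sup>2)" for k
    using d[of k] by (auto simp: sq_integrable_def)
  have "(\<integral>\<^sup>+t. (\<Sum>k. ennreal (2^k * (cmod (d k t))\<^sup>2)) \<partial>lebesgue) =
      (\<Sum>k. \<integral>\<^sup>+t. ennreal (2^k * (cmod (d k t))\<^sup>2) \<partial>lebesgue)"
    using borel_measurable_integrable[OF int] by (intro nn_integral_suminf measurable_compose[OF _ measurable_ennreal])
  also have "\<dots> = (\<Sum>k. ennreal (LINT t|lebesgue. 2^k * (cmod (d k t))\<^sup>2))"
    by (intro suminf_cong nn_integral_eq_integral int) auto
  also have "\<dots> \<le> (\<Sum>k. ennreal ((1/2)^k))"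
  proof (intro suminf_le ennreal_leI)
    fix k
    have "(LINT t|lebesgue. 2^k * (cmod (d k t))\<^sup>2) \<le> 2^k * (1/4)^k"
      using d2[of k] by simp
    also have "\<dots> = (1/2)^k" by (simp flip: power_mult_distrib)
    finally show "(LINT t|lebesgue. 2^k * (cmod (d k t))\<^sup>2) \<le> (1/2)^k" .
  qed auto
  also have "\<dots> = ennreal (\<Sum>k. (1/2)^k)"
    by (intro suminf_ennreal2) (auto intro: summable_geometric)
  also have "\<dots> < \<infinity>" by simp
  finally have "AE t in lebesgue. (\<Sum>k. ennreal (2^k * (cmod (d k t))\<^sup>2)) \<noteq> \<infinity>"
    using borel_measurable_integrable[OF int]
    by (intro nn_integral_PInf_AE borel_measurable_suminf_order measurable_compose[OF _ measurable_ennreal]) auto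
  then have conv: "AE t in lebesgue. convergent (\<lambda>k. f (r k) t)"
  proof eventually_elim
    case (elim t)
    then have "summable (\<lambda>k. 2^k * (cmod (d k t))\<^sup>2)"
      by (intro summable_suminf_not_top) auto
    then have "(\<lambda>k. 2^k * (cmod (d k t))\<^sup>2) \<longlonglongrightarrow> 0" by (rule summable_LIMSEQ_zero)
    then have "Bseq (\<lambda>k. 2^k * (cmod (d k t))\<^sup>2)" by (intro convergent_imp_Bseq convergentI)
    then obtain C where C: "C > 0" "\<forall>k. norm (2^k * (cmod (d k t))\<^sup>2) \<le> C" by (rule BseqE)
    \<comment> \<open>The weighted square is bounded in k, so the increments decay like (1/sqrt 2)^k
      and are absolutely summable.\<close>
    have "cmod (d k t) \<le> sqrt C * (sqrt (1/2))^k" for k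
    proof (rule power2_le_imp_le)
      have "(cmod (d k t))\<^sup>2 \<le> C * (1/2)^k"
        using C(2)[rule_format, of k] by (simp add: field_simps power_divide)
      also have "\<dots> = (sqrt C * sqrt (1/2) ^ k)\<^sup>2"
      proof -
        have "(sqrt (1/2) ^ k)\<^sup>2 = ((sqrt (1/2))\<^sup>2) ^ k" by (simp only: power_mult[symmetric] mult.commute)
        also have "(sqrt (1/2))\<^sup>2 = (1/2::real)" by (rule real_sqrt_pow2) simp
        finally show ?thesis using C(1) by (simp only: power_mult_distrib real_sqrt_pow2[OF less_imp_le])
      qed
      finally show "(cmod (d k t))\<^sup>2 \<le> (sqrt C * sqrt (1/2) ^ k)\<^sup>2" .
    qed (use C(1) in auto)
    moreover have "summable (\<lambda>k. sqrt C * (sqrt (1/2))^k)"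
      by (intro summable_mult summable_geometric) (auto simp: real_sqrt_divide)
    ultimately have "summable (\<lambda>k. d k t)"
      using summable_comparison_test'[of "\<lambda>k. sqrt C * (sqrt (1/2))^k" 0 "\<lambda>k. d k t"] by blast
    then have "convergent (\<lambda>n. (\<Sum>k<n. d k t) + f (r 0) t)"
      by (intro convergent_add) (auto simp: summable_iff_convergent convergent_const)
    moreover have "(\<Sum>k<n. d k t) + f (r 0) t = f (r n) t" for n
      unfolding d_def by (subst sum_lessThan_telescope) simp
    ultimately show ?case by simp
  qed
  define g where "g t = lim (\<lambda>k. f (r k) t)" for t
  have lim: "AE t in lebesgue. (\<lambda>k. f (r k) t) \<longlonglongrightarrow> g t"
    using conv by eventually_elim (simp add: g_def convergent_LIMSEQ_iff)
  have gm: "g \<in> borel_measurable lebesgue"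
    unfolding g_def using f by (intro borel_measurable_lim_metric) (auto simp: sq_integrable_def)
  \<comment> \<open>Square integrability of g is still open here. Fatou along the subsequence gives
    it for g - f n together with the norm bound, and adding f n back gives it for g.\<close>
  have fatou: "sq_integrable (\<lambda>t. g t - f n t) \<and> (LINT t|lebesgue. (cmod (g t - f n t))\<^sup>2) \<le> e\<^sup>2"
    if "e > 0" and N: "\<And>m. m \<ge> N \<Longrightarrow> norm (X m - X n) \<le> e" for n e N
  proof -
    have m: "(\<lambda>t. (cmod (f (r k) t - f n t))\<^sup>2) \<in> borel_measurable lebesgue" for k
      using sq_integrable_diff[OF f(1)[of "r k"] f(1)[of n]] by (auto simp: sq_integrable_def)
    have "(\<integral>\<^sup>+t. ennreal ((cmod (g t - f n t))\<^sup>2) \<partial>lebesgue)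
        = (\<integral>\<^sup>+t. liminf (\<lambda>k. ennreal ((cmod (f (r k) t - f n t))\<^sup>2)) \<partial>lebesgue)"
    proof (rule nn_integral_cong_AE, use lim in eventually_elim)
      case (elim t)
      then have "(\<lambda>k. ennreal ((cmod (f (r k) t - f n t))\<^sup>2)) \<longlonglongrightarrow> ennreal ((cmod (g t - f n t))\<^sup>2)"
        by (intro tendsto_intros)
      then show ?case by (intro lim_imp_Liminf[symmetric] sequentially_bot)
    qed
    also have "\<dots> \<le> liminf (\<lambda>k. \<integral>\<^sup>+t. ennreal ((cmod (f (r k) t - f n t))\<^sup>2) \<partial>lebesgue)"
      using m by (intro nn_integral_liminf) auto
    also have "\<dots> = liminf (\<lambda>k. ennreal ((norm (X (r k) - X n))\<^sup>2))"
    proof (intro arg_cong[where f=liminf] ext)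
      fix k
      have *: "sq_integrable (\<lambda>t. f (r k) t - f n t)" by (intro sq_integrable_diff f)
      then have "(norm (X (r k) - X n))\<^sup>2 = (LINT t|lebesgue. (cmod (f (r k) t - f n t))\<^sup>2)"
        by (simp add: f abs_l2_diff norm_abs_l2)
      with * show "(\<integral>\<^sup>+t. ennreal ((cmod (f (r k) t - f n t))\<^sup>2) \<partial>lebesgue) = ennreal ((norm (X (r k) - X n))\<^sup>2)"
        by (simp add: nn_integral_eq_integral sq_integrable_def)
    qed
    also have "\<dots> \<le> ennreal (e\<^sup>2)"
    proof (rule Liminf_le)
      show "\<forall>\<^sub>F k in sequentially. ennreal ((norm (X (r k) - X n))\<^sup>2) \<le> ennreal (e\<^sup>2)"
        using seq_suble[OF r(1)] N
        by (intro eventually_sequentiallyI[of N] ennreal_leI power_mono) (meson order.trans, auto)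
    qed auto
    finally have *: "(\<integral>\<^sup>+t. ennreal ((cmod (g t - f n t))\<^sup>2) \<partial>lebesgue) \<le> ennreal (e\<^sup>2)" .
    have m': "(\<lambda>t. g t - f n t) \<in> borel_measurable lebesgue"
      using gm f(1)[of n] by (intro borel_measurable_diff) (auto simp: sq_integrable_def)
    have int: "integrable lebesgue (\<lambda>t. (cmod (g t - f n t))\<^sup>2)"
    proof (rule integrableI_bounded)
      show "(\<lambda>t. (cmod (g t - f n t))\<^sup>2) \<in> borel_measurable lebesgue" using m' by measurable
      have "(\<integral>\<^sup>+t. ennreal (norm ((cmod (g t - f n t))\<^sup>2)) \<partial>lebesgue) \<le> ennreal (e\<^sup>2)" using * by simp
      also have "\<dots> < \<infinity>" by simp
      finally show "(\<integral>\<^sup>+t. ennreal (norm ((cmod (g t - f n t))\<^sup>2)) \<partial>lebesgue) < \<infinity>" .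
    qed
    have "ennreal (LINT t|lebesgue. (cmod (g t - f n t))\<^sup>2) \<le> ennreal (e\<^sup>2)"
      using * int by (subst (asm) nn_integral_eq_integral) auto
    then show ?thesis using int m' by (simp add: sq_integrable_def)
  qed
  have Xb: "\<exists>N. \<forall>n\<ge>N. \<forall>m\<ge>N. norm (X m - X n) \<le> e" if "e > 0" for e
    using CauchyD[OF X that] less_imp_le by blast
  obtain N1 where "\<forall>n\<ge>N1. \<forall>m\<ge>N1. norm (X m - X n) \<le> 1" using Xb[of 1] by auto
  then have "sq_integrable (\<lambda>t. g t - f N1 t)" using fatou[of 1 N1 N1] by auto
  then have g: "sq_integrable g" using sq_integrable_add[OF _ f(1)[of N1]] by fastforce
  have "X \<longlonglongrightarrow> abs_l2 g"
  proof (rule LIMSEQ_I)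
    fix e :: real assume e: "e > 0"
    then obtain N where N: "\<forall>n\<ge>N. \<forall>m\<ge>N. norm (X m - X n) \<le> e/2" using Xb[of "e/2"] by auto
    have "norm (X n - abs_l2 g) < e" if "n \<ge> N" for n
    proof -
      have *: "sq_integrable (\<lambda>t. g t - f n t)" "(LINT t|lebesgue. (cmod (g t - f n t))\<^sup>2) \<le> (e/2)\<^sup>2"
        using fatou[of "e/2" N n] N that e by auto
      have "(norm (abs_l2 g - X n))\<^sup>2 \<le> (e/2)\<^sup>2"
        using * by (simp add: f abs_l2_diff g norm_abs_l2)
      then have "norm (abs_l2 g - X n) \<le> e/2" by (rule power2_le_imp_le) (use e in simp)
      then show ?thesis using e by (simp add: norm_minus_commute)
    qed
    then show "\<exists>no. \<forall>n\<ge>no. norm (X n - abs_l2 g) < e" by blast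
  qed
  then show "convergent X" by (rule convergentI)
qed

section \<open>Maximal dissipative operators and contraction semigroups\<close>

text \<open>Banach's fixed point theorem for x = B^-1 (f - K x), a contraction because C k < 1. The
  later uses take for K a real multiple of the identity or of multiplication by i.\<close>

lemma perturbed_surjective:
  fixes X D :: "'a::{real_normed_vector,complete_space} set"
  assumes "subspace X" "closed X" "D \<subseteq> X"
    and surj: "\<And>f. f \<in> X \<Longrightarrow> \<exists>x\<in>D. B x = f"
    and bd: "\<And>x y. x \<in> D \<Longrightarrow> y \<in> D \<Longrightarrow> norm (x - y) \<le> C * norm (B x - B y)"
    and K: "\<And>x. x \<in> X \<Longrightarrow> K x \<in> X" "\<And>x y. x \<in> X \<Longrightarrow> y \<in> X \<Longrightarrow> norm (K x - K y) \<le> k * norm (x - y)"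
    and "0 \<le> C" "0 \<le> k" "C * k < 1" "f \<in> X"
  shows "\<exists>x\<in>D. B x + K x = f"
proof -
  obtain G where G: "\<And>f. f \<in> X \<Longrightarrow> G f \<in> D" "\<And>f. f \<in> X \<Longrightarrow> B (G f) = f"
    using surj by metis
  define g where "g x = G (f - K x)" for x
  have X: "f - K x \<in> X" if "x \<in> X" for x
    using assms K that by (simp add: subspace_diff)
  have "\<exists>!x. x \<in> X \<and> g x = x"
  proof (rule Banach_fix)
    show "complete X" using \<open>closed X\<close> by (simp add: complete_eq_closed)
    show "X \<noteq> {}" using assms(11) by auto
    show "0 \<le> C * k" using assms by simp
    show "g ` X \<subseteq> X" using G X \<open>D \<subseteq> X\<close> by (auto simp: g_def)
    show "dist (g x) (g y) \<le> C * k * dist x y" if "x \<in> X" "y \<in> X" for x y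
    proof -
      have "norm (g x - g y) \<le> C * norm (K y - K x)"
        using bd[of "g x" "g y"] G X that by (simp add: g_def)
      also have "\<dots> \<le> C * (k * norm (y - x))"
        using K(2) that \<open>0 \<le> C\<close> by (intro mult_left_mono) auto
      finally show ?thesis by (simp add: dist_norm norm_minus_commute)
    qed
  qed fact
  then obtain x where x: "x \<in> X" "g x = x" by blast
  then have "x \<in> D" "B x = f - K x" using G X by (metis g_def)+
  then show ?thesis by (metis diff_add_cancel)
qed

lemma norm_add_diff_le:
  fixes a b c :: "'a::real_normed_vector"
  shows "norm (a + b - c) \<le> norm a + norm b + norm c"
  using norm_triangle_ineq4[of "a + b" c] norm_triangle_ineq[of a b] by linarith

lemma norm_diff_scaleR_squared:
  fixes a u :: "'a::real_inner"
  shows "(norm (a - t *\<^sub>R u))\<^sup>2 = (norm a)\<^sup>2 + t\<^sup>2 * (norm u)\<^sup>2 - 2 * t * inner a u"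
  unfolding power2_norm_eq_inner
  by (simp add: inner_diff_left inner_diff_right inner_commute[of u a] power2_eq_square algebra_simps)

text \<open>Projection onto the closure of D: a minimising sequence converges to a nearest point p,
  minimality makes z - p orthogonal to D, and z - p lies in X, where the hypothesis
  \<open>orth\<close> applies.\<close>

lemma subspace_closure_eq_of_orthogonal:
  fixes D :: "'a::{real_inner,complete_space} set"
  assumes "subspace D" and X: "subspace X" "D \<subseteq> X" "closed X"
    and orth: "\<And>z. z \<in> X \<Longrightarrow> (\<And>u. u \<in> D \<Longrightarrow> inner z u = 0) \<Longrightarrow> z = 0"
    and z: "z \<in> X"
  shows "z \<in> closure D"
proof -
  define d where "d = Inf ((\<lambda>u. norm (z - u)) ` D)"
  have "0 \<in> D" using assms(1) by (rule subspace_0)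
  then have ne: "(\<lambda>u. norm (z - u)) ` D \<noteq> {}" by blast
  have bb: "bdd_below ((\<lambda>u. norm (z - u)) ` D)" by (auto intro: bdd_belowI[of _ 0])
  have d: "d \<le> norm (z - u)" if "u \<in> D" for u
    unfolding d_def using bb that by (auto intro: cInf_lower)
  have d0: "0 \<le> d" unfolding d_def using ne by (auto intro: cInf_greatest)
  have "\<exists>u\<in>D. norm (z - u) < d + 1 / (Suc n)" for n :: nat
    using cInf_lessD[OF ne, of "d + 1 / (Suc n)"] by (auto simp flip: d_def)
  then obtain m where m: "\<And>n. m n \<in> D" "\<And>n. norm (z - m n) < d + 1 / (Suc n)" by metis
  \<comment> \<open>The midpoint of u and v lies in D, hence at distance at least d from z; the
    parallelogram identity then makes minimising sequences Cauchy.\<close>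
  have par: "(norm (u - v))\<^sup>2 \<le> 2 * (norm (z - u))\<^sup>2 + 2 * (norm (z - v))\<^sup>2 - 4 * d\<^sup>2"
    if "u \<in> D" "v \<in> D" for u v
  proof -
    have "(1/2) *\<^sub>R (u + v) \<in> D" using that assms(1) by (simp add: subspace_add subspace_scale)
    from d[OF this] have "d\<^sup>2 \<le> (norm (z - (1/2) *\<^sub>R (u + v)))\<^sup>2" using d0 by (intro power_mono)
    moreover have "(norm (u - v))\<^sup>2 + 4 * (norm (z - (1/2) *\<^sub>R (u + v)))\<^sup>2
      = 2 * (norm (z - u))\<^sup>2 + 2 * (norm (z - v))\<^sup>2"
    proof -
      define a where "a = z - u"
      define b where "b = z - v"
      have 1: "(norm (a - b))\<^sup>2 + (norm (a + b))\<^sup>2 = 2 * (norm a)\<^sup>2 + 2 * (norm b)\<^sup>2"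
        by (simp add: power2_norm_eq_inner inner_diff_left inner_diff_right inner_add_left inner_add_right)
      have "a + b = 2 *\<^sub>R (z - (1/2) *\<^sub>R (u + v))"
        by (simp add: a_def b_def algebra_simps scaleR_2)
      then have 2: "(norm (a + b))\<^sup>2 = 4 * (norm (z - (1/2) *\<^sub>R (u + v)))\<^sup>2"
        by (simp add: power_mult_distrib)
      have "a - b = v - u" by (simp add: a_def b_def)
      then have "norm (a - b) = norm (u - v)" by (metis norm_minus_commute)
      with 1 2 show ?thesis by (simp add: a_def b_def)
    qed
    ultimately show ?thesis by linarith
  qed
  have lim: "(\<lambda>n. (norm (z - m n))\<^sup>2) \<longlonglongrightarrow> d\<^sup>2"
  proof (rule tendsto_power, rule real_tendsto_sandwich[OF _ _ tendsto_const[of d]])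
    show "(\<lambda>n. d + 1 / real (Suc n)) \<longlonglongrightarrow> d"
      using LIMSEQ_inverse_real_of_nat_add[of d] by (simp only: inverse_eq_divide)
    show "\<forall>\<^sub>F n in sequentially. d \<le> norm (z - m n)" using d m(1) by (intro always_eventually) auto
    show "\<forall>\<^sub>F n in sequentially. norm (z - m n) \<le> d + 1 / real (Suc n)"
      using less_imp_le[OF m(2)] by (intro always_eventually) auto
  qed
  have "Cauchy m"
  proof (rule CauchyI)
    fix e :: real assume "e > 0"
    then have "\<forall>\<^sub>F n in sequentially. (norm (z - m n))\<^sup>2 < d\<^sup>2 + e\<^sup>2/4"
      using order_tendstoD(2)[OF lim] by auto
    then obtain N where N: "\<And>n. n \<ge> N \<Longrightarrow> (norm (z - m n))\<^sup>2 < d\<^sup>2 + e\<^sup>2/4"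
      by (auto simp: eventually_sequentially)
    have "norm (m i - m j) < e" if "i \<ge> N" "j \<ge> N" for i j
    proof (rule power2_less_imp_less)
      show "(norm (m i - m j))\<^sup>2 < e\<^sup>2" using par[OF m(1) m(1), of i j] N[OF that(1)] N[OF that(2)] by linarith
    qed (use \<open>e > 0\<close> in auto)
    then show "\<exists>M. \<forall>i\<ge>M. \<forall>j\<ge>M. norm (m i - m j) < e" by blast
  qed
  then obtain p where p: "m \<longlonglongrightarrow> p" by (auto simp: Cauchy_convergent_iff convergent_def)
  then have pD: "p \<in> closure D" using m by (auto simp: closure_sequential)
  have "(\<lambda>n. (norm (z - m n))\<^sup>2) \<longlonglongrightarrow> (norm (z - p))\<^sup>2" by (intro tendsto_intros p)
  then have dp: "d\<^sup>2 = (norm (z - p))\<^sup>2" using lim LIMSEQ_unique by blast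
  have dc: "d\<^sup>2 \<le> (norm (z - (p + t *\<^sub>R u)))\<^sup>2" if u: "u \<in> D" for t u
  proof -
    have w: "m n + t *\<^sub>R u \<in> D" for n using m(1) u assms(1) by (simp add: subspace_add subspace_scale)
    have "(\<lambda>n. (norm (z - (m n + t *\<^sub>R u)))\<^sup>2) \<longlonglongrightarrow> (norm (z - (p + t *\<^sub>R u)))\<^sup>2"
      by (intro tendsto_intros p)
    then show ?thesis
      by (rule LIMSEQ_le_const) (use d[OF w] d0 in \<open>auto intro!: power_mono\<close>)
  qed
  have "z - p = 0"
  proof (rule orth)
    have "closure D \<subseteq> X" using X by (simp add: closure_minimal)
    then show "z - p \<in> X" using z pD X by (auto intro: subspace_diff)
    fix u assume u: "u \<in> D"
    have q: "0 \<le> t\<^sup>2 * (norm u)\<^sup>2 - 2 * t * inner (z - p) u" for t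
    proof -
      from dc[OF u] have "(norm (z - p))\<^sup>2 \<le> (norm (z - (p + t *\<^sub>R u)))\<^sup>2" by (simp add: dp)
      also have "\<dots> = (norm (z - p))\<^sup>2 + t\<^sup>2 * (norm u)\<^sup>2 - 2 * t * inner (z - p) u"
      proof -
        have "z - (p + t *\<^sub>R u) = (z - p) - t *\<^sub>R u" by simp
        then show ?thesis by (simp only: norm_diff_scaleR_squared)
      qed
      finally show ?thesis by simp
    qed
    show "inner (z - p) u = 0"
    proof (cases "u = 0")
      case False
      define i where "i = inner (z - p) u"
      \<comment> \<open>The value t = i / |u|^2 minimises the quadratic in \<open>q\<close>.\<close>
      have "0 \<le> (i / (norm u)\<^sup>2)\<^sup>2 * (norm u)\<^sup>2 - 2 * (i / (norm u)\<^sup>2) * i"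
        using q[of "i / (norm u)\<^sup>2"] by (simp add: i_def)
      also have "\<dots> = - (i\<^sup>2 / (norm u)\<^sup>2)"
        using False by (simp add: field_simps power2_eq_square)
      finally have "i\<^sup>2 / (norm u)\<^sup>2 \<le> 0" by simp
      then have "i = 0" using False by (simp add: divide_le_0_iff)
      then show ?thesis by (simp add: i_def)
    qed simp
  qed
  then show ?thesis using pD by simp
qed

section \<open>Dissipative operators: lower bounds and ranges\<close>

locale dissipative =
  fixes X D :: "'a::{real_inner,banach} set" and A :: "'a \<Rightarrow> 'a"
  assumes subX: "subspace X" and closedX: "closed X" and subD: "subspace D" and DX: "D \<subseteq> X"
    and AX: "\<And>x. x \<in> D \<Longrightarrow> A x \<in> X"
    and A_add: "\<And>x y. x \<in> D \<Longrightarrow> y \<in> D \<Longrightarrow> A (x + y) = A x + A y"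
    and A_scale: "\<And>x r. x \<in> D \<Longrightarrow> A (r *\<^sub>R x) = r *\<^sub>R A x"
    and diss: "\<And>x. x \<in> D \<Longrightarrow> inner (A x) x \<le> 0"
begin

lemma A_minus: "x \<in> D \<Longrightarrow> y \<in> D \<Longrightarrow> A (x - y) = A x - A y"
  using A_add[of x "(-1) *\<^sub>R y"] A_scale[of y "-1"] subspace_scale[OF subD, of y "-1"] by simp

lemma A_zero: "A 0 = 0"
  using A_minus[of 0 0] subspace_0[OF subD] by simp

lemma dissipative_lower_bound:
  assumes "x \<in> D" "0 < l"
  shows "norm x \<le> (1 / l) * norm (l *\<^sub>R x - A x)"
proof (cases "x = 0")
  case False
  have "l * (norm x)\<^sup>2 \<le> inner (l *\<^sub>R x - A x) x"
    using diss[OF assms(1)] by (simp add: inner_diff_left power2_norm_eq_inner)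
  also have "\<dots> \<le> norm (l *\<^sub>R x - A x) * norm x" by (rule norm_cauchy_schwarz)
  finally have "l * norm x \<le> norm (l *\<^sub>R x - A x)"
    using False by (simp add: power2_eq_square)
  then show ?thesis using assms(2) by (simp add: field_simps)
qed (use assms in simp)

lemma dissipative_contraction:
  assumes "x \<in> D" "0 \<le> h"
  shows "norm x \<le> norm (x - h *\<^sub>R A x)"
proof (cases "h = 0")
  case False
  then have "norm x \<le> h * norm ((1/h) *\<^sub>R x - A x)"
    using dissipative_lower_bound[OF assms(1), of "1/h"] assms(2) by simp
  also have "\<dots> = norm (h *\<^sub>R ((1/h) *\<^sub>R x - A x))" using assms(2) by simp
  also have "h *\<^sub>R ((1/h) *\<^sub>R x - A x) = x - h *\<^sub>R A x"
    using False by (simp add: algebra_simps)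
  finally show ?thesis .
qed simp

text \<open>At the parameter l the inverse has Lipschitz constant 1/l, so a shift by |m - l| < l is
  an admissible perturbation. This is the window 0 < m < 2 l.\<close>

lemma range_shift:
  assumes l: "0 < l" "\<And>f. f \<in> X \<Longrightarrow> \<exists>x\<in>D. l *\<^sub>R x - A x = f" and m: "0 < m" "m < 2 * l" and f: "f \<in> X"
  shows "\<exists>x\<in>D. m *\<^sub>R x - A x = f"
proof -
  have "\<exists>x\<in>D. (l *\<^sub>R x - A x) + (m - l) *\<^sub>R x = f"
  proof (rule perturbed_surjective[where X=X and C="1/l" and k="\<bar>m - l\<bar>"])
    show "norm (x - y) \<le> 1/l * norm (l *\<^sub>R x - A x - (l *\<^sub>R y - A y))" if "x \<in> D" "y \<in> D" for x y
    proof -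
      have "l *\<^sub>R x - A x - (l *\<^sub>R y - A y) = l *\<^sub>R (x - y) - A (x - y)"
        unfolding A_minus[OF that] by (simp add: algebra_simps)
      then show ?thesis
        using dissipative_lower_bound[of "x - y" l] that l(1) subD by (simp add: subspace_diff)
    qed
    show "norm ((m - l) *\<^sub>R x - (m - l) *\<^sub>R y) \<le> \<bar>m - l\<bar> * norm (x - y)" for x y
      by (simp flip: scaleR_diff_right)
    show "1 / l * \<bar>m - l\<bar> < 1" using l m by (simp add: field_simps abs_less_iff)
  qed (use subX closedX DX l m f in \<open>auto simp: subspace_scale\<close>)
  then show ?thesis by (simp add: algebra_simps)
qed

text \<open>Growing by the factor 3/2, which stays below the admissible 2, reaches a parameter above
  m; one more shift then comes down to m, however small m is.\<close>

lemma range_all: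
  assumes l: "0 < l" "\<And>f. f \<in> X \<Longrightarrow> \<exists>x\<in>D. l *\<^sub>R x - A x = f" and m: "0 < m" and f: "f \<in> X"
  shows "\<exists>x\<in>D. m *\<^sub>R x - A x = f"
proof -
  define P where "P m \<longleftrightarrow> (\<forall>f\<in>X. \<exists>x\<in>D. m *\<^sub>R x - A x = f)" for m
  have "P ((3/2)^n * l)" for n :: nat
  proof (induct n)
    case 0 then show ?case using l by (simp add: P_def)
  next
    case (Suc n)
    have "\<exists>x\<in>D. ((3/2)^Suc n * l) *\<^sub>R x - A x = f" if "f \<in> X" for f
      by (rule range_shift[of "(3/2)^n * l"]) (use Suc l(1) that in \<open>auto simp: P_def\<close>)
    then show ?case by (simp add: P_def)
  qed
  moreover obtain n where "m / l < (3/2)^n" using real_arch_pow[of "3/2" "m/l"] by auto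
  moreover from this have "m < (3/2)^n * l" "0 < (3/2)^n * l" using l(1) m by (simp_all add: field_simps)
  then have "m < 2 * ((3/2)^n * l)" by linarith
  ultimately show ?thesis
    using l(1) m f by (intro range_shift[of "(3/2)^n * l" m f]) (simp_all add: P_def)
qed

end

section \<open>Resolvents of a maximal dissipative operator\<close>

locale m_dissipative = dissipative +
  assumes range1: "\<And>f. f \<in> X \<Longrightarrow> \<exists>x\<in>D. x - A x = f"
begin

text \<open>The implicit Euler step (I - h A)^-1. At h = 0 the equation x = f has no solution in D
  for general f, so the identity is prescribed; statements then cover 0 \<le> h, in particular the
  scheme at time 0.\<close>

definition Res :: "real \<Rightarrow> 'a \<Rightarrow> 'a" where
  "Res h f = (if h = 0 then f else (SOME x. x \<in> D \<and> x - h *\<^sub>R A x = f))"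

lemma Res:
  assumes "0 < h" "f \<in> X"
  shows "Res h f \<in> D" "Res h f - h *\<^sub>R A (Res h f) = f"
proof -
  have "(1/h) *\<^sub>R f \<in> X" using assms subX by (simp add: subspace_scale)
  then obtain x where x: "x \<in> D" "(1/h) *\<^sub>R x - A x = (1/h) *\<^sub>R f"
    using range_all[of 1 "1/h"] range1 assms by auto
  then have "h *\<^sub>R ((1/h) *\<^sub>R x - A x) = h *\<^sub>R ((1/h) *\<^sub>R f)" by simp
  then have "x - h *\<^sub>R A x = f" using assms by (simp add: algebra_simps)
  with x have "\<exists>x. x \<in> D \<and> x - h *\<^sub>R A x = f" by blast
  from someI_ex[OF this] show "Res h f \<in> D" "Res h f - h *\<^sub>R A (Res h f) = f"
    using assms by (auto simp: Res_def)
qed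

lemma Res_0 [simp]: "Res 0 f = f" by (simp add: Res_def)

lemma Res_unique:
  assumes "0 \<le> h" "x \<in> D" "x - h *\<^sub>R A x = f"
  shows "Res h f = x"
proof (cases "h = 0")
  case False
  then have h: "0 < h" using assms by simp
  have f: "f \<in> X" using assms DX AX subX by (metis subspace_diff subspace_scale subsetD)
  have "norm (Res h f - x) \<le> norm (Res h f - x - h *\<^sub>R A (Res h f - x))"
    using Res[OF h f] assms subD by (intro dissipative_contraction) (auto intro: subspace_diff)
  also have "\<dots> = norm ((Res h f - h *\<^sub>R A (Res h f)) - (x - h *\<^sub>R A x))"
    unfolding A_minus[OF Res(1)[OF h f] assms(2)] by (simp add: algebra_simps)
  also have "\<dots> = 0" using Res[OF h f] assms by simp
  finally show ?thesis by simp
qed (use assms in simp)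

text \<open>Linearity and contractivity are bundled because they pass together through compositions,
  powers and pointwise limits.\<close>

definition lin_contr :: "('a \<Rightarrow> 'a) \<Rightarrow> bool" where
  "lin_contr U \<longleftrightarrow> (\<forall>x\<in>X. U x \<in> X \<and> norm (U x) \<le> norm x) \<and> (\<forall>x\<in>X. \<forall>y\<in>X. U (x + y) = U x + U y)
     \<and> (\<forall>x\<in>X. \<forall>r. U (r *\<^sub>R x) = r *\<^sub>R U x)"

lemma lin_contrD:
  assumes "lin_contr U" "x \<in> X"
  shows "U x \<in> X" "norm (U x) \<le> norm x" "y \<in> X \<Longrightarrow> U (x + y) = U x + U y" "U (r *\<^sub>R x) = r *\<^sub>R U x"
    "y \<in> X \<Longrightarrow> U (x - y) = U x - U y"
proof -
  show "U x \<in> X" "norm (U x) \<le> norm x" "y \<in> X \<Longrightarrow> U (x + y) = U x + U y" "U (r *\<^sub>R x) = r *\<^sub>R U x"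
    using assms by (auto simp: lin_contr_def)
  show "U (x - y) = U x - U y" if "y \<in> X"
  proof -
    have y: "(-1) *\<^sub>R y \<in> X" using that subX by (rule subspace_scale[rotated])
    have "U (x + (-1) *\<^sub>R y) = U x + U ((-1) *\<^sub>R y)" "U ((-1) *\<^sub>R y) = (-1) *\<^sub>R U y"
      using assms y that unfolding lin_contr_def by blast+
    then show ?thesis by simp
  qed
qed

lemma lin_contr_dist: "lin_contr U \<Longrightarrow> x \<in> X \<Longrightarrow> y \<in> X \<Longrightarrow> norm (U x - U y) \<le> norm (x - y)"
  using lin_contrD(2)[of U "x - y"] lin_contrD(5)[of U x y] subX by (simp add: subspace_diff)

lemma lin_contr_id: "lin_contr (\<lambda>x. x)" by (simp add: lin_contr_def)

lemma lin_contr_comp: "lin_contr U \<Longrightarrow> lin_contr V \<Longrightarrow> lin_contr (\<lambda>x. U (V x))"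
  unfolding lin_contr_def by (auto intro: order.trans)

lemma lin_contr_pow: "lin_contr U \<Longrightarrow> lin_contr (U ^^ n)"
proof (induct n)
  case (Suc n)
  then show ?case using lin_contr_comp[of U "U ^^ n"] by (simp add: comp_def)
qed (simp add: lin_contr_def)

lemma commute_pow:
  assumes "lin_contr U" "lin_contr V" and "\<And>x. x \<in> X \<Longrightarrow> U (V x) = V (U x)" and "x \<in> X"
  shows "U ((V ^^ n) x) = (V ^^ n) (U x)"
proof (induct n)
  case (Suc n)
  have "(V ^^ n) x \<in> X" using lin_contr_pow[OF assms(2)] assms(4) by (rule lin_contrD)
  then show ?case using Suc assms(3) by simp
qed simp

text \<open>Telescoping: exchanging one factor U for V at a time costs at most
  \<open>norm (U x - V x)\<close>, because the factors commute and do not increase norms.\<close>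

lemma pow_diff:
  assumes U: "lin_contr U" and V: "lin_contr V" and c: "\<And>x. x \<in> X \<Longrightarrow> U (V x) = V (U x)" and x: "x \<in> X"
  shows "norm ((U ^^ n) x - (V ^^ n) x) \<le> n * norm (U x - V x)"
proof (induct n)
  case (Suc n)
  have Un: "(U ^^ n) x \<in> X" and Vn: "(V ^^ n) x \<in> X"
    using lin_contr_pow U V x lin_contrD(1) by blast+
  have "(U ^^ Suc n) x - (V ^^ Suc n) x
      = (U ((U ^^ n) x) - U ((V ^^ n) x)) + (U ((V ^^ n) x) - V ((V ^^ n) x))" by simp
  also have eqUV: "U ((V ^^ n) x) = (V ^^ n) (U x)" by (rule commute_pow[OF U V c x])
  also have "V ((V ^^ n) x) = (V ^^ n) (V x)" by (rule funpow_swap1)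
  finally have "norm ((U ^^ Suc n) x - (V ^^ Suc n) x)
      \<le> norm (U ((U ^^ n) x) - U ((V ^^ n) x)) + norm ((V ^^ n) (U x) - (V ^^ n) (V x))"
    unfolding eqUV by (simp only: norm_triangle_ineq)
  also have "\<dots> \<le> norm ((U ^^ n) x - (V ^^ n) x) + norm (U x - V x)"
    using lin_contr_dist[OF U Un Vn] lin_contr_dist[OF lin_contr_pow[OF V]] lin_contrD(1)[OF U x] lin_contrD(1)[OF V x]
    by (intro add_mono) auto
  finally show ?case using Suc by (simp add: algebra_simps)
qed simp

lemma Res_lin_contr: "0 \<le> h \<Longrightarrow> lin_contr (Res h)"
proof (cases "h = 0")
  case False
  assume "0 \<le> h" with False have h: "0 < h" by simp
  note R = Res[OF h]
  have "Res h x \<in> X" if "x \<in> X" for x using R that DX by auto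
  moreover have "norm (Res h x) \<le> norm x" if "x \<in> X" for x
    using dissipative_contraction[OF R(1)[OF that], of h] R(2)[OF that] h by simp
  moreover have "Res h (x + y) = Res h x + Res h y" if "x \<in> X" "y \<in> X" for x y
  proof (rule Res_unique)
    have "Res h x + Res h y - h *\<^sub>R A (Res h x + Res h y)
        = (Res h x - h *\<^sub>R A (Res h x)) + (Res h y - h *\<^sub>R A (Res h y))"
      using R that by (simp add: A_add algebra_simps)
    then show "Res h x + Res h y - h *\<^sub>R A (Res h x + Res h y) = x + y"
      using R(2) that by simp
  qed (use h R that subD in \<open>auto intro: subspace_add\<close>)
  moreover have "Res h (r *\<^sub>R x) = r *\<^sub>R Res h x" if "x \<in> X" for x r
  proof (rule Res_unique)
    have "r *\<^sub>R Res h x - h *\<^sub>R A (r *\<^sub>R Res h x) = r *\<^sub>R (Res h x - h *\<^sub>R A (Res h x))"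
      using R that by (simp add: A_scale algebra_simps)
    then show "r *\<^sub>R Res h x - h *\<^sub>R A (r *\<^sub>R Res h x) = r *\<^sub>R x"
      using R(2) that by simp
  qed (use h R that subD in \<open>auto intro: subspace_scale\<close>)
  ultimately show ?thesis by (simp add: lin_contr_def)
qed (simp add: lin_contr_def)

lemma Res_X: "0 \<le> h \<Longrightarrow> x \<in> X \<Longrightarrow> Res h x \<in> X"
  using Res_lin_contr lin_contrD(1) by blast

lemma Res_D: "0 \<le> h \<Longrightarrow> x \<in> D \<Longrightarrow> Res h x \<in> D"
  using Res(1)[of h x] DX by (cases "h = 0") auto

lemma Res_A:
  assumes "0 \<le> h" "x \<in> D"
  shows "A (Res h x) = Res h (A x)"
proof (cases "h = 0")
  case False
  then have h: "0 < h" using assms by simp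
  have xX: "x \<in> X" "A x \<in> X" using assms DX AX by auto
  note R = Res[OF h xX(1)] and L = lin_contrD[OF Res_lin_contr[OF assms(1)]]
  have "Res h (x - h *\<^sub>R A x) = x" using assms by (intro Res_unique) auto
  then have "Res h x - h *\<^sub>R Res h (A x) = x"
    using xX subX L by (simp add: subspace_scale)
  with R(2) have "Res h x - h *\<^sub>R A (Res h x) = Res h x - h *\<^sub>R Res h (A x)" by simp
  then have "h *\<^sub>R A (Res h x) = h *\<^sub>R Res h (A x)" by simp
  then show ?thesis using h by simp
qed simp

lemma Res_Res:
  assumes "0 \<le> h" "0 \<le> k" "x \<in> X"
  shows "Res h (Res k x) = Res k (Res h x)"
proof (cases "k = 0")
  case False
  then have k: "0 < k" using assms by simp
  note R = Res[OF k assms(3)] and L = lin_contrD[OF Res_lin_contr[OF assms(1)]]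
  have "Res h x = Res h (Res k x - k *\<^sub>R A (Res k x))" using R by simp
  also have "\<dots> = Res h (Res k x) - k *\<^sub>R A (Res h (Res k x))"
  proof -
    have X: "Res k x \<in> X" "A (Res k x) \<in> X" using R(1) DX AX by auto
    show ?thesis
      unfolding L(5)[OF X(1) subspace_scale[OF subX X(2)]] L(4)[OF X(2)] Res_A[OF assms(1) R(1)] ..
  qed
  finally have eq: "Res h x = Res h (Res k x) - k *\<^sub>R A (Res h (Res k x))" .
  show ?thesis
    by (rule Res_unique[symmetric, OF assms(2) Res_D[OF assms(1) R(1)] eq[symmetric]])
qed simp

text \<open>For z orthogonal to D, put R = \<open>Res 1 z\<close>, an element of D. Pairing z = R -
  A R with R and using dissipativity gives |R|^2 \<le> 0, hence R = 0 and z = 0.\<close>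

lemma dense: "z \<in> X \<Longrightarrow> z \<in> closure D"
proof (rule subspace_closure_eq_of_orthogonal[OF subD subX DX closedX])
  fix z assume z: "z \<in> X" "\<And>u. u \<in> D \<Longrightarrow> inner z u = 0"
  note R = Res[OF zero_less_one z(1)]
  have "inner (Res 1 z - 1 *\<^sub>R A (Res 1 z)) (Res 1 z) = 0" using R z(2) by simp
  then have "(norm (Res 1 z))\<^sup>2 \<le> 0"
    using diss[OF R(1)] by (simp add: inner_diff_left power2_norm_eq_inner)
  then have "Res 1 z = 0" by simp
  with R(2) show "z = 0" by (simp add: A_zero)
qed

text \<open>The domain of the square of A, on which the errors of the Euler scheme are of second
  order.\<close>

definition D2 where "D2 = {x \<in> D. A x \<in> D}"

lemma D2_D: "x \<in> D2 \<Longrightarrow> x \<in> D" "x \<in> D2 \<Longrightarrow> A x \<in> D" by (auto simp: D2_def)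

lemma Res_D2: "0 < h \<Longrightarrow> x \<in> D \<Longrightarrow> Res h x \<in> D2"
  using DX AX by (auto simp: D2_def Res_A intro!: Res)

lemma Res_near: "0 \<le> h \<Longrightarrow> x \<in> D \<Longrightarrow> norm (Res h x - x) \<le> h * norm (A x)"
proof -
  assume h: "0 \<le> h" and x: "x \<in> D"
  then have X: "x \<in> X" "A x \<in> X" using DX AX by auto
  have "Res h x - x = h *\<^sub>R Res h (A x)"
    using Res(2)[of h x] Res_A[OF h x] X h by (cases "h = 0") (auto simp: algebra_simps)
  then show ?thesis
    using lin_contrD(2)[OF Res_lin_contr[OF h] X(2)] h by (simp add: mult_left_mono)
qed

text \<open>Serves both \<open>Res\<close> and \<open>S\<close>: the linear estimate on D yields
  convergence on X, since D is dense and the maps are uniformly contractive.\<close>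

lemma contraction_family_tendsto:
  assumes U: "\<And>h. 0 \<le> h \<Longrightarrow> lin_contr (U h)" "\<And>h y. 0 \<le> h \<Longrightarrow> y \<in> D \<Longrightarrow> norm (U h y - y) \<le> h * norm (A y)"
    and x: "x \<in> X"
  shows "((\<lambda>h. U h x) \<longlongrightarrow> x) (at_right 0)"
proof (rule tendstoI)
  fix e :: real assume e: "e > 0"
  obtain y where y: "y \<in> D" "dist y x < e/3"
    using dense[OF x] e closure_approachable[of x D] by (metis divide_pos_pos zero_less_numeral)
  have "((\<lambda>h. h * norm (A y)) \<longlongrightarrow> 0 * norm (A y)) (at_right 0)" by (intro tendsto_intros)
  then have "\<forall>\<^sub>F h in at_right 0. h * norm (A y) < e/3"
    using e by (intro order_tendstoD) auto
  then show "\<forall>\<^sub>F h in at_right 0. dist (U h x) x < e"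
    using eventually_at_right_less[of "0::real"]
  proof eventually_elim
    case (elim h)
    have "norm (U h x - U h y) \<le> norm (x - y)"
      using elim y DX x by (intro lin_contr_dist U(1)) auto
    moreover have "norm (U h y - y) < e/3" using U(2)[of h y] elim y by simp
    ultimately show ?case
      using y(2) norm_triangle_ineq[of "U h x - U h y" "U h y - y"]
        norm_triangle_ineq[of "U h x - y" "y - x"]
      by (simp add: dist_norm norm_minus_commute)
  qed
qed

lemma Res_tendsto: "x \<in> X \<Longrightarrow> ((\<lambda>h. Res h x) \<longlongrightarrow> x) (at_right 0)"
  by (rule contraction_family_tendsto[OF Res_lin_contr Res_near])

text \<open>Density in the graph norm: \<open>Res h x\<close> lies in the domain of the square and A
  commutes with \<open>Res h\<close>, so x and A x are approximated at once.\<close>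

lemma D2_approx:
  assumes "x \<in> D" "0 < e"
  obtains y where "y \<in> D2" "norm (x - y) < e" "norm (A x - A y) < e"
proof -
  have X: "x \<in> X" "A x \<in> X" using assms DX AX by auto
  have "\<forall>\<^sub>F h in at_right 0. dist (Res h x) x < e" "\<forall>\<^sub>F h in at_right 0. dist (Res h (A x)) (A x) < e"
    using Res_tendsto X assms(2) by (auto intro: tendstoD)
  then have "\<forall>\<^sub>F h in at_right (0::real). 0 < h \<and> dist (Res h x) x < e \<and> dist (Res h (A x)) (A x) < e"
    using eventually_at_right_less[of "0::real"] by eventually_elim auto
  then obtain h where "0 < h" "dist (Res h x) x < e" "dist (Res h (A x)) (A x) < e"
    using eventually_happens'[OF trivial_limit_at_right_real] by blast
  then show ?thesis
    using that[of "Res h x"] assms Res_A[of h x] by (simp add: Res_D2 dist_norm norm_minus_commute)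
qed

lemma D2_dense:
  assumes "x \<in> X" "0 < e"
  obtains y where "y \<in> D2" "norm (x - y) < e"
proof -
  obtain z where z: "z \<in> D" "dist z x < e/2"
    using dense[OF assms(1)] assms(2) closure_approachable[of x D] by (metis half_gt_zero)
  obtain y where y: "y \<in> D2" "norm (z - y) < e/2"
    using D2_approx[OF z(1), of "e/2"] assms(2) by auto
  have "norm (x - y) < e"
    using z(2) y(2) norm_triangle_ineq[of "x - z" "z - y"] by (simp add: dist_norm norm_minus_commute)
  then show ?thesis using that y by blast
qed

text \<open>Each x n equals \<open>Res 1 (x n - A (x n))\<close> and \<open>Res 1\<close> is
  continuous on all of X, so the limit is \<open>Res 1 (l - m)\<close> and lies in D.\<close>

lemma A_closed:
  assumes "\<And>n::nat. x n \<in> D" "x \<longlonglongrightarrow> l" "(\<lambda>n. A (x n)) \<longlonglongrightarrow> m"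
  shows "l \<in> D" "A l = m"
proof -
  have X: "l \<in> X" "m \<in> X"
    using closed_sequentially[OF closedX, of x l] closed_sequentially[OF closedX, of "\<lambda>n. A (x n)" m] DX AX assms by auto
  then have lm: "l - m \<in> X" using subX by (simp add: subspace_diff)
  have xm: "x n - A (x n) \<in> X" for n using assms(1) DX AX subX by (auto intro: subspace_diff)
  have "(\<lambda>n. (x n - A (x n)) - (l - m)) \<longlonglongrightarrow> (l - m) - (l - m)" by (intro tendsto_intros assms)
  then have 0: "(\<lambda>n. norm ((x n - A (x n)) - (l - m))) \<longlonglongrightarrow> 0" by (simp add: tendsto_norm_zero)
  have "x n = Res 1 (x n - A (x n))" for n using assms(1) by (intro Res_unique[symmetric]) auto
  then have "norm (x n - Res 1 (l - m)) \<le> norm ((x n - A (x n)) - (l - m))" for n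
    using lin_contr_dist[OF Res_lin_contr[of 1] xm[of n] lm] by simp
  then have "(\<lambda>n. norm (x n - Res 1 (l - m))) \<longlonglongrightarrow> 0"
    by (intro tendsto_sandwich[OF _ _ tendsto_const 0]) auto
  then have "(\<lambda>n. x n - Res 1 (l - m)) \<longlonglongrightarrow> 0" by (rule tendsto_norm_zero_cancel)
  then have "x \<longlonglongrightarrow> Res 1 (l - m)" by (rule LIM_zero_cancel)
  then have l: "l = Res 1 (l - m)" using assms(2) LIMSEQ_unique by blast
  note R = Res[OF zero_less_one lm]
  show "l \<in> D" using R l by simp
  show "A l = m" using R(2) by (simp flip: l)
qed

text \<open>Since (I - b A)(I - a A) = I - (a + b) A + a b A^2, one step of length a + b and two
  successive steps differ by a term of order a b. Equal steps give convergence under halving,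
  unequal ones the semigroup law.\<close>

lemma Res_split_step:
  assumes "0 \<le> a" "0 \<le> b" "x \<in> D2"
  shows "norm (Res (a + b) x - Res a (Res b x)) \<le> a * b * norm (A (A x))"
proof -
  have X: "x \<in> X" "x \<in> D" "A x \<in> D" "A x \<in> X" "A (A x) \<in> X"
    using assms DX AX by (auto simp: D2_def)
  define p where "p = Res a (Res b x)"
  have pD: "p \<in> D" "A p = Res a (Res b (A x))" "A p \<in> D" "A (A p) = Res a (Res b (A (A x)))"
  proof -
    have b: "Res b x \<in> D" "A (Res b x) = Res b (A x)" "Res b (A x) \<in> D" "A (Res b (A x)) = Res b (A (A x))"
      using X assms by (simp_all add: Res_A Res_D)
    show "p \<in> D" "A p = Res a (Res b (A x))" "A p \<in> D" "A (A p) = Res a (Res b (A (A x)))"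
      using b assms by (simp_all add: p_def Res_A Res_D)
  qed
  have pX: "p \<in> X" "A p \<in> X" "A (A p) \<in> X" using pD(1) DX AX[OF pD(1)] AX[OF pD(3)] by auto
  have inv: "Res h y - h *\<^sub>R A (Res h y) = y" if "0 \<le> h" "y \<in> D" for h y
    using Res(2)[of h y] that DX by (cases "h = 0") auto
  have 1: "p - a *\<^sub>R A p = Res b x" using inv[of a "Res b x"] assms X by (simp add: p_def Res_D)
  have "x = (p - a *\<^sub>R A p) - b *\<^sub>R A (p - a *\<^sub>R A p)"
    using inv[of b x] assms X 1 by simp
  also have "\<dots> = (p - (a + b) *\<^sub>R A p) + (a * b) *\<^sub>R A (A p)"
    using pD subD by (simp add: A_minus A_scale subspace_scale algebra_simps)
  finally have x: "x - (p - (a + b) *\<^sub>R A p) = (a * b) *\<^sub>R A (A p)" by (simp add: algebra_simps)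
  have "Res (a + b) (p - (a + b) *\<^sub>R A p) = p" using assms pD by (intro Res_unique) auto
  then have "norm (Res (a + b) x - p) \<le> norm ((a * b) *\<^sub>R A (A p))"
    using lin_contr_dist[OF Res_lin_contr[of "a+b"], of x "p - (a + b) *\<^sub>R A p"] assms X pX subX x
    by (simp add: subspace_diff subspace_scale)
  also have "\<dots> \<le> a * b * norm (A (A x))"
  proof -
    have "norm (A (A p)) \<le> norm (A (A x))"
      unfolding pD(4) using lin_contrD(2)[OF lin_contr_comp[OF Res_lin_contr[of a] Res_lin_contr[of b]]] X assms by auto
    then show ?thesis using assms by (simp add: mult_left_mono)
  qed
  finally show ?thesis by (simp add: p_def)
qed

section \<open>The semigroup as limit of the backward Euler scheme\<close>

definition Euler :: "nat \<Rightarrow> real \<Rightarrow> 'a \<Rightarrow> 'a" where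
  "Euler n t = Res (t / 2^n) ^^ (2^n)"

definition S :: "real \<Rightarrow> 'a \<Rightarrow> 'a" where
  "S t x = lim (\<lambda>n. Euler n t x)"

lemma Euler_lin_contr: "0 \<le> t \<Longrightarrow> lin_contr (Euler n t)"
  unfolding Euler_def by (intro lin_contr_pow Res_lin_contr) simp

text \<open>Dyadic step numbers let consecutive approximations be compared step by step: each of the
  2^n steps is replaced by two of half the length, with defect at most (t / 2^(n+1))^2 |A^2 x|. The
  total is of order 2^-n and summable in n.\<close>

lemma Euler_step:
  assumes "0 \<le> t" "x \<in> D2"
  shows "norm (Euler (Suc n) t x - Euler n t x) \<le> t\<^sup>2 * norm (A (A x)) * (1/2)^n"
proof -
  let ?k = "t / 2 ^ Suc n"
  have h: "0 \<le> ?k" "t / 2^n = ?k + ?k" using assms by auto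
  have xX: "x \<in> X" using assms DX D2_D by auto
  have E: "Euler (Suc n) t x = ((Res ?k ^^ 2) ^^ (2^n)) x"
    unfolding Euler_def by (simp add: funpow_mult)
  have L: "lin_contr (Res ?k)" "lin_contr (Res (t / 2^n))" "lin_contr (Res ?k ^^ 2)"
    using assms by (auto intro!: Res_lin_contr lin_contr_pow simp del: power_Suc)
  have "norm (((Res ?k ^^ 2) ^^ (2^n)) x - (Res (t / 2^n) ^^ (2^n)) x)
      \<le> real (2^n) * norm ((Res ?k ^^ 2) x - Res (t / 2^n) x)"
  proof (rule pow_diff[OF L(3,2) _ xX])
    fix y assume y: "y \<in> X"
    show "(Res ?k ^^ 2) (Res (t / 2 ^ n) y) = Res (t / 2 ^ n) ((Res ?k ^^ 2) y)"
      by (rule commute_pow[OF L(2,1) _ y, symmetric]) (use assms in \<open>simp add: Res_Res\<close>)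
  qed
  also have "\<dots> \<le> real (2^n) * (?k * ?k * norm (A (A x)))"
    using Res_split_step[OF h(1) h(1) assms(2)] unfolding h(2)[symmetric]
    by (intro mult_left_mono) (auto simp: numeral_2_eq_2 norm_minus_commute)
  also have "\<dots> = t\<^sup>2 * norm (A (A x)) * (1/2)^n * (1/4)"
    by (simp add: power2_eq_square field_simps power_divide)
  also have "\<dots> \<le> t\<^sup>2 * norm (A (A x)) * (1/2)^n" by (intro mult_left_le) auto
  finally show ?thesis unfolding E by (simp only: Euler_def)
qed

text \<open>On \<open>D2\<close> the increments are summable; density of \<open>D2\<close> and
  uniform contractivity carry the Cauchy property over to X.\<close>

lemma Euler_convergent:
  assumes "0 \<le> t" "x \<in> X"
  shows "convergent (\<lambda>n. Euler n t x)"
proof -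
  have D2: "convergent (\<lambda>n. Euler n t y)" if "y \<in> D2" for y
  proof -
    have "summable (\<lambda>n. Euler (Suc n) t y - Euler n t y)"
    proof (rule summable_comparison_test)
      show "\<exists>N. \<forall>n\<ge>N. norm (Euler (Suc n) t y - Euler n t y) \<le> t\<^sup>2 * norm (A (A y)) * (1/2)^n"
        using Euler_step[OF assms(1) that] by blast
      show "summable (\<lambda>n. t\<^sup>2 * norm (A (A y)) * (1/2)^n)"
        by (intro summable_mult summable_geometric) auto
    qed
    then have "convergent (\<lambda>n. (\<Sum>k<n. Euler (Suc k) t y - Euler k t y) + Euler 0 t y)"
      by (intro convergent_add convergent_const) (simp add: summable_iff_convergent)
    then show ?thesis by (simp only: sum_lessThan_telescope[of "\<lambda>k. Euler k t y"] diff_add_cancel)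
  qed
  have "Cauchy (\<lambda>n. Euler n t x)"
  proof (rule CauchyI)
    fix e :: real assume e: "e > 0"
    obtain y where y: "y \<in> D2" "norm (x - y) < e/3" using D2_dense[OF assms(2), of "e/3"] e by auto
    then have yX: "y \<in> X" using D2_D DX by auto
    obtain M where M: "\<And>m n. m \<ge> M \<Longrightarrow> n \<ge> M \<Longrightarrow> norm (Euler m t y - Euler n t y) < e/3"
      using CauchyD[OF convergent_Cauchy[OF D2[OF y(1)]], of "e/3"] e by auto
    have c: "norm (Euler n t x - Euler n t y) < e/3" for n
      using lin_contr_dist[OF Euler_lin_contr[OF assms(1)] assms(2) yX, of n] y(2) by simp
    have "norm (Euler m t x - Euler n t x) < e" if "m \<ge> M" "n \<ge> M" for m n
    proof -
      have "Euler m t x - Euler n t x = (Euler m t x - Euler m t y) + (Euler m t y - Euler n t y) - (Euler n t x - Euler n t y)"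
        by simp
      then have "norm (Euler m t x - Euler n t x) \<le> norm (Euler m t x - Euler m t y) + norm (Euler m t y - Euler n t y) + norm (Euler n t x - Euler n t y)"
        by (simp only: norm_add_diff_le)
      then show ?thesis using c[of m] c[of n] M[OF that] by linarith
    qed
    then show "\<exists>M. \<forall>m\<ge>M. \<forall>n\<ge>M. norm (Euler m t x - Euler n t x) < e" by blast
  qed
  then show ?thesis by (rule Cauchy_convergent)
qed

lemma Euler_tendsto: "0 \<le> t \<Longrightarrow> x \<in> X \<Longrightarrow> (\<lambda>n. Euler n t x) \<longlonglongrightarrow> S t x"
  using Euler_convergent by (simp add: S_def convergent_LIMSEQ_iff)

lemma S_lin_contr: assumes "0 \<le> t" shows "lin_contr (S t)"
  unfolding lin_contr_def
proof (intro conjI ballI allI)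
  note L = lin_contrD[OF Euler_lin_contr[OF assms]] and T = Euler_tendsto[OF assms]
  fix x assume x: "x \<in> X"
  show "S t x \<in> X" by (rule closed_sequentially[OF closedX L(1)[OF x] T[OF x]])
  show "norm (S t x) \<le> norm x"
    by (rule LIMSEQ_le_const2[OF tendsto_norm[OF T[OF x]]]) (use L(2)[OF x] in auto)
  show "S t (r *\<^sub>R x) = r *\<^sub>R S t x" for r
  proof (rule LIMSEQ_unique)
    show "(\<lambda>n. Euler n t (r *\<^sub>R x)) \<longlonglongrightarrow> S t (r *\<^sub>R x)" using x subX by (intro T) (auto intro: subspace_scale)
    show "(\<lambda>n. Euler n t (r *\<^sub>R x)) \<longlonglongrightarrow> r *\<^sub>R S t x" unfolding L(4)[OF x] by (intro tendsto_intros T x)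
  qed
  fix y assume y: "y \<in> X"
  show "S t (x + y) = S t x + S t y"
  proof (rule LIMSEQ_unique)
    show "(\<lambda>n. Euler n t (x + y)) \<longlonglongrightarrow> S t (x + y)" using x y subX by (intro T) (auto intro: subspace_add)
    show "(\<lambda>n. Euler n t (x + y)) \<longlonglongrightarrow> S t x + S t y" unfolding L(3)[OF x y] by (intro tendsto_intros T x y)
  qed
qed

lemmas S_X = lin_contrD(1)[OF S_lin_contr] and S_contraction = lin_contrD(2)[OF S_lin_contr]
  and S_add = lin_contrD(3)[OF S_lin_contr] and S_scale = lin_contrD(4)[OF S_lin_contr]
  and S_diff = lin_contrD(5)[OF S_lin_contr]

lemma Euler_0: "Euler n 0 x = x"
proof -
  have "(Res 0 ^^ m) x = x" for m by (induct m) auto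
  then show ?thesis by (simp add: Euler_def)
qed

lemma S_0: "S 0 x = x"
  by (simp add: S_def Euler_0)

lemma tendsto_eq_of_dense:
  assumes "\<And>n::nat. lin_contr (U n)" "lin_contr V" "\<And>y. y \<in> D2 \<Longrightarrow> (\<lambda>n. U n y) \<longlonglongrightarrow> V y" "x \<in> X"
  shows "(\<lambda>n. U n x) \<longlonglongrightarrow> V x"
proof (rule LIMSEQ_I)
  fix e :: real assume e: "e > 0"
  obtain y where y: "y \<in> D2" "norm (x - y) < e/3" using D2_dense[OF assms(4), of "e/3"] e by auto
  then have yX: "y \<in> X" using D2_D DX by auto
  obtain M where M: "\<And>n. n \<ge> M \<Longrightarrow> norm (U n y - V y) < e/3"
    using LIMSEQ_D[OF assms(3)[OF y(1)], of "e/3"] e by auto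
  have "norm (U n x - V x) < e" if "n \<ge> M" for n
  proof -
    have "U n x - V x = (U n x - U n y) + (U n y - V y) - (V x - V y)" by simp
    then have "norm (U n x - V x) \<le> norm (U n x - U n y) + norm (U n y - V y) + norm (V x - V y)"
      by (simp only: norm_add_diff_le)
    then show ?thesis
      using lin_contr_dist[OF assms(1,4) yX, of n] lin_contr_dist[OF assms(2,4) yX] M[OF that] y(2) by linarith
  qed
  then show "\<exists>no. \<forall>n\<ge>no. norm (U n x - V x) < e" by blast
qed

text \<open>The resolvent with step (t + s)/2^n is compared with the product of those with steps
  t/2^n and s/2^n. On \<open>D2\<close> the 2^n defects of order t s / 4^n add up to order t s /
  2^n, and density does the rest.\<close>

lemma S_semigroup:
  assumes "0 \<le> t" "0 \<le> s" "x \<in> X"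
  shows "S (t + s) x = S t (S s x)"
proof -
  have pow_comp: "((\<lambda>x. U (V x)) ^^ n) x = (U ^^ n) ((V ^^ n) x)"
    if "lin_contr U" "lin_contr V" "\<And>x. x \<in> X \<Longrightarrow> U (V x) = V (U x)" "x \<in> X" for U V n x
  proof (induct n)
    case (Suc n)
    have "(V ^^ n) x \<in> X" using lin_contr_pow[OF that(2)] that(4) by (rule lin_contrD)
    then have "V ((U ^^ n) ((V ^^ n) x)) = (U ^^ n) (V ((V ^^ n) x))"
      using that by (intro commute_pow) auto
    then show ?case using Suc by simp
  qed simp
  have "(\<lambda>n. Euler n t (Euler n s x)) \<longlonglongrightarrow> S t (S s x)"
  proof -
    have "(\<lambda>n. norm (Euler n t (Euler n s x) - Euler n t (S s x))) \<longlonglongrightarrow> 0"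
    proof (rule tendsto_sandwich[OF _ _ tendsto_const])
      show "(\<lambda>n. norm (Euler n s x - S s x)) \<longlonglongrightarrow> 0"
        using Euler_tendsto[OF assms(2,3)] by (simp add: LIM_zero tendsto_norm_zero)
      show "\<forall>\<^sub>F n in sequentially. norm (Euler n t (Euler n s x) - Euler n t (S s x)) \<le> norm (Euler n s x - S s x)"
        using assms lin_contrD(1)[OF Euler_lin_contr] S_X
        by (intro always_eventually allI lin_contr_dist Euler_lin_contr) auto
    qed auto
    then have "(\<lambda>n. (Euler n t (Euler n s x) - Euler n t (S s x)) + Euler n t (S s x)) \<longlonglongrightarrow> 0 + S t (S s x)"
      using assms S_X by (intro tendsto_add Euler_tendsto) (auto intro: tendsto_norm_zero_cancel)
    then show ?thesis by simp
  qed
  moreover have "(\<lambda>n. Euler n t (Euler n s x)) \<longlonglongrightarrow> S (t + s) x"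
  proof (rule tendsto_eq_of_dense[where U="\<lambda>n x. Euler n t (Euler n s x)" and V="S (t + s)", OF _ _ _ assms(3)])
    show "lin_contr (\<lambda>x. Euler n t (Euler n s x))" for n
      by (rule lin_contr_comp[OF Euler_lin_contr[OF assms(1)] Euler_lin_contr[OF assms(2)]])
    show "lin_contr (S (t + s))" using assms by (intro S_lin_contr) auto
    fix y assume y: "y \<in> D2"
    then have yX: "y \<in> X" using D2_D DX by auto
    have "norm (Euler n (t + s) y - Euler n t (Euler n s y)) \<le> t * s * norm (A (A y)) * (1/2)^n" for n
    proof -
      let ?a = "t / 2^n" and ?b = "s / 2^n"
      have ab: "0 \<le> ?a" "0 \<le> ?b" using assms by auto
      have L: "lin_contr (Res ?a)" "lin_contr (Res ?b)" "lin_contr (Res (?a + ?b))" using ab by (auto intro: Res_lin_contr)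
      have "Euler n t (Euler n s y) = ((\<lambda>x. Res ?a (Res ?b x)) ^^ (2^n)) y"
        unfolding Euler_def using ab Res_Res by (intro pow_comp[OF L(1,2) _ yX, symmetric]) auto
      then have "norm (Euler n (t + s) y - Euler n t (Euler n s y))
          = norm ((Res (?a + ?b) ^^ (2^n)) y - ((\<lambda>x. Res ?a (Res ?b x)) ^^ (2^n)) y)"
        by (simp add: Euler_def add_divide_distrib)
      also have "\<dots> \<le> real (2^n) * norm (Res (?a + ?b) y - Res ?a (Res ?b y))"
        using ab by (intro pow_diff[OF L(3) lin_contr_comp[OF L(1,2)] _ yX]) (simp add: Res_Res Res_X)
      also have "\<dots> \<le> real (2^n) * (?a * ?b * norm (A (A y)))"
        by (intro mult_left_mono Res_split_step ab y) auto
      also have "\<dots> = t * s * norm (A (A y)) * (1/2)^n"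
        by (simp add: field_simps power_divide)
      finally show ?thesis .
    qed
    moreover have "(\<lambda>n. t * s * norm (A (A y)) * (1/2)^n) \<longlonglongrightarrow> 0"
      by (intro tendsto_mult_right_zero LIMSEQ_realpow_zero) auto
    ultimately have "(\<lambda>n. norm (Euler n (t + s) y - Euler n t (Euler n s y))) \<longlonglongrightarrow> 0"
      by (intro real_tendsto_sandwich[OF _ _ tendsto_const[of 0]
            \<open>(\<lambda>n. t * s * norm (A (A y)) * (1/2)^n) \<longlonglongrightarrow> 0\<close>] always_eventually allI) auto
    then have "(\<lambda>n. Euler n (t + s) y - (Euler n (t + s) y - Euler n t (Euler n s y))) \<longlonglongrightarrow> S (t + s) y - 0"
      using assms yX by (intro tendsto_diff Euler_tendsto) (auto intro: tendsto_norm_zero_cancel)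
    then show "(\<lambda>n. Euler n t (Euler n s y)) \<longlonglongrightarrow> S (t + s) y" by simp
  qed
  ultimately show ?thesis using LIMSEQ_unique by blast
qed

lemma Euler_D:
  assumes "0 \<le> t" "x \<in> D"
  shows "Euler n t x \<in> D" "A (Euler n t x) = Euler n t (A x)"
proof -
  have "(Res h ^^ m) x \<in> D \<and> A ((Res h ^^ m) x) = (Res h ^^ m) (A x)" if "0 \<le> h" for h m
    using that assms by (induct m) (auto simp: Res_D Res_A)
  then show "Euler n t x \<in> D" "A (Euler n t x) = Euler n t (A x)" using assms by (auto simp: Euler_def)
qed

lemma S_D:
  assumes "0 \<le> t" "x \<in> D"
  shows "S t x \<in> D" "A (S t x) = S t (A x)"
  using A_closed[of "\<lambda>n. Euler n t x" "S t x" "S t (A x)"] Euler_D[OF assms] Euler_tendsto[OF assms(1)] assms DX AX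
  by auto

lemma S_near:
  assumes "0 \<le> t" "x \<in> D"
  shows "norm (S t x - x) \<le> t * norm (A x)"
proof -
  have X: "x \<in> X" using assms DX by auto
  have "norm (Euler n t x - x) \<le> t * norm (A x)" for n
  proof -
    have "norm ((Res (t/2^n) ^^ (2^n)) x - ((\<lambda>x. x) ^^ (2^n)) x) \<le> real (2^n) * norm (Res (t/2^n) x - x)"
      by (intro pow_diff Res_lin_contr lin_contr_id X) (use assms in auto)
    also have "((\<lambda>x. x) ^^ (2^n)) x = x" by (simp add: id_def[symmetric])
    also have "real (2^n) * norm (Res (t/2^n) x - x) \<le> real (2^n) * (t/2^n * norm (A x))"
      using assms by (intro mult_left_mono Res_near) auto
    finally show ?thesis by (simp add: Euler_def)
  qed
  then show ?thesis
    by (intro LIMSEQ_le_const2[OF tendsto_norm[OF tendsto_diff[OF Euler_tendsto[OF assms(1) X] tendsto_const]]]) auto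
qed

text \<open>A Taylor bound whose remainder depends on the number of steps and their length only
  through the total time m h, so that it survives the limit of the scheme.\<close>

lemma Res_pow_expansion:
  assumes h: "0 \<le> h" and x: "x \<in> D2"
  shows "norm ((Res h ^^ m) x - x - (m * h) *\<^sub>R A x) \<le> (m * h)\<^sup>2 * norm (A (A x))"
proof (induct m)
  case (Suc m)
  have X: "x \<in> D" "A x \<in> D" "x \<in> X" "A x \<in> X" using x D2_D DX AX by auto
  let ?y = "(Res h ^^ m) x" and ?K = "norm (A (A x))"
  have y: "?y \<in> X" using lin_contr_pow[OF Res_lin_contr[OF h]] X(3) by (rule lin_contrD)
  note L = lin_contrD[OF Res_lin_contr[OF h]]
  have e1: "Res h x - x = h *\<^sub>R Res h (A x)"
    using Res(2)[of h x] Res_A[OF h X(1)] X h by (cases "h = 0") (auto simp: algebra_simps)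
  have "Res h (?y - x - (m * h) *\<^sub>R A x) = Res h ?y - Res h x - (m * h) *\<^sub>R Res h (A x)"
    using X y subX by (simp add: L subspace_diff subspace_scale)
  then have eq: "(Res h ^^ Suc m) x - x - (Suc m * h) *\<^sub>R A x
      = Res h (?y - x - (m * h) *\<^sub>R A x) + (Suc m * h) *\<^sub>R (Res h (A x) - A x)"
    using e1 by (simp add: algebra_simps)
  have "norm ((Res h ^^ Suc m) x - x - (Suc m * h) *\<^sub>R A x)
      \<le> norm (Res h (?y - x - (m * h) *\<^sub>R A x)) + norm ((Suc m * h) *\<^sub>R (Res h (A x) - A x))"
    unfolding eq by (rule norm_triangle_ineq)
  also have "\<dots> \<le> (m * h)\<^sup>2 * ?K + Suc m * h * (h * ?K)"
  proof (rule add_mono)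
    have "norm (Res h (?y - x - (m * h) *\<^sub>R A x)) \<le> norm (?y - x - (m * h) *\<^sub>R A x)"
      using X y subX by (intro L(2)) (auto intro: subspace_diff subspace_scale)
    then show "norm (Res h (?y - x - (m * h) *\<^sub>R A x)) \<le> (m * h)\<^sup>2 * ?K" using Suc by simp
    show "norm ((Suc m * h) *\<^sub>R (Res h (A x) - A x)) \<le> Suc m * h * (h * ?K)"
      using Res_near[OF h X(2)] h by (simp add: mult_left_mono)
  qed
  \<comment> \<open>The induction closes because m^2 + (m + 1) \<le> (m + 1)^2.\<close>
  also have "\<dots> = (m^2 + Suc m) * (h^2 * ?K)" by (simp add: power2_eq_square algebra_simps)
  also have "\<dots> \<le> (Suc m)^2 * (h^2 * ?K)"
    by (intro mult_right_mono mult_nonneg_nonneg) (auto simp: power2_eq_square algebra_simps)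
  finally show ?case by (simp add: power_mult_distrib mult.assoc)
qed simp

lemma S_expansion_D2:
  assumes "0 \<le> t" "x \<in> D2"
  shows "norm (S t x - x - t *\<^sub>R A x) \<le> t\<^sup>2 * norm (A (A x))"
proof -
  have X: "x \<in> X" using assms DX D2_D by auto
  have "norm (Euler n t x - x - t *\<^sub>R A x) \<le> t\<^sup>2 * norm (A (A x))" for n
    using Res_pow_expansion[of "t/2^n" x "2^n"] assms by (simp add: Euler_def)
  then show ?thesis
    by (intro LIMSEQ_le_const2[OF tendsto_norm[OF tendsto_diff[OF tendsto_diff[OF Euler_tendsto[OF assms(1) X] tendsto_const] tendsto_const]]]) auto
qed

text \<open>The quadratic remainder is available on \<open>D2\<close> only. A general x is compared
  with some y close to it in the graph norm: the difference x - y costs at most t |A x - A y| by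
  \<open>S_near\<close>, and as much again in the linear terms.\<close>

lemma S_differentiable:
  assumes x: "x \<in> D" and e: "0 < e"
  obtains d where "0 < d" "\<And>t. 0 \<le> t \<Longrightarrow> t < d \<Longrightarrow> norm (S t x - x - t *\<^sub>R A x) \<le> e * t"
proof -
  obtain y where y: "y \<in> D2" "norm (A x - A y) < e/3" using D2_approx[OF x, of "e/3"] e by auto
  \<comment> \<open>The summand 1 keeps the time bound e / (3 K) meaningful when A (A y) =
    0.\<close>
  define K where "K = norm (A (A y)) + 1"
  have "norm (S t x - x - t *\<^sub>R A x) \<le> e * t" if t: "0 \<le> t" "t < e / (3 * K)" for t
  proof -
    have D: "y \<in> D" "x - y \<in> D" "x \<in> X" "y \<in> X" using y x D2_D subD DX by (auto intro: subspace_diff)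
    have K: "K > 0" by (simp add: K_def add_nonneg_pos)
    have n1: "norm (S t (x - y) - (x - y)) \<le> t * (e/3)"
    proof -
      have "norm (A (x - y)) \<le> e/3" using y(2) A_minus[OF x D(1)] by simp
      then show ?thesis using S_near[OF t(1) D(2)] mult_left_mono[OF _ t(1)] order.trans by blast
    qed
    have "norm (S t y - y - t *\<^sub>R A y) \<le> t\<^sup>2 * norm (A (A y))" by (rule S_expansion_D2[OF t(1) y(1)])
    also have "\<dots> \<le> t * (t * K)" using t by (simp add: power2_eq_square K_def mult_left_mono mult.assoc)
    also have "\<dots> \<le> t * (e/3)" using t K by (intro mult_left_mono) (auto simp: field_simps)
    finally have n2: "norm (S t y - y - t *\<^sub>R A y) \<le> t * (e/3)" .
    have n3: "norm (t *\<^sub>R (A x - A y)) \<le> t * (e/3)"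
      using mult_left_mono[OF less_imp_le[OF y(2)] t(1)] t(1) by simp
    have "S t x - x - t *\<^sub>R A x = (S t (x - y) - (x - y)) + (S t y - y - t *\<^sub>R A y) - t *\<^sub>R (A x - A y)"
      using S_diff[OF t(1) D(3,4)] by (simp add: algebra_simps)
    then have "norm (S t x - x - t *\<^sub>R A x) \<le> norm (S t (x - y) - (x - y)) + norm (S t y - y - t *\<^sub>R A y) + norm (t *\<^sub>R (A x - A y))"
      by (simp only: norm_add_diff_le)
    then show ?thesis using n1 n2 n3 by (simp add: field_simps)
  qed
  moreover have "0 < e / (3 * K)" using e by (simp add: K_def add_nonneg_pos)
  ultimately show ?thesis using that by blast
qed

lemma S_generator:
  assumes "x \<in> D"
  shows "((\<lambda>t. (1/t) *\<^sub>R (S t x - x)) \<longlongrightarrow> A x) (at_right 0)"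
proof (rule tendstoI)
  fix e :: real assume e: "e > 0"
  then obtain d where d: "0 < d" "\<And>t. 0 \<le> t \<Longrightarrow> t < d \<Longrightarrow> norm (S t x - x - t *\<^sub>R A x) \<le> e/2 * t"
    using S_differentiable[OF assms, of "e/2"] by auto
  have "\<forall>\<^sub>F t in at_right 0. 0 < t \<and> t < d"
    using d(1) by (auto simp: eventually_at_right_field)
  then show "\<forall>\<^sub>F t in at_right 0. dist ((1/t) *\<^sub>R (S t x - x)) (A x) < e"
  proof eventually_elim
    case (elim t)
    have "(1/t) *\<^sub>R (S t x - x) - A x = (1/t) *\<^sub>R (S t x - x - t *\<^sub>R A x)"
      using elim by (simp add: algebra_simps)
    then have "dist ((1/t) *\<^sub>R (S t x - x)) (A x) = (1/t) * norm (S t x - x - t *\<^sub>R A x)"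
      using elim by (simp add: dist_norm)
    also have "\<dots> \<le> (1/t) * (e/2 * t)" using d(2)[of t] elim by (intro mult_left_mono) auto
    also have "\<dots> < e" using e elim by simp
    finally show ?case .
  qed
qed

lemma S_continuous_at_0: "x \<in> X \<Longrightarrow> ((\<lambda>t. S t x) \<longlongrightarrow> x) (at_right 0)"
  by (rule contraction_family_tendsto[OF S_lin_contr S_near])

text \<open>The generator cannot properly extend A. With y = \<open>Res 1 (x - z)\<close> in D, the
  difference w = x - y has an orbit whose right derivative at 0 is w itself, while contractivity
  makes the inner product of that derivative with w nonpositive.\<close>

lemma S_generator_domain:
  assumes x: "x \<in> X" and z: "z \<in> X" and lim: "((\<lambda>t. (1/t) *\<^sub>R (S t x - x)) \<longlongrightarrow> z) (at_right 0)"
  shows "x \<in> D"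
proof -
  have xz: "x - z \<in> X" using x z subX by (rule subspace_diff[rotated])
  note R = Res[OF zero_less_one xz]
  define y where "y = Res 1 (x - z)"
  have y: "y \<in> D" "y - A y = x - z" using R by (auto simp: y_def)
  have yX: "y \<in> X" using y DX by auto
  define w where "w = x - y"
  have wX: "w \<in> X" using x yX subX by (auto simp: w_def intro: subspace_diff)
  have "((\<lambda>t. (1/t) *\<^sub>R (S t x - x) - (1/t) *\<^sub>R (S t y - y)) \<longlongrightarrow> z - A y) (at_right 0)"
    by (intro tendsto_diff lim S_generator y)
  moreover have "z - A y = w" using y(2) by (simp add: w_def algebra_simps)
  moreover have "\<forall>\<^sub>F t in at_right 0. (1/t) *\<^sub>R (S t x - x) - (1/t) *\<^sub>R (S t y - y) = (1/t) *\<^sub>R (S t w - w)"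
    using eventually_at_right_less[of "0::real"]
    by eventually_elim (use x yX in \<open>simp add: w_def S_diff algebra_simps\<close>)
  ultimately have "((\<lambda>t. (1/t) *\<^sub>R (S t w - w)) \<longlongrightarrow> w) (at_right 0)"
    using tendsto_cong by force
  then have "((\<lambda>t. inner ((1/t) *\<^sub>R (S t w - w)) w) \<longlongrightarrow> inner w w) (at_right 0)"
    by (intro tendsto_intros)
  moreover have "\<forall>\<^sub>F t in at_right 0. inner ((1/t) *\<^sub>R (S t w - w)) w \<le> 0"
    using eventually_at_right_less[of "0::real"]
  proof eventually_elim
    case (elim t)
    have "inner (S t w) w \<le> norm (S t w) * norm w" by (rule norm_cauchy_schwarz)
    also have "\<dots> \<le> norm w * norm w" using S_contraction[of t w] elim wX by (intro mult_right_mono) auto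
    finally have "inner (S t w) w \<le> inner w w" by (simp add: power2_norm_eq_inner flip: power2_eq_square)
    then show ?case using elim by (simp add: inner_diff_left divide_le_0_iff)
  qed
  ultimately have "inner w w \<le> 0" by (rule tendsto_upperbound) simp
  then have "inner w w = 0" using inner_ge_zero[of w] by linarith
  then have "w = 0" by simp
  then show ?thesis using y by (simp add: w_def)
qed

lemma S_has_derivative:
  assumes x: "x \<in> D" and t: "0 \<le> t"
  shows "((\<lambda>t. S t x) has_vector_derivative S t (A x)) (at t within {0..})"
  unfolding has_vector_derivative_def has_derivative_within_alt
proof (intro conjI allI impI)
  show "bounded_linear (\<lambda>h. h *\<^sub>R S t (A x))" by (rule bounded_linear_scaleR_left)
  fix e :: real assume e: "e > 0"
  have X: "x \<in> X" "A x \<in> X" using x DX AX by auto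
  obtain d where d: "0 < d" "\<And>t. 0 \<le> t \<Longrightarrow> t < d \<Longrightarrow> norm (S t x - x - t *\<^sub>R A x) \<le> e/2 * t"
    using S_differentiable[OF x, of "e/2"] e by auto
  have "\<forall>\<^sub>F h in at_right 0. dist (S h (A x)) (A x) < e/2"
    using S_continuous_at_0[OF X(2)] e by (intro tendstoD) auto
  then obtain d' where d': "0 < d'" "\<And>h. 0 < h \<Longrightarrow> h < d' \<Longrightarrow> norm (S h (A x) - A x) < e/2"
    by (auto simp: eventually_at_right_field dist_norm)
  have "norm (S s x - S t x - (s - t) *\<^sub>R S t (A x)) \<le> e * \<bar>s - t\<bar>" if s: "0 \<le> s" "\<bar>s - t\<bar> < min d d'" for s
  proof (cases "t \<le> s")
    case True
    have "S s x = S t (S (s - t) x)" using S_semigroup[of t "s - t" x] t True X by simp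
    then have "S s x - S t x - (s - t) *\<^sub>R S t (A x) = S t (S (s - t) x - x - (s - t) *\<^sub>R A x)"
      using t True X subX S_X by (simp add: S_diff S_scale subspace_diff subspace_scale)
    then have "norm (S s x - S t x - (s - t) *\<^sub>R S t (A x)) \<le> norm (S (s - t) x - x - (s - t) *\<^sub>R A x)"
      using S_contraction[of t "S (s - t) x - x - (s - t) *\<^sub>R A x"] t True X subX S_X
      by (simp add: subspace_diff subspace_scale)
    also have "\<dots> \<le> e/2 * (s - t)" using d(2)[of "s - t"] s True by auto
    also have "\<dots> \<le> e * \<bar>s - t\<bar>" using e True by (simp add: mult_right_mono)
    finally show ?thesis .
  next
    \<comment> \<open>For the left difference quotient only \<open>S s\<close> can be factored out,
      which replaces A x by \<open>S h (A x)\<close>; strong continuity at 0 absorbs the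
      difference.\<close>
    case False
    define h where "h = t - s"
    have h: "0 < h" "h < d" "h < d'" using False s by (auto simp: h_def)
    have "S t x = S s (S h x)" "S t (A x) = S s (S h (A x))"
      using S_semigroup[of s h] s h X by (auto simp: h_def)
    then have "S s x - S t x - (s - t) *\<^sub>R S t (A x) = S s (h *\<^sub>R (S h (A x) - A x) - (S h x - x - h *\<^sub>R A x))"
    proof -
      have "S s (h *\<^sub>R (S h (A x) - A x) - (S h x - x - h *\<^sub>R A x))
          = h *\<^sub>R (S s (S h (A x)) - S s (A x)) - (S s (S h x) - S s x - h *\<^sub>R S s (A x))"
        using s h X subX S_X by (simp add: S_diff S_scale subspace_diff subspace_scale)
      also have "\<dots> = S s x - S s (S h x) - (s - t) *\<^sub>R S s (S h (A x))"
        by (simp add: h_def algebra_simps)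
      finally show ?thesis unfolding \<open>S t x = S s (S h x)\<close> \<open>S t (A x) = S s (S h (A x))\<close> ..
    qed
    then have "norm (S s x - S t x - (s - t) *\<^sub>R S t (A x)) \<le> norm (h *\<^sub>R (S h (A x) - A x) - (S h x - x - h *\<^sub>R A x))"
      using S_contraction[of s "h *\<^sub>R (S h (A x) - A x) - (S h x - x - h *\<^sub>R A x)"] s h X subX S_X
      by (simp add: subspace_diff subspace_scale)
    also have "\<dots> \<le> norm (h *\<^sub>R (S h (A x) - A x)) + norm (S h x - x - h *\<^sub>R A x)" by (rule norm_triangle_ineq4)
    also have "\<dots> \<le> h * (e/2) + e/2 * h"
      using d(2)[of h] d'(2)[of h] h by (intro add_mono) (auto simp: mult_left_mono)
    finally show ?thesis using h by (simp add: h_def field_simps)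
  qed
  then show "\<exists>d>0. \<forall>y\<in>{0..}. norm (y - t) < d \<longrightarrow> norm (S y x - S t x - (y - t) *\<^sub>R S t (A x)) \<le> e * norm (y - t)"
    using d(1) d'(1) by (intro exI[of _ "min d d'"]) auto
qed

end

text \<open>By the parallelogram identity x - y and x + y together lose no norm; as neither can gain
  any, neither loses any. This lets time increments inherit constancy of the norm.\<close>

lemma (in m_dissipative) S_isometric_diff:
  assumes x: "x \<in> X" "norm (S t x) = norm x" and y: "y \<in> X" "norm (S t y) = norm y" and t: "0 \<le> t"
  shows "norm (S t (x - y)) = norm (x - y)"
proof -
  have par: "(norm (a - b))\<^sup>2 + (norm (a + b))\<^sup>2 = 2 * (norm a)\<^sup>2 + 2 * (norm b)\<^sup>2" for a b :: 'a
    by (simp add: power2_norm_eq_inner inner_diff_left inner_diff_right inner_add_left inner_add_right)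
  have xy: "x - y \<in> X" "x + y \<in> X" using x y subX by (auto intro: subspace_diff subspace_add)
  have "(norm (S t (x - y)))\<^sup>2 + (norm (S t (x + y)))\<^sup>2 = (norm (x - y))\<^sup>2 + (norm (x + y))\<^sup>2"
    using par[of "S t x" "S t y"] par[of x y] x y t by (simp add: S_diff S_add)
  moreover have "(norm (S t (x + y)))\<^sup>2 \<le> (norm (x + y))\<^sup>2"
    by (intro power_mono S_contraction xy t) auto
  ultimately have "(norm (x - y))\<^sup>2 \<le> (norm (S t (x - y)))\<^sup>2" by linarith
  then have "norm (x - y) \<le> norm (S t (x - y))" by (rule power2_le_imp_le) simp
  then show ?thesis using S_contraction[OF t xy(1)] by simp
qed

lemma (in m_dissipative) S_norm_antimono:
  assumes "x \<in> X" "0 \<le> s" "s \<le> t"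
  shows "norm (S t x) \<le> norm (S s x)"
  using S_semigroup[of "t - s" s x] S_contraction[of "t - s" "S s x"] S_X[of s x] assms by simp

section \<open>Surjective dissipative operators with precompact graph balls\<close>

locale compact_dissipative = dissipative +
  assumes onto: "\<And>f. f \<in> X \<Longrightarrow> \<exists>x\<in>D. A x = f"
    and precompact: "\<And>x C. (\<And>n::nat. x n \<in> D) \<Longrightarrow> (\<And>n. norm (x n) \<le> C) \<Longrightarrow>
      (\<And>n. norm (A (x n)) \<le> C) \<Longrightarrow> \<exists>r l. strict_mono (r :: nat \<Rightarrow> nat) \<and> (x \<circ> r) \<longlonglongrightarrow> l"
begin

text \<open>Testing dissipativity on \<open>x n + t *\<^sub>R u\<close> and letting \<open>n\<close> grow shows that the limit is orthogonal
  to the range of \<open>A\<close>, so surjectivity makes it vanish.\<close>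

lemma limit_in_kernel:
  assumes x: "\<And>n::nat. x n \<in> D" "x \<longlonglongrightarrow> l" "(\<lambda>n. A (x n)) \<longlonglongrightarrow> 0"
  shows "l = 0"
proof -
  have lX: "l \<in> X" using closed_sequentially[OF closedX, of x l] x DX by auto
  have orth: "inner (A u) l = 0" if u: "u \<in> D" for u
  proof -
    define a where "a = inner (A u) l"
    define b where "b = inner (A u) u"
    have q: "t * a + t\<^sup>2 * b \<le> 0" for t
    proof -
      have tu: "t *\<^sub>R u \<in> D" using u subD by (rule subspace_scale[rotated])
      have "inner (A (x n) + t *\<^sub>R A u) (x n + t *\<^sub>R u) \<le> 0" for n
        using diss[of "x n + t *\<^sub>R u"] x(1)[of n] tu subD u by (simp add: A_add A_scale subspace_add)
      moreover have "(\<lambda>n. inner (A (x n) + t *\<^sub>R A u) (x n + t *\<^sub>R u)) \<longlonglongrightarrow> inner (0 + t *\<^sub>R A u) (l + t *\<^sub>R u)"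
        by (intro tendsto_intros x)
      ultimately have "inner (0 + t *\<^sub>R A u) (l + t *\<^sub>R u) \<le> 0"
        by (intro LIMSEQ_le_const2) auto
      then show ?thesis by (simp add: a_def b_def inner_add_right power2_eq_square algebra_simps)
    qed
    \<comment> \<open>At t = a/c the expression t a + t^2 b equals t^2 (c + b), and c > |b| makes
      the second factor positive, which forces a = 0.\<close>
    define c where "c = 1 + \<bar>b\<bar>"
    have c: "c > 0" "c + b > 0" by (auto simp: c_def)
    have "(a/c) * a + (a/c)\<^sup>2 * b = (a/c)\<^sup>2 * (c + b)"
      using c by (simp add: power2_eq_square field_simps)
    then have "(a/c)\<^sup>2 * (c + b) \<le> 0" using q[of "a/c"] by simp
    then have "(a/c)\<^sup>2 \<le> 0" using c by (simp add: mult_le_0_iff)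
    then show ?thesis using c by (simp add: a_def)
  qed
  obtain u where "u \<in> D" "A u = l" using onto[OF lX] by blast
  then have "inner l l = 0" using orth[of u] by simp
  then show ?thesis by simp
qed

text \<open>A violating sequence, normalised, is bounded in the graph norm and has a limit of norm
  1, which \<open>ker\<close> forbids. That hypothesis speaks of limits rather than of elements of
  D, because closedness of A is only known after maximality. In the applications B is A or A - w
  J.\<close>

lemma bounded_below:
  assumes B: "\<And>x r. x \<in> D \<Longrightarrow> B (r *\<^sub>R x) = r *\<^sub>R B x"
    and M: "\<And>x. x \<in> D \<Longrightarrow> norm (A x) \<le> norm (B x) + M * norm x" "0 \<le> M"
    and ker: "\<And>y l. (\<And>n::nat. y n \<in> D) \<Longrightarrow> y \<longlonglongrightarrow> l \<Longrightarrow> (\<lambda>n. B (y n)) \<longlonglongrightarrow> 0 \<Longrightarrow> l = 0"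
  shows "\<exists>C>0. \<forall>x\<in>D. norm x \<le> C * norm (B x)"
proof (rule ccontr)
  assume neg: "\<not> ?thesis"
  have "\<exists>x\<in>D. real (Suc n) * norm (B x) < norm x" for n
    using neg by (auto simp: not_le dest!: spec[of _ "real (Suc n)"])
  then obtain x where x: "\<And>n. x n \<in> D" "\<And>n. real (Suc n) * norm (B (x n)) < norm (x n)" by metis
  define y where "y n = (1 / norm (x n)) *\<^sub>R x n" for n
  have x0: "norm (x n) > 0" for n using x(2)[of n] by (smt (verit) mult_nonneg_nonneg norm_ge_zero of_nat_0_le_iff)
  have yD: "y n \<in> D" for n using x subD by (simp add: y_def subspace_scale)
  have y1: "norm (y n) = 1" for n using x0[of n] by (simp add: y_def)
  have By: "norm (B (y n)) \<le> 1 / real (Suc n)" for n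
  proof -
    have "norm (B (y n)) = norm (B (x n)) / norm (x n)" using x0[of n] x by (simp add: y_def B)
    also have "\<dots> \<le> 1 / real (Suc n)" using x(2)[of n] x0[of n] by (simp add: field_simps)
    finally show ?thesis .
  qed
  have "norm (B (y n)) \<le> 1" for n using By[of n] by (rule order.trans) simp
  then have Ay: "norm (A (y n)) \<le> 1 + M" for n using M(1)[OF yD[of n]] y1[of n] by (smt (verit) mult_cancel_left1)
  have "\<exists>r l. strict_mono (r :: nat \<Rightarrow> nat) \<and> (y \<circ> r) \<longlonglongrightarrow> l"
    by (rule precompact[where C="1 + M"]) (use yD y1 Ay M(2) in auto)
  then obtain r l where r: "strict_mono (r :: nat \<Rightarrow> nat)" "(y \<circ> r) \<longlonglongrightarrow> l" by blast
  have "(\<lambda>n. B (y n)) \<longlonglongrightarrow> 0"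
  proof (rule Lim_null_comparison)
    show "\<forall>\<^sub>F n in sequentially. norm (B (y n)) \<le> inverse (real (Suc n))"
      using By by (intro always_eventually) (simp add: inverse_eq_divide)
  qed (rule LIMSEQ_inverse_real_of_nat)
  then have "(\<lambda>n. B ((y \<circ> r) n)) \<longlonglongrightarrow> 0"
    using LIMSEQ_subseq_LIMSEQ[OF _ r(1), of "\<lambda>n. B (y n)"] by (simp add: comp_def)
  with ker[OF _ r(2)] yD have "l = 0" by simp
  moreover have "(\<lambda>n. norm ((y \<circ> r) n)) \<longlonglongrightarrow> norm l" by (intro tendsto_norm r(2))
  then have "norm l = 1" using y1 by (simp add: LIMSEQ_const_iff)
  ultimately show False by simp
qed

lemma inverse_bounded: "\<exists>C>0. \<forall>x\<in>D. norm x \<le> C * norm (A x)"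
proof (rule bounded_below[where M=0])
  show "l = 0" if "\<And>n::nat. y n \<in> D" "y \<longlonglongrightarrow> l" "(\<lambda>n. A (y n)) \<longlonglongrightarrow> 0" for y l
    by (rule limit_in_kernel[OF that])
qed (simp_all add: A_scale)

text \<open>The operator - A is onto with inverse bounded by C, so adding l = 1/(2 C) times the
  identity is a perturbation with C l = 1/2; \<open>range_all\<close> then moves the parameter from
  l to 1.\<close>

lemma range_1:
  assumes f: "f \<in> X"
  shows "\<exists>x\<in>D. x - A x = f"
proof -
  obtain C where C: "C > 0" "\<And>x. x \<in> D \<Longrightarrow> norm x \<le> C * norm (A x)" using inverse_bounded by blast
  define l where "l = 1 / (2 * C)"
  have l: "l > 0" using C by (simp add: l_def)
  have "\<exists>x\<in>D. - A x + l *\<^sub>R x = f" if f: "f \<in> X" for f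
  proof (rule perturbed_surjective[where X=X and C=C and k=l])
    show "\<exists>x\<in>D. - A x = g" if "g \<in> X" for g
      using onto[of "- g"] subspace_neg[OF subX that] by force
    show "norm (x - y) \<le> C * norm (- A x - - A y)" if "x \<in> D" "y \<in> D" for x y
      using C(2)[of "x - y"] that subD by (simp add: subspace_diff A_minus norm_minus_commute)
    show "norm (l *\<^sub>R x - l *\<^sub>R y) \<le> l * norm (x - y)" for x y
      using l by (simp flip: scaleR_diff_right)
    show "C * l < 1" using C by (simp add: l_def)
  qed (use subX closedX DX l C f in \<open>auto simp: subspace_scale\<close>)
  then have "\<exists>x\<in>D. l *\<^sub>R x - A x = f" if f: "f \<in> X" for f using f by (simp add: algebra_simps)
  from range_all[OF l this, of 1 f] f show ?thesis by simp
qed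

end

sublocale compact_dissipative \<subseteq> m_dissipative
  by unfold_locales (rule range_1)

context compact_dissipative
begin

text \<open>A LaSalle argument. For x in \<open>D2\<close> the orbits of x and of A x both stay in
  graph balls, so both converge along subsequences of integer times; convergence of the second
  places the limit z in D by closedness. The norm is nonincreasing along the orbit, so it tends to
  |z|, and S t z is again a limit point of the orbit.\<close>

lemma omega_limit:
  assumes x: "x \<in> D2"
  shows "\<exists>z\<in>D. (\<forall>t\<ge>0. norm (S t z) = norm z) \<and> ((\<lambda>t. norm (S t x)) \<longlongrightarrow> norm z) at_top"
proof -
  have X: "x \<in> D" "A x \<in> D" "x \<in> X" "A x \<in> X" "A (A x) \<in> X" using x D2_D DX AX[of "A x"] AX[of x] by auto
  define C where "C = norm x + norm (A x) + norm (A (A x))"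
  have C: "norm x \<le> C" "norm (A x) \<le> C" "norm (A (A x)) \<le> C" by (simp_all add: C_def)
  have S_le: "norm (S (real n) v) \<le> C" if "v \<in> X" "norm v \<le> C" for v n
    using S_contraction[of "real n" v] that by simp
  have "\<exists>r l. strict_mono (r :: nat \<Rightarrow> nat) \<and> ((\<lambda>n. S (real n) x) \<circ> r) \<longlonglongrightarrow> l"
    by (rule precompact[where C=C]) (use S_D[OF _ X(1)] S_le[OF X(3) C(1)] S_le[OF X(4) C(2)] in auto)
  then obtain r z where r: "strict_mono (r :: nat \<Rightarrow> nat)" "(\<lambda>n. S (real (r n)) x) \<longlonglongrightarrow> z" by (auto simp: comp_def)
  have "\<exists>r' l. strict_mono (r' :: nat \<Rightarrow> nat) \<and> ((\<lambda>n. S (real (r n)) (A x)) \<circ> r') \<longlonglongrightarrow> l"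
    by (rule precompact[where C=C]) (use S_D[OF _ X(2)] S_le[OF X(4) C(2)] S_le[OF X(5) C(3)] in auto)
  then obtain r' w where r': "strict_mono (r' :: nat \<Rightarrow> nat)" "(\<lambda>n. S (real (r (r' n))) (A x)) \<longlonglongrightarrow> w" by (auto simp: comp_def)
  have rr: "(\<lambda>n. S (real (r (r' n))) x) \<longlonglongrightarrow> z" using LIMSEQ_subseq_LIMSEQ[OF r(2) r'(1)] by (simp add: comp_def)
  have zD: "z \<in> D"
    using A_closed(1)[OF _ rr, of w] S_D[OF _ X(1)] r'(2) by simp
  have zX: "z \<in> X" using zD DX by auto
  have n: "(\<lambda>n. norm (S (real (r n)) x)) \<longlonglongrightarrow> norm z" by (intro tendsto_norm r(2))
  have ge: "norm z \<le> norm (S t x)" if "0 \<le> t" for t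
  proof (rule LIMSEQ_le_const2[OF n])
    obtain N :: nat where "t \<le> real N" using real_arch_simple by blast
    then have "norm (S (real (r n)) x) \<le> norm (S t x)" if "n \<ge> N" for n
      using seq_suble[OF r(1), of n] that \<open>0 \<le> t\<close> by (intro S_norm_antimono X(3)) auto
    then show "\<exists>N. \<forall>n\<ge>N. norm (S (real (r n)) x) \<le> norm (S t x)" by blast
  qed
  have lim: "((\<lambda>t. norm (S t x)) \<longlongrightarrow> norm z) at_top"
  proof (rule tendstoI)
    fix e :: real assume "e > 0"
    then have "\<forall>\<^sub>F k in sequentially. norm (S (real (r k)) x) < norm z + e"
      using order_tendstoD(2)[OF n] by simp
    then obtain k where k: "norm (S (real (r k)) x) < norm z + e"
      using eventually_happens'[OF sequentially_bot] by blast
    have "dist (norm (S t x)) (norm z) < e" if "t \<ge> real (r k)" for t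
    proof -
      have "norm (S t x) \<le> norm (S (real (r k)) x)" using that by (intro S_norm_antimono X(3)) auto
      moreover have "norm z \<le> norm (S t x)" using that by (intro ge) (metis of_nat_0_le_iff order.trans)
      ultimately show ?thesis using k by (simp add: dist_real_def)
    qed
    then show "\<forall>\<^sub>F t in at_top. dist (norm (S t x)) (norm z) < e"
      by (auto simp: eventually_at_top_linorder)
  qed
  have "norm (S t z) = norm z" if t: "0 \<le> t" for t
  proof -
    have "(\<lambda>n. norm (S t (S (real (r n)) x) - S t z)) \<longlonglongrightarrow> 0"
    proof (rule Lim_null_comparison)
      show "\<forall>\<^sub>F n in sequentially. norm (norm (S t (S (real (r n)) x) - S t z)) \<le> norm (S (real (r n)) x - z)"
        using lin_contr_dist[OF S_lin_contr[OF t]] S_X X(3) zX by (intro always_eventually) simp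
      show "(\<lambda>n. norm (S (real (r n)) x - z)) \<longlonglongrightarrow> 0" using r(2) by (simp add: LIM_zero tendsto_norm_zero)
    qed
    then have "(\<lambda>n. S t (S (real (r n)) x)) \<longlonglongrightarrow> S t z"
      by (rule LIM_zero_cancel[OF tendsto_norm_zero_cancel])
    then have "(\<lambda>n. norm (S (t + real (r n)) x)) \<longlonglongrightarrow> norm (S t z)"
      using t X(3) by (simp add: S_semigroup tendsto_norm)
    moreover have "filterlim (\<lambda>n. t + real (r n)) at_top sequentially"
      by (rule filterlim_tendsto_add_at_top[OF tendsto_const
            filterlim_compose[OF filterlim_real_sequentially filterlim_subseq[OF r(1)]]])
    then have "(\<lambda>n. norm (S (t + real (r n)) x)) \<longlonglongrightarrow> norm z" using filterlim_compose[OF lim] by blast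
    ultimately show ?thesis using LIMSEQ_unique by blast
  qed
  with zD lim show ?thesis by blast
qed

text \<open>Contractivity and density reduce the claim to \<open>D2\<close>, where
  \<open>omega_limit\<close> identifies the limit of the norm with |z| for an orbit of constant
  norm.\<close>

lemma strongly_stable_of_observability:
  assumes obs: "\<And>z. z \<in> D \<Longrightarrow> (\<And>t. 0 \<le> t \<Longrightarrow> norm (S t z) = norm z) \<Longrightarrow> z = 0"
    and x: "x \<in> X"
  shows "((\<lambda>t. norm (S t x)) \<longlongrightarrow> 0) at_top"
proof (rule tendstoI)
  fix e :: real assume e: "e > 0"
  obtain y where y: "y \<in> D2" "norm (x - y) < e/2" using D2_dense[OF x, of "e/2"] e by auto
  obtain z where "z \<in> D" "\<forall>t\<ge>0. norm (S t z) = norm z" and lim: "((\<lambda>t. norm (S t y)) \<longlongrightarrow> norm z) at_top"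
    using omega_limit[OF y(1)] by blast
  then have "z = 0" using obs by blast
  with lim have "((\<lambda>t. norm (S t y)) \<longlongrightarrow> 0) at_top" by simp
  then have "\<forall>\<^sub>F t in at_top. norm (S t y) < e/2" using e by (intro order_tendstoD) auto
  then show "\<forall>\<^sub>F t in at_top. dist (norm (S t x)) 0 < e"
    using eventually_ge_at_top[of 0]
  proof eventually_elim
    case (elim t)
    have "norm (S t x - S t y) \<le> norm (x - y)"
      using elim x y D2_D DX by (intro lin_contr_dist S_lin_contr) auto
    then show ?case using elim(1) y(2) norm_triangle_ineq2[of "S t x" "S t y"] by simp
  qed
qed

text \<open>J is multiplication by i seen as a real operator. Orthogonality of J x to x makes A - w
  J dissipative again, so the real theory applies to it, and commutation with A passes to the
  semigroup.\<close>

lemma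
  assumes stable: "\<And>x. x \<in> X \<Longrightarrow> ((\<lambda>t. norm (S t x)) \<longlongrightarrow> 0) at_top"
    and J: "bounded_linear J" "\<And>x. norm (J x) = norm x" "\<And>x. inner (J x) x = 0" "\<And>x. x \<in> X \<Longrightarrow> J x \<in> X"
      "\<And>x. x \<in> D \<Longrightarrow> J x \<in> D" "\<And>x. x \<in> D \<Longrightarrow> A (J x) = J (A x)"
  shows S_commute: "0 \<le> t \<Longrightarrow> x \<in> X \<Longrightarrow> S t (J x) = J (S t x)"
    and imaginary_bounded_below: "\<exists>C>0. \<forall>x\<in>D. norm x \<le> C * norm (w *\<^sub>R J x - A x)"
    and imaginary_onto: "f \<in> X \<Longrightarrow> \<exists>x\<in>D. w *\<^sub>R J x - A x = f"
proof -
  interpret J: bounded_linear J by fact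
  have Res_J: "Res h (J x) = J (Res h x)" if "0 \<le> h" "x \<in> X" for h x
  proof (cases "h = 0")
    case False
    then have h: "0 < h" using that by simp
    note R = Res[OF h that(2)]
    show ?thesis
    proof (rule Res_unique[OF that(1)])
      show "J (Res h x) \<in> D" using R J by simp
      have "J (Res h x) - h *\<^sub>R A (J (Res h x)) = J (Res h x - h *\<^sub>R A (Res h x))"
        by (simp only: J.diff J.scaleR J(6)[OF R(1)])
      then show "J (Res h x) - h *\<^sub>R A (J (Res h x)) = J x" by (simp only: R(2))
    qed
  qed simp
  have Euler_J: "Euler n t (J x) = J (Euler n t x)" if "0 \<le> t" "x \<in> X" for n t x
  proof -
    have "(Res h ^^ m) (J x) = J ((Res h ^^ m) x)" if h: "0 \<le> h" for h m
    proof (induct m)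
      case (Suc m)
      have "(Res h ^^ m) x \<in> X" using lin_contr_pow[OF Res_lin_contr[OF h]] \<open>x \<in> X\<close> by (rule lin_contrD)
      then show ?case using Suc Res_J h by simp
    qed simp
    then show ?thesis using that by (simp add: Euler_def)
  qed
  have S_J: "S t (J x) = J (S t x)" if "0 \<le> t" "x \<in> X" for t x
  proof (rule LIMSEQ_unique)
    show "(\<lambda>n. Euler n t (J x)) \<longlonglongrightarrow> S t (J x)" using that J by (intro Euler_tendsto) auto
    show "(\<lambda>n. Euler n t (J x)) \<longlonglongrightarrow> J (S t x)"
      unfolding Euler_J[OF that] by (intro J.tendsto Euler_tendsto that)
  qed
  then show "0 \<le> t \<Longrightarrow> x \<in> X \<Longrightarrow> S t (J x) = J (S t x)" .
  \<comment> \<open>An eigenvector would have an orbit of constant norm.\<close>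
  have inj: "x = 0" if x: "x \<in> D" "A x = w *\<^sub>R J x" for x
  proof -
    have X: "x \<in> X" "J x \<in> X" using x DX J by auto
    have "((\<lambda>t. inner (S t x) (S t x)) has_vector_derivative 0) (at t within {0..})" if t: "t \<in> {0..}" for t
    proof -
      have "S t (A x) = w *\<^sub>R J (S t x)" using t x X by (simp add: S_scale S_J)
      then have "inner (S t x) (S t (A x)) + inner (S t (A x)) (S t x) = 0"
        using J(3)[of "S t x"] by (simp add: inner_commute)
      moreover have "((\<lambda>t. inner (S t x) (S t x)) has_vector_derivative
          inner (S t x) (S t (A x)) + inner (S t (A x)) (S t x)) (at t within {0..})"
        using t by (intro bounded_bilinear.has_vector_derivative[OF bounded_bilinear_inner] S_has_derivative x) auto
      ultimately show ?thesis by simp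
    qed
    from has_vector_derivative_zero_constant[OF convex_real_interval(1) this]
    obtain c where c: "\<And>t. t \<in> {0..} \<Longrightarrow> inner (S t x) (S t x) = c" by metis
    have "norm (S t x) = norm x" if "t \<ge> 0" for t
      using c[of t] c[of 0] that by (simp add: norm_eq_sqrt_inner S_0)
    then have "\<forall>\<^sub>F t in at_top. norm (S t x) = norm x" by (auto simp: eventually_at_top_linorder)
    then have "((\<lambda>t::real. norm x) \<longlongrightarrow> 0) at_top" using stable[OF X(1)] tendsto_cong by fastforce
    then show ?thesis by (simp add: tendsto_const_iff)
  qed
  \<comment> \<open>The kernel hypothesis is met through \<open>inj\<close>: J is continuous, so A
    (y n) tends to w J l, and closedness makes l satisfy A l = w J l.\<close>
  have "\<exists>C>0. \<forall>x\<in>D. norm x \<le> C * norm (A x - w *\<^sub>R J x)"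
  proof (rule bounded_below[where M="\<bar>w\<bar>"])
    show "A (r *\<^sub>R x) - w *\<^sub>R J (r *\<^sub>R x) = r *\<^sub>R (A x - w *\<^sub>R J x)" if "x \<in> D" for x r
      using that by (simp add: A_scale J.scaleR algebra_simps)
    show "norm (A x) \<le> norm (A x - w *\<^sub>R J x) + \<bar>w\<bar> * norm x" for x
      using norm_triangle_ineq[of "A x - w *\<^sub>R J x" "w *\<^sub>R J x"] J(2)[of x] by simp
    fix y :: "nat \<Rightarrow> 'a" and l
    assume y: "\<And>n. y n \<in> D" "y \<longlonglongrightarrow> l" "(\<lambda>n. A (y n) - w *\<^sub>R J (y n)) \<longlonglongrightarrow> 0"
    have "(\<lambda>n. (A (y n) - w *\<^sub>R J (y n)) + w *\<^sub>R J (y n)) \<longlonglongrightarrow> 0 + w *\<^sub>R J l"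
      by (intro tendsto_intros J.tendsto y)
    then have "(\<lambda>n. A (y n)) \<longlonglongrightarrow> w *\<^sub>R J l" by simp
    from A_closed[OF y(1,2) this] show "l = 0" by (rule inj)
  qed simp
  then obtain C where C: "C > 0" "\<And>x. x \<in> D \<Longrightarrow> norm x \<le> C * norm (A x - w *\<^sub>R J x)" by blast
  then show "\<exists>C>0. \<forall>x\<in>D. norm x \<le> C * norm (w *\<^sub>R J x - A x)"
    by (metis norm_minus_commute)
  interpret B: dissipative X D "\<lambda>x. A x - w *\<^sub>R J x"
    using subX closedX subD DX AX J A_add A_scale diss
    by unfold_locales (auto simp: J.add J.scaleR algebra_simps inner_diff_left intro!: subspace_diff subspace_scale)
  \<comment> \<open>At l = |w| + 1 the term w J is small against the bound 1/l for the inverse of l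
    - A; \<open>B.range_all\<close> then reaches every positive shift of A - w J.\<close>
  define l where "l = \<bar>w\<bar> + 1"
  have l: "l > 0" by (simp add: l_def)
  have Jw: "norm (c *\<^sub>R J x - c *\<^sub>R J y) \<le> \<bar>c\<bar> * norm (x - y)" for c x y
    by (simp add: J(2) flip: scaleR_diff_right J.diff)
  have "\<exists>x\<in>D. (l *\<^sub>R x - A x) + w *\<^sub>R J x = f" if f: "f \<in> X" for f
  proof (rule perturbed_surjective[where X=X and C="1/l" and k="\<bar>w\<bar>"])
    show "\<exists>x\<in>D. l *\<^sub>R x - A x = g" if "g \<in> X" for g
      using range_all[of 1 l g] range1 l that by simp
    show "norm (x - y) \<le> 1/l * norm (l *\<^sub>R x - A x - (l *\<^sub>R y - A y))" if "x \<in> D" "y \<in> D" for x y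
    proof -
      have "l *\<^sub>R x - A x - (l *\<^sub>R y - A y) = l *\<^sub>R (x - y) - A (x - y)"
        unfolding A_minus[OF that] by (simp add: algebra_simps)
      then show ?thesis
        using dissipative_lower_bound[of "x - y" l] that l subD by (simp add: subspace_diff)
    qed
    show "1 / l * \<bar>w\<bar> < 1" by (simp add: l_def field_simps)
  qed (use subX closedX DX l f J Jw in \<open>auto simp: subspace_scale\<close>)
  then have rl: "\<exists>x\<in>D. l *\<^sub>R x - (A x - w *\<^sub>R J x) = f" if f: "f \<in> X" for f
    using f by (simp add: algebra_simps)
  \<comment> \<open>The shift removed at the end has to be small against the lower bound: m = 1/(4
    C) turns C into 4 C / 3, and (4 C / 3) m = 1/3 < 1.\<close>
  define m where "m = 1 / (4 * C)"
  have m: "m > 0" using C by (simp add: m_def)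
  have C': "norm x \<le> (4 * C / 3) * norm (m *\<^sub>R x - (A x - w *\<^sub>R J x))" if "x \<in> D" for x
  proof -
    have "norm (A x - w *\<^sub>R J x) \<le> norm (m *\<^sub>R x) + norm (m *\<^sub>R x - (A x - w *\<^sub>R J x))"
      using norm_triangle_ineq4[of "m *\<^sub>R x" "m *\<^sub>R x - (A x - w *\<^sub>R J x)"] by simp
    then have "C * norm (A x - w *\<^sub>R J x) \<le> C * (m * norm x + norm (m *\<^sub>R x - (A x - w *\<^sub>R J x)))"
      using C(1) m by (intro mult_left_mono) auto
    then have "norm x \<le> C * (m * norm x + norm (m *\<^sub>R x - (A x - w *\<^sub>R J x)))" using C(2)[OF that] by linarith
    also have "\<dots> = norm x / 4 + C * norm (m *\<^sub>R x - (A x - w *\<^sub>R J x))"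
      using C(1) by (simp add: m_def field_simps)
    finally show ?thesis by simp
  qed
  show "\<exists>x\<in>D. w *\<^sub>R J x - A x = f" if f: "f \<in> X"
  proof -
    have "\<exists>x\<in>D. (m *\<^sub>R x - (A x - w *\<^sub>R J x)) + (- m) *\<^sub>R x = f"
    proof (rule perturbed_surjective[where X=X and C="4 * C / 3" and k=m])
      show "\<exists>x\<in>D. m *\<^sub>R x - (A x - w *\<^sub>R J x) = g" if "g \<in> X" for g
        using B.range_all[OF l rl m that] .
      show "norm (x - y) \<le> 4 * C / 3 * norm (m *\<^sub>R x - (A x - w *\<^sub>R J x) - (m *\<^sub>R y - (A y - w *\<^sub>R J y)))"
        if "x \<in> D" "y \<in> D" for x y
      proof -
        have "m *\<^sub>R x - (A x - w *\<^sub>R J x) - (m *\<^sub>R y - (A y - w *\<^sub>R J y))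
          = m *\<^sub>R (x - y) - (A (x - y) - w *\<^sub>R J (x - y))"
          unfolding A_minus[OF that] J.diff by (simp add: algebra_simps)
        then show ?thesis using C'[of "x - y"] that subD by (simp add: subspace_diff)
      qed
      show "norm ((- m) *\<^sub>R x - (- m) *\<^sub>R y) \<le> m * norm (x - y)" for x y
        using m by (simp add: norm_minus_commute flip: scaleR_diff_right)
      show "4 * C / 3 * m < 1" using C by (simp add: m_def)
    qed (use subX closedX DX m C f in \<open>auto simp: subspace_scale subspace_neg\<close>)
    then show ?thesis by simp
  qed
qed

end

section \<open>Square integrable functions and weak derivatives on an interval\<close>

definition zext :: "real \<Rightarrow> (real \<Rightarrow> complex) \<Rightarrow> real \<Rightarrow> complex" where
  "zext l f = (\<lambda>x. if x \<in> {0..l} then f x else 0)"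

definition emb :: "real \<Rightarrow> (real \<Rightarrow> complex) \<Rightarrow> l2" where
  "emb l f = abs_l2 (zext l f)"

lemma L2_iff_sq_integrable: "L2 0 l f \<longleftrightarrow> sq_integrable (zext l f)"
proof -
  have "(\<lambda>x. (cmod (zext l f x))\<^sup>2) = (\<lambda>x. if x \<in> {0..l} then (cmod (f x))\<^sup>2 else 0)"
    by (auto simp: zext_def)
  then have "integrable lebesgue (\<lambda>x. (cmod (zext l f x))\<^sup>2) \<longleftrightarrow> integrable (lebesgue_on {0..l}) (\<lambda>x. (cmod (f x))\<^sup>2)"
    using Lebesgue_Measure.integrable_restrict_UNIV[of "{0..l}" "\<lambda>x. (cmod (f x))\<^sup>2"] by simp
  moreover have "zext l f \<in> borel_measurable lebesgue \<longleftrightarrow> f \<in> borel_measurable (lebesgue_on {0..l})"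
    unfolding zext_def by (rule borel_measurable_if) simp
  ultimately show ?thesis by (simp add: L2_def sq_integrable_def)
qed

lemma sq_integrable_L2:
  assumes "sq_integrable h"
  shows "L2 0 l h"
proof -
  have "zext l h \<in> borel_measurable lebesgue"
    unfolding zext_def using assms by (intro borel_measurable_if_I measurable_restrict_space1) (auto simp: sq_integrable_def)
  moreover have "integrable lebesgue (\<lambda>t. (cmod (zext l h t))\<^sup>2)"
  proof (rule Bochner_Integration.integrable_bound[where f="\<lambda>t. (cmod (h t))\<^sup>2"])
    show "integrable lebesgue (\<lambda>t. (cmod (h t))\<^sup>2)" using assms by (simp add: sq_integrable_def)
    show "(\<lambda>t. (cmod (zext l h t))\<^sup>2) \<in> borel_measurable lebesgue" using calculation by measurable
  qed (simp add: zext_def)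
  ultimately show ?thesis by (simp add: L2_iff_sq_integrable sq_integrable_def)
qed

lemma lin_zext: "zext l (\<lambda>x. a * f x + b * g x) = (\<lambda>x. a * zext l f x + b * zext l g x)"
  by (auto simp: zext_def)

lemma L2_lin: "L2 0 l f \<Longrightarrow> L2 0 l g \<Longrightarrow> L2 0 l (\<lambda>x. a * f x + b * g x)"
  unfolding L2_iff_sq_integrable lin_zext by (intro sq_integrable_add sq_integrable_cmult)

lemma L2_cmult: "L2 0 l f \<Longrightarrow> L2 0 l (\<lambda>x. a * f x)"
  using L2_lin[of l f f a 0] by simp

lemma AE_ivl_iff: "(AE x in lebesgue_on {0..l::real}. P x) \<longleftrightarrow> (AE x in lebesgue. x \<in> {0..l} \<longrightarrow> P x)"
  by (rule AE_restrict_space_iff) simp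

lemma AE_ivlI: "(\<And>x. x \<in> {0..l::real} \<Longrightarrow> P x) \<Longrightarrow> AE x in lebesgue_on {0..l}. P x"
  by (intro AE_I2) simp

lemma emb_eq_iff:
  assumes "L2 0 l f" "L2 0 l g"
  shows "emb l f = emb l g \<longleftrightarrow> (AE x in lebesgue_on {0..l}. f x = g x)"
proof -
  have "emb l f = emb l g \<longleftrightarrow> (AE x in lebesgue. zext l f x = zext l g x)"
    using Quotient3_rel[OF Quotient3_l2, of "zext l f" "zext l g"] assms
    by (auto simp: emb_def L2_iff_sq_integrable)
  also have "\<dots> \<longleftrightarrow> (AE x in lebesgue. x \<in> {0..l} \<longrightarrow> f x = g x)"
    by (intro AE_cong) (auto simp: zext_def)
  finally show ?thesis by (simp add: AE_ivl_iff)
qed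

lemma emb_lin:
  assumes "L2 0 l f" "L2 0 l g"
  shows "emb l (\<lambda>x. a * f x + b * g x) = cscale a (emb l f) + cscale b (emb l g)"
  using assms unfolding emb_def L2_iff_sq_integrable lin_zext
  by (simp add: cscale.abs_eq plus_l2.abs_eq sq_integrable_cmult)

lemma emb_cmult: "L2 0 l f \<Longrightarrow> emb l (\<lambda>x. a * f x) = cscale a (emb l f)"
  unfolding emb_def L2_iff_sq_integrable
  by (subst cscale.abs_eq) (auto simp: zext_def intro!: arg_cong[where f=abs_l2])

lemma emb_inner:
  assumes "L2 0 l f" "L2 0 l g"
  shows "inner (emb l f) (emb l g) = Re (l2inner 0 l f g)"
proof -
  have "(\<lambda>x. zext l f x * cnj (zext l g x)) = (\<lambda>x. if x \<in> {0..l} then f x * cnj (g x) else 0)"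
    by (auto simp: zext_def)
  then have "(LINT x|lebesgue. zext l f x * cnj (zext l g x)) = l2inner 0 l f g"
    unfolding l2inner_def
    using Lebesgue_Measure.integral_restrict_UNIV[of "{0..l}" "\<lambda>x. f x * cnj (g x)"] by simp
  moreover have "inner (emb l f) (emb l g) = Re (LINT x|lebesgue. zext l f x * cnj (zext l g x))"
    unfolding emb_def using assms by (intro inner_l2.abs_eq) (auto simp: L2_iff_sq_integrable)
  ultimately show ?thesis by simp
qed

lemma l2inner_self: "l2inner 0 l f f = of_real ((l2norm 0 l f)\<^sup>2)"
  unfolding l2inner_def l2norm_def integral_mult_cnj_self by simp

lemma emb_norm: "L2 0 l f \<Longrightarrow> norm (emb l f) = l2norm 0 l f"
  by (simp add: norm_eq_sqrt_inner emb_inner l2inner_self l2norm_def)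

lemma cscale_add: "cscale (a + b) x = cscale a x + cscale b x"
  by transfer (auto simp: distrib_right intro: sq_integrable_add sq_integrable_cmult)

lemma cscale_add_right: "cscale a (x + y) = cscale a x + cscale a y"
  by transfer (auto simp: distrib_left intro: sq_integrable_add sq_integrable_cmult)

lemma cscale_cscale: "cscale a (cscale b x) = cscale (a * b) x"
  by transfer (auto simp: mult.assoc intro: sq_integrable_cmult)

lemma cscale_of_real: "cscale (of_real r) x = r *\<^sub>R x"
  by (simp add: scaleR_l2_def)

lemma norm_cscale: "norm (cscale a x) = cmod a * norm x"
proof -
  obtain f where f: "sq_integrable f" "x = abs_l2 f" by (rule abs_l2_surj)
  have x: "cscale a x = abs_l2 (\<lambda>t. a * f t)" using f by (simp add: cscale.abs_eq)
  have "(norm (cscale a x))\<^sup>2 = (cmod a * norm x)\<^sup>2"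
    unfolding x power_mult_distrib using f
    by (simp add: norm_abs_l2 sq_integrable_cmult norm_mult power_mult_distrib)
  then show ?thesis by (rule power2_eq_imp_eq) auto
qed

text \<open>Cauchy-Schwarz holds for the real part; a phase c of modulus 1 rotates f until the
  complex inner product is real and nonnegative. For z = 0 the phase is arbitrary and 1 is
  taken.\<close>

lemma cmod_l2inner_le:
  assumes "L2 0 l f" "L2 0 l g"
  shows "cmod (l2inner 0 l f g) \<le> l2norm 0 l f * l2norm 0 l g"
proof -
  define z where "z = l2inner 0 l f g"
  define c where "c = (if z = 0 then 1 else cnj z / cmod z)"
  have c: "cmod c = 1" by (simp add: c_def norm_divide)
  have "c * z = of_real (cmod z)"
    using complex_norm_square[of z] by (simp add: c_def power2_eq_square field_simps)
  moreover have "l2inner 0 l (\<lambda>x. c * f x) g = c * z"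
    unfolding l2inner_def z_def by (simp add: mult.assoc)
  ultimately have "cmod z = inner (emb l (\<lambda>x. c * f x)) (emb l g)"
    using assms by (simp add: emb_inner L2_cmult)
  also have "\<dots> \<le> norm (emb l (\<lambda>x. c * f x)) * norm (emb l g)" by (rule norm_cauchy_schwarz)
  also have "norm (emb l (\<lambda>x. c * f x)) = norm (emb l f)"
    using assms c by (simp add: emb_cmult norm_cscale)
  finally show ?thesis using assms by (simp add: emb_norm z_def)
qed

lemma L2_bounded_mult:
  assumes "L2 0 l f" and m: "m \<in> borel_measurable (lebesgue_on {0..l})" and b: "\<And>x. x \<in> {0..l} \<Longrightarrow> cmod (m x) \<le> C"
  shows "L2 0 l (\<lambda>x. m x * f x)"
  unfolding L2_def
proof
  have f: "f \<in> borel_measurable (lebesgue_on {0..l})" "integrable (lebesgue_on {0..l}) (\<lambda>x. (cmod (f x))\<^sup>2)"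
    using assms by (auto simp: L2_def)
  show mf: "(\<lambda>x. m x * f x) \<in> borel_measurable (lebesgue_on {0..l})"
    using f m by (intro borel_measurable_times)
  show "integrable (lebesgue_on {0..l}) (\<lambda>x. (cmod (m x * f x))\<^sup>2)"
  proof (rule Bochner_Integration.integrable_bound[where f="\<lambda>x. C\<^sup>2 * (cmod (f x))\<^sup>2"])
    show "integrable (lebesgue_on {0..l}) (\<lambda>x. C\<^sup>2 * (cmod (f x))\<^sup>2)" using f by simp
    show "(\<lambda>x. (cmod (m x * f x))\<^sup>2) \<in> borel_measurable (lebesgue_on {0..l})"
      using borel_measurable_power[OF measurable_compose[OF mf borel_measurable_norm]] by simp
    show "AE x in lebesgue_on {0..l}. norm ((cmod (m x * f x))\<^sup>2) \<le> norm (C\<^sup>2 * (cmod (f x))\<^sup>2)"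
    proof (rule AE_ivlI)
      fix x assume "x \<in> {0..l}"
      then have "(cmod (m x))\<^sup>2 * (cmod (f x))\<^sup>2 \<le> C\<^sup>2 * (cmod (f x))\<^sup>2"
        using b by (intro mult_right_mono power_mono) auto
      then show "norm ((cmod (m x * f x))\<^sup>2) \<le> norm (C\<^sup>2 * (cmod (f x))\<^sup>2)"
        by (simp add: norm_mult power_mult_distrib)
    qed
  qed
qed

lemma L2_affine_mult: "L2 0 l f \<Longrightarrow> L2 0 l (\<lambda>x. of_real (x - c) * f x)"
proof (rule L2_bounded_mult)
  show "(\<lambda>x. of_real (x - c) :: complex) \<in> borel_measurable (lebesgue_on {0..l})"
    by (intro continuous_imp_measurable_on_sets_lebesgue continuous_intros) simp
  show "cmod (of_real (x - c)) \<le> \<bar>l\<bar> + \<bar>c\<bar>" if "x \<in> {0..l}" for x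
  proof -
    have "\<bar>x - c\<bar> \<le> \<bar>l\<bar> + \<bar>c\<bar>" using that by (auto simp: abs_if)
    then show ?thesis by (simp only: norm_of_real)
  qed
qed

lemma L2_continuous:
  assumes "continuous_on {0..l} f"
  shows "L2 0 l f"
  unfolding L2_def
proof
  show "f \<in> borel_measurable (lebesgue_on {0..l})"
    using assms by (intro continuous_imp_measurable_on_sets_lebesgue) auto
  show "integrable (lebesgue_on {0..l}) (\<lambda>x. (cmod (f x))\<^sup>2)"
    using assms by (intro continuous_imp_integrable_real continuous_intros)
qed

lemma L2_one: "L2 0 l (\<lambda>x. 1)"
  by (intro L2_continuous continuous_intros)

lemma L2_cutoff:
  assumes "L2 0 l f"
  shows "L2 0 l (\<lambda>x. if x \<le> s then f x else 0)"
proof -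
  have "L2 0 l (\<lambda>x. (if x \<le> s then 1 else 0) * f x)"
  proof (rule L2_bounded_mult[OF assms, where C=1])
    have "(\<lambda>x. indicator {..s} x :: complex) \<in> borel_measurable borel" by measurable
    then have "(\<lambda>x. indicator {..s} x :: complex) \<in> borel_measurable (lebesgue_on {0..l})"
      by (intro measurable_restrict_space1 measurable_completion) simp
    then show "(\<lambda>x. if x \<le> s then 1 else 0 :: complex) \<in> borel_measurable (lebesgue_on {0..l})"
      by (simp add: indicator_def of_bool_def)
  qed auto
  moreover have "(\<lambda>x. (if x \<le> s then 1 else 0) * f x) = (\<lambda>x. if x \<le> s then f x else 0)" by auto
  ultimately show ?thesis by simp
qed

lemma L2_integrable:
  assumes "L2 0 l f"
  shows "integrable (lebesgue_on {0..l}) f"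
proof (rule Bochner_Integration.integrable_bound[where f="\<lambda>x. 1 + (cmod (f x))\<^sup>2"])
  show "integrable (lebesgue_on {0..l}) (\<lambda>x. 1 + (cmod (f x))\<^sup>2)"
    using assms continuous_imp_integrable_real[of 0 l "\<lambda>x. 1::real"] by (simp add: L2_def)
  have "a \<le> 1 + a\<^sup>2" for a :: real
  proof -
    have "(a - 1/2)\<^sup>2 = a\<^sup>2 - a + 1/4" by (simp add: power2_eq_square algebra_simps)
    then show ?thesis using zero_le_power2[of "a - 1/2"] by linarith
  qed
  then show "AE x in lebesgue_on {0..l}. norm (f x) \<le> norm (1 + (cmod (f x))\<^sup>2)"
    by (intro AE_ivlI) (simp add: add_nonneg_nonneg)
qed (use assms in \<open>simp add: L2_def\<close>)

section \<open>Primitives of square integrable functions\<close>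

lemma integral_initial_segment:
  fixes x l :: real
  assumes "x \<in> {0..l}"
  shows "(LINT t|lebesgue_on {0..x}. g t) = (LINT t|lebesgue_on {0..l}. (if t \<le> x then g t else (0::complex)))"
proof -
  have "(LINT t|lebesgue_on {0..x}. g t) = (LINT t|lebesgue. (if t \<in> {0..x} then g t else 0))"
    by (rule Lebesgue_Measure.integral_restrict_UNIV[symmetric]) simp
  also have "(\<lambda>t. if t \<in> {0..x} then g t else 0) = (\<lambda>t. if t \<in> {0..l} then (if t \<le> x then g t else 0) else 0)"
    using assms by auto
  also have "(LINT t|lebesgue. \<dots> t) = (LINT t|lebesgue_on {0..l}. (if t \<le> x then g t else 0))"
    by (rule Lebesgue_Measure.integral_restrict_UNIV) simp
  finally show ?thesis .
qed

lemma integral_initial_continuous: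
  assumes "integrable (lebesgue_on {0..l}) (g :: real \<Rightarrow> complex)"
  shows "continuous_on {0..l} (\<lambda>x. LINT t|lebesgue_on {0..x}. g t)"
proof -
  have "g integrable_on {0..l}" using assms by (intro integrable_on_lebesgue_on) auto
  then have "continuous_on {0..l} (\<lambda>x. integral {0..x} g)" by (rule indefinite_integral_continuous_1)
  moreover have "integral {0..x} g = (LINT t|lebesgue_on {0..x}. g t)" if "x \<in> {0..l}" for x
    using that assms
    by (intro lebesgue_integral_eq_integral[symmetric] Equivalence_Lebesgue_Henstock_Integration.integrable_subinterval[OF assms]) auto
  ultimately show ?thesis by (rule continuous_on_eq)
qed

text \<open>The increment of the primitive is the inner product of g with the indicator of the
  half-open interval from s to t, whose norm is sqrt (t - s).\<close>

lemma holder_primitive: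
  assumes g: "L2 0 l g" and st: "0 \<le> s" "s \<le> t" "t \<le> l"
  shows "cmod ((LINT x|lebesgue_on {0..t}. g x) - (LINT x|lebesgue_on {0..s}. g x)) \<le> sqrt (t - s) * l2norm 0 l g"
proof -
  define c where "c x = (if x \<le> t then 1 else 0) - (if x \<le> s then 1 else (0::complex))" for x
  have L: "L2 0 l c"
    using L2_lin[OF L2_cutoff[OF L2_one, of l t] L2_cutoff[OF L2_one, of l s], of 1 "-1"] by (simp add: c_def[abs_def])
  have i: "integrable (lebesgue_on {0..l}) (\<lambda>x. if x \<le> r then g x else 0)" for r
    by (intro L2_integrable L2_cutoff g)
  have "(LINT x|lebesgue_on {0..t}. g x) - (LINT x|lebesgue_on {0..s}. g x) = l2inner 0 l g c"
    using st unfolding l2inner_def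
    by (subst (1 2) integral_initial_segment[of _ l])
      (auto simp: c_def simp flip: Bochner_Integration.integral_diff[OF i i] intro!: Bochner_Integration.integral_cong)
  then have "cmod ((LINT x|lebesgue_on {0..t}. g x) - (LINT x|lebesgue_on {0..s}. g x)) \<le> l2norm 0 l g * l2norm 0 l c"
    using cmod_l2inner_le[OF g L] by simp
  also have "l2norm 0 l c = sqrt (t - s)"
  proof -
    have "(LINT x|lebesgue_on {0..l}. (cmod (c x))\<^sup>2) = (LINT x|lebesgue. (if x \<in> {0..l} then (cmod (c x))\<^sup>2 else 0))"
      by (rule Lebesgue_Measure.integral_restrict_UNIV[symmetric]) simp
    also have "\<dots> = (LINT x|lebesgue. indicat_real {s<..t} x)"
      using st by (intro Bochner_Integration.integral_cong) (auto simp: c_def indicator_def)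
    also have "\<dots> = t - s" using st by simp
    finally show ?thesis by (simp add: l2norm_def)
  qed
  finally show ?thesis by (simp add: mult.commute)
qed

text \<open>The integral of the zero extension of g vanishes over half-lines, an intersection-stable
  generator of the Borel sets. Dynkin induction over complements and disjoint unions reaches all
  Borel sets, and Lebesgue sets differ from these by null sets.\<close>

lemma zero_if_primitive_zero:
  assumes g: "integrable (lebesgue_on {0..l}) (g :: real \<Rightarrow> complex)" and l: "0 \<le> l"
    and z: "\<And>x. x \<in> {0..l} \<Longrightarrow> (LINT t|lebesgue_on {0..x}. g t) = 0"
  shows "AE x in lebesgue_on {0..l}. g x = 0"
proof -
  define G where "G = zext l g"
  have G: "integrable lebesgue G" using g unfolding G_def zext_def by (subst Lebesgue_Measure.integrable_restrict_UNIV) auto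
  have half: "(LINT x|lebesgue. indicat_real {..a} x *\<^sub>R G x) = 0" for a
  proof -
    have "(LINT x|lebesgue. indicat_real {..a} x *\<^sub>R G x) = (LINT x|lebesgue_on {0..min a l}. g x)" if "0 \<le> a"
      by (subst Lebesgue_Measure.integral_restrict_UNIV[symmetric])
        (auto simp: G_def zext_def indicator_def intro!: Bochner_Integration.integral_cong)
    moreover have "(\<lambda>x. indicat_real {..a} x *\<^sub>R G x) = (\<lambda>x. 0)" if "a < 0"
      using that by (auto simp: G_def zext_def indicator_def)
    ultimately show ?thesis using z[of "min a l"] l by (cases "0 \<le> a") auto
  qed
  have tot: "(LINT x|lebesgue. G x) = 0"
  proof -
    have "(\<lambda>x. indicat_real {..l} x *\<^sub>R G x) = G" by (auto simp: G_def zext_def indicator_def fun_eq_iff)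
    then show ?thesis using half[of l] by simp
  qed
  have borel: "(LINT x|lebesgue. indicat_real B x *\<^sub>R G x) = 0" if "B \<in> sets borel" for B :: "real set"
  proof -
    have sb: "sigma_sets UNIV (range (\<lambda>a::real. {..a})) = sets borel"
      by (subst borel_eq_atMost) (simp add: sets_measure_of)
    have "Int_stable (range (\<lambda>a::real. {..a}))" by (auto simp: Int_stable_def)
    moreover have "range (\<lambda>a::real. {..a}) \<subseteq> Pow UNIV" by simp
    moreover have "B \<in> sigma_sets UNIV (range (\<lambda>a::real. {..a}))"
      using that by (simp add: sb)
    ultimately show ?thesis
    proof (induct rule: sigma_sets_induct_disjoint)
      case (basic A) then show ?case using half by auto
    next
      case (compl A)
      have "A \<in> sets lebesgue" using compl(1) unfolding sb by (intro sets_completionI_sets) simp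
      then have i: "integrable lebesgue (\<lambda>x. indicat_real A x *\<^sub>R G x)" using G by (rule integrable_mult_indicator)
      have "(LINT x|lebesgue. indicat_real (UNIV - A) x *\<^sub>R G x) = (LINT x|lebesgue. G x - indicat_real A x *\<^sub>R G x)"
        by (intro Bochner_Integration.integral_cong) (auto simp: indicator_def)
      also have "\<dots> = 0" using tot compl(2) by (simp add: Bochner_Integration.integral_diff[OF G i])
      finally show ?case .
    next
      case (union A)
      have "A i \<in> sets lebesgue" for i using union(2) unfolding sb by (intro sets_completionI_sets) auto
      then show ?case
        using lebesgue_integral_countable_add[of A lebesgue G] union(1,3) G
        by (simp add: set_lebesgue_integral_def disjoint_family_on_def set_integrable_def integrable_mult_indicator)
    qed (auto)
  qed
  have leb: "(LINT x|lebesgue. indicat_real A x *\<^sub>R G x) = 0" if "A \<in> sets lebesgue" for A :: "real set"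
  proof -
    obtain B N N' where A: "A = B \<union> N" "N \<subseteq> N'" "N' \<in> null_sets lborel" "B \<in> sets lborel"
      using \<open>A \<in> sets lebesgue\<close> by (rule sets_completionE)
    have "AE x in lborel. x \<notin> N'" using A(3) by (rule AE_not_in)
    then have "AE x in lebesgue. x \<notin> N'" by (rule AE_completion)
    then have "AE x in lebesgue. indicat_real A x *\<^sub>R G x = indicat_real B x *\<^sub>R G x"
      by eventually_elim (use A in \<open>auto simp: indicator_def\<close>)
    moreover have "integrable lebesgue (\<lambda>x. indicat_real A x *\<^sub>R G x)" "integrable lebesgue (\<lambda>x. indicat_real B x *\<^sub>R G x)"
      using \<open>A \<in> sets lebesgue\<close> A(4) G by (auto intro!: integrable_mult_indicator)
    ultimately have "(LINT x|lebesgue. indicat_real A x *\<^sub>R G x) = (LINT x|lebesgue. indicat_real B x *\<^sub>R G x)"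
      by (intro integral_cong_AE) auto
    then show ?thesis using borel[of B] A(4) by simp
  qed
  show ?thesis
  proof (rule sigma_finite_measure.density_zero[OF _ g])
    show "sigma_finite_measure (lebesgue_on {0..l})"
      by (intro finite_measure.axioms(1) finite_measure_lebesgue_on) simp
    fix A assume "A \<in> sets (lebesgue_on {0..l})"
    then have "A \<in> sets lebesgue" by (simp add: sets_restrict_space_iff)
    then have "(LINT x|lebesgue. (if x \<in> {0..l} then indicat_real A x *\<^sub>R g x else 0)) = 0"
      using leb[of A] by (simp add: G_def zext_def if_distrib cong: if_cong)
    then show "set_lebesgue_integral (lebesgue_on {0..l}) A g = 0"
      unfolding set_lebesgue_integral_def
      by (subst Lebesgue_Measure.integral_restrict_UNIV[symmetric]) auto
  qed
qed

text \<open>Fubini takes the place of the product rule, as f and g are merely integrable: each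
  summand is an integral of f(x) g(t) over half of the square.\<close>

lemma integral_by_parts_primitive:
  assumes f: "integrable (lebesgue_on {0..l}) (f :: real \<Rightarrow> complex)" and g: "integrable (lebesgue_on {0..l}) (g :: real \<Rightarrow> complex)"
  shows "(LINT x|lebesgue_on {0..l}. f x * (LINT t|lebesgue_on {0..x}. g t) + (LINT t|lebesgue_on {0..x}. f t) * g x)
    = (LINT x|lebesgue_on {0..l}. f x) * (LINT x|lebesgue_on {0..l}. g x)"
proof -
  let ?M = "lebesgue_on {0..l}"
  define c where "c x t = (if t \<le> x then 1 else (0::complex))" for x t :: real
  interpret finite_measure ?M by (rule finite_measure_lebesgue_on) simp
  interpret pair_sigma_finite ?M ?M by unfold_locales
  have cm: "(\<lambda>p. c (fst p) (snd p)) \<in> borel_measurable (?M \<Otimes>\<^sub>M ?M)"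
  proof -
    have id: "(\<lambda>x. x) \<in> borel_measurable ?M"
      by (intro measurable_restrict_space1 measurable_completion) simp
    have "fst \<in> borel_measurable (?M \<Otimes>\<^sub>M ?M)" "snd \<in> borel_measurable (?M \<Otimes>\<^sub>M ?M)"
      using measurable_compose[OF measurable_fst id, of ?M] measurable_compose[OF measurable_snd id, of ?M] by simp_all
    then show ?thesis unfolding c_def by measurable
  qed
  have fm: "(\<lambda>p. f (fst p)) \<in> borel_measurable (?M \<Otimes>\<^sub>M ?M)" "(\<lambda>p. g (snd p)) \<in> borel_measurable (?M \<Otimes>\<^sub>M ?M)"
    using measurable_compose[OF measurable_fst borel_measurable_integrable[OF f], of ?M]
      measurable_compose[OF measurable_snd borel_measurable_integrable[OF g], of ?M] by simp_all
  have cg: "integrable ?M (\<lambda>t. c x t * g t)" for x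
  proof (rule Bochner_Integration.integrable_bound[OF g])
    show "(\<lambda>t. c x t * g t) \<in> borel_measurable ?M"
    proof (intro borel_measurable_times borel_measurable_integrable[OF g])
      have "indicator {..x} \<in> borel_measurable (borel :: real measure)" by measurable
      then have "(indicator {..x} :: real \<Rightarrow> complex) \<in> borel_measurable ?M"
        by (intro measurable_restrict_space1 measurable_completion) simp
      then show "c x \<in> borel_measurable ?M" by (simp add: c_def indicator_def of_bool_def cong: measurable_cong)
    qed
  qed (auto simp: c_def)
  have int: "integrable (?M \<Otimes>\<^sub>M ?M) (\<lambda>(x, t). c x t * (f x * g t))"
  proof (rule Bochner_Integration.integrable_bound[where f="\<lambda>p. f (fst p) * g (snd p)"])
    show "integrable (?M \<Otimes>\<^sub>M ?M) (\<lambda>p. f (fst p) * g (snd p))"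
    proof (rule Fubini_integrable)
      show "(\<lambda>p. f (fst p) * g (snd p)) \<in> borel_measurable (?M \<Otimes>\<^sub>M ?M)" using fm by (rule borel_measurable_times)
      show "integrable ?M (\<lambda>x. LINT y|?M. norm (f (fst (x, y)) * g (snd (x, y))))"
        using f by (simp add: norm_mult)
      show "AE x in ?M. integrable ?M (\<lambda>y. f (fst (x, y)) * g (snd (x, y)))" using g by simp
    qed
    have "(\<lambda>p. c (fst p) (snd p) * (f (fst p) * g (snd p))) \<in> borel_measurable (?M \<Otimes>\<^sub>M ?M)"
      using cm fm by (intro borel_measurable_times)
    then show "(\<lambda>(x, t). c x t * (f x * g t)) \<in> borel_measurable (?M \<Otimes>\<^sub>M ?M)" by (simp add: case_prod_beta)
  qed (auto simp: c_def norm_mult)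
  have pg: "(LINT t|lebesgue_on {0..x}. g t) = (LINT t|?M. c x t * g t)" if "x \<in> {0..l}" for x
    unfolding integral_initial_segment[OF that] c_def by (intro Bochner_Integration.integral_cong) auto
  have pf: "(LINT t|lebesgue_on {0..x}. f t) = (LINT t|?M. c x t * f t)" if "x \<in> {0..l}" for x
    unfolding integral_initial_segment[OF that] c_def by (intro Bochner_Integration.integral_cong) auto
  have 1: "(LINT x|?M. f x * (LINT t|lebesgue_on {0..x}. g t)) = (LINT t|?M. LINT x|?M. c x t * (f x * g t))"
  proof -
    have "(LINT x|?M. f x * (LINT t|lebesgue_on {0..x}. g t)) = (LINT x|?M. LINT t|?M. c x t * (f x * g t))"
    proof (rule Bochner_Integration.integral_cong[OF refl])
      fix x assume "x \<in> space ?M"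
      then show "f x * (LINT t|lebesgue_on {0..x}. g t) = (LINT t|?M. c x t * (f x * g t))"
        by (simp add: pg mult.left_commute flip: integral_mult_right_zero)
    qed
    then show ?thesis by (simp add: Fubini_integral[OF int])
  qed
  have 2: "(LINT t|?M. (LINT x|lebesgue_on {0..t}. f x) * g t) = (LINT t|?M. LINT x|?M. c t x * (f x * g t))"
  proof (rule Bochner_Integration.integral_cong[OF refl])
    fix t assume "t \<in> space ?M"
    then show "(LINT x|lebesgue_on {0..t}. f x) * g t = (LINT x|?M. c t x * (f x * g t))"
      by (simp add: pf mult.assoc flip: integral_mult_left_zero)
  qed
  \<comment> \<open>The two triangles cover the square and overlap only on the diagonal.\<close>
  have 3: "(LINT x|?M. c x t * (f x * g t)) + (LINT x|?M. c t x * (f x * g t)) = (LINT x|?M. f x) * g t" for t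
  proof -
    have m: "(\<lambda>x. c x t) \<in> borel_measurable ?M" "(\<lambda>x. c t x) \<in> borel_measurable ?M"
    proof -
      have "indicator {..t} \<in> borel_measurable (borel :: real measure)" "indicator {t..} \<in> borel_measurable (borel :: real measure)" by measurable
      then have "(indicator {..t} :: real \<Rightarrow> complex) \<in> borel_measurable ?M" "(indicator {t..} :: real \<Rightarrow> complex) \<in> borel_measurable ?M"
        by (auto intro!: measurable_restrict_space1 measurable_completion)
      then show "(\<lambda>x. c x t) \<in> borel_measurable ?M" "(\<lambda>x. c t x) \<in> borel_measurable ?M"
        by (simp_all add: c_def indicator_def of_bool_def cong: measurable_cong)
    qed
    have fg: "integrable ?M (\<lambda>x. f x * g t)" using f by simp
    have i: "integrable ?M (\<lambda>x. c x t * (f x * g t))" "integrable ?M (\<lambda>x. c t x * (f x * g t))"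
      by (rule Bochner_Integration.integrable_bound[OF fg];
          use m borel_measurable_integrable[OF fg] in \<open>auto simp: c_def norm_mult intro!: borel_measurable_times\<close>)+
    have "AE x in lebesgue. x \<noteq> t" by (rule AE_completion[OF AE_lborel_singleton])
    then have "AE x in ?M. c x t * (f x * g t) + c t x * (f x * g t) = f x * g t"
      unfolding AE_ivl_iff by eventually_elim (auto simp: c_def)
    then have "(LINT x|?M. c x t * (f x * g t) + c t x * (f x * g t)) = (LINT x|?M. f x * g t)"
      using i fg by (intro integral_cong_AE) auto
    then show ?thesis by (simp add: Bochner_Integration.integral_add[OF i])
  qed
  have cont: "continuous_on {0..l} (\<lambda>x. LINT t|lebesgue_on {0..x}. h t)" if "integrable ?M h" for h :: "real \<Rightarrow> complex"
    using that by (rule integral_initial_continuous)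
  have bm: "integrable ?M (\<lambda>x. h x * k x)" if h: "integrable ?M h" and k: "continuous_on {0..l} k" for h k :: "real \<Rightarrow> complex"
  proof -
    have "bounded (k ` {0..l})" by (intro compact_imp_bounded compact_continuous_image k) simp
    then obtain C where C: "\<forall>x\<in>{0..l}. cmod (k x) \<le> C" by (auto simp: bounded_iff)
    show ?thesis
    proof (rule Bochner_Integration.integrable_bound[where f="\<lambda>x. C *\<^sub>R h x"])
      show "(\<lambda>x. h x * k x) \<in> borel_measurable ?M"
        using h k by (intro borel_measurable_times borel_measurable_integrable continuous_imp_measurable_on_sets_lebesgue) auto
      show "AE x in ?M. norm (h x * k x) \<le> norm (C *\<^sub>R h x)"
      proof (rule AE_ivlI)
        fix x assume "x \<in> {0..l}"
        then have "cmod (k x) \<le> \<bar>C\<bar>" using C by force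
        then show "norm (h x * k x) \<le> norm (C *\<^sub>R h x)"
          by (simp add: norm_mult mult.commute[of "cmod (h x)"] mult_right_mono)
      qed
    qed (use h in simp)
  qed
  have "(LINT x|?M. f x * (LINT t|lebesgue_on {0..x}. g t) + (LINT t|lebesgue_on {0..x}. f t) * g x)
    = (LINT x|?M. f x * (LINT t|lebesgue_on {0..x}. g t)) + (LINT x|?M. (LINT t|lebesgue_on {0..x}. f t) * g x)"
    using bm[OF f cont[OF g]] bm[OF g cont[OF f]] by (intro Bochner_Integration.integral_add) (auto simp: mult.commute)
  also have "\<dots> = (LINT t|?M. (LINT x|?M. c x t * (f x * g t))) + (LINT t|?M. (LINT x|?M. c t x * (f x * g t)))"
    by (simp add: 1 2)
  also have "\<dots> = (LINT t|?M. (LINT x|?M. c x t * (f x * g t)) + (LINT x|?M. c t x * (f x * g t)))"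
  proof (rule Bochner_Integration.integral_add[symmetric])
    show "integrable ?M (\<lambda>t. LINT x|?M. c x t * (f x * g t))" using integrable_snd[OF int] by simp
    have "integrable ?M (\<lambda>t. (LINT x|lebesgue_on {0..t}. f x) * g t)"
      using bm[OF g cont[OF f]] by (simp add: mult.commute)
    then show "integrable ?M (\<lambda>t. LINT x|?M. c t x * (f x * g t))"
      by (rule Bochner_Integration.integrable_cong[THEN iffD1, rotated 2])
        (auto simp: pf mult.assoc simp flip: integral_mult_left_zero)
  qed
  also have "\<dots> = (LINT x|?M. f x) * (LINT x|?M. g x)" by (simp add: 3)
  finally show ?thesis .
qed

text \<open>\<open>F\<close> is the absolutely continuous representative of \<open>f\<close> on \<open>[0, l]\<close>, with derivative \<open>g\<close> in \<open>L\<^sup>2\<close>.\<close>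

definition wder :: "real \<Rightarrow> (real \<Rightarrow> complex) \<Rightarrow> (real \<Rightarrow> complex) \<Rightarrow> (real \<Rightarrow> complex) \<Rightarrow> bool" where
  "wder l f F g \<longleftrightarrow> L2 0 l f \<and> L2 0 l g \<and> (\<forall>x\<in>{0..l}. F x = F 0 + (LINT t|lebesgue_on {0..x}. g t))
     \<and> (AE x in lebesgue_on {0..l}. f x = F x)"

lemma wderD:
  assumes "wder l f F g"
  shows "L2 0 l f" "L2 0 l g" "x \<in> {0..l} \<Longrightarrow> F x = F 0 + (LINT t|lebesgue_on {0..x}. g t)"
    "AE x in lebesgue_on {0..l}. f x = F x"
  using assms unfolding wder_def by blast+

lemma wder_continuous:
  assumes "wder l f F g"
  shows "continuous_on {0..l} F"
proof (rule continuous_on_eq)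
  show "continuous_on {0..l} (\<lambda>x. F 0 + (LINT t|lebesgue_on {0..x}. g t))"
    by (rule continuous_on_add[OF continuous_on_const integral_initial_continuous[OF L2_integrable[OF wderD(2)[OF assms]]]])
qed (rule wderD(3)[OF assms, symmetric])

text \<open>The set of agreement is closed and of full measure, so it contains the open interval and
  with it the closure.\<close>

lemma continuous_AE_unique:
  assumes "0 < l" and F: "continuous_on {0..l} F" and G: "continuous_on {0..l} (G :: real \<Rightarrow> complex)"
    and ae: "AE x in lebesgue_on {0..l}. F x = G x" and x: "x \<in> {0..l}"
  shows "F x = G x"
proof -
  define E where "E = {x \<in> {0..l}. F x - G x = 0}"
  have E: "closed E"
    unfolding E_def using F G by (intro continuous_closed_preimage_constant continuous_on_diff) auto
  have "AE x in lebesgue. x \<in> {0<..<l} \<longrightarrow> x \<in> E"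
    using ae unfolding AE_ivl_iff by eventually_elim (auto simp: E_def)
  then have "{0<..<l} \<subseteq> E"
    by (intro subsetI) (rule mem_closed_if_AE_lebesgue_open[OF open_greaterThanLessThan E])
  then have "closure {0<..<l} \<subseteq> E" using E by (rule closure_minimal)
  then show ?thesis using x assms(1) by (auto simp: E_def)
qed

lemma wder_unique:
  assumes l: "0 < l" and w: "wder l f F g" "wder l f' F' g'" and ae: "AE x in lebesgue_on {0..l}. f x = f' x"
  shows "x \<in> {0..l} \<Longrightarrow> F x = F' x" "AE x in lebesgue_on {0..l}. g x = g' x"
proof -
  have "AE x in lebesgue_on {0..l}. F x = F' x"
    using ae wderD(4)[OF w(1)] wderD(4)[OF w(2)] by eventually_elim simp
  then have FF: "F x = F' x" if "x \<in> {0..l}" for x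
    using that by (intro continuous_AE_unique[OF l wder_continuous[OF w(1)] wder_continuous[OF w(2)]])
  then show "x \<in> {0..l} \<Longrightarrow> F x = F' x" .
  note i = L2_integrable[OF wderD(2)[OF w(1)]] L2_integrable[OF wderD(2)[OF w(2)]]
  have "AE x in lebesgue_on {0..l}. g x - g' x = 0"
  proof (rule zero_if_primitive_zero)
    show "integrable (lebesgue_on {0..l}) (\<lambda>x. g x - g' x)" using i by (rule Bochner_Integration.integrable_diff)
    fix x assume x: "x \<in> {0..l}"
    have sub: "integrable (lebesgue_on {0..x}) g" "integrable (lebesgue_on {0..x}) g'"
      using x by (auto intro!: Equivalence_Lebesgue_Henstock_Integration.integrable_subinterval[OF i(1)]
          Equivalence_Lebesgue_Henstock_Integration.integrable_subinterval[OF i(2)])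
    show "(LINT t|lebesgue_on {0..x}. g t - g' t) = 0"
      using wderD(3)[OF w(1) x] wderD(3)[OF w(2) x] FF[OF x] FF[of 0] l
      by (simp add: Bochner_Integration.integral_diff[OF sub])
  qed (use l in simp)
  then show "AE x in lebesgue_on {0..l}. g x = g' x" by simp
qed

lemma wder_imp_H1:
  assumes "wder l f F g"
  shows "H1 0 l f"
  unfolding H1_def using wderD[OF assms] wder_continuous[OF assms] by blast

text \<open>\<open>crep\<close> and \<open>wd\<close> are choices. The chosen continuous
  representative must coincide with the witness F, and so the predicate behind \<open>wd\<close> is
  satisfiable and its choice is a genuine weak derivative.\<close>

lemma H1_imp_wder:
  assumes l: "0 < l" and "H1 0 l f"
  shows "wder l f (crep 0 l f) (wd 0 l f)"
proof -
  from assms(2) obtain g F where w: "L2 0 l f" "L2 0 l g" "continuous_on {0..l} F"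
    "\<forall>x\<in>{0..l}. F x = F 0 + (LINT t|lebesgue_on {0..x}. g t)" "AE x in lebesgue_on {0..l}. f x = F x"
    unfolding H1_def by blast
  then have "\<exists>F. continuous_on {0..l} F \<and> (AE x in lebesgue_on {0..l}. f x = F x)" by blast
  from someI_ex[OF this] have c: "continuous_on {0..l} (crep 0 l f)" "AE x in lebesgue_on {0..l}. f x = crep 0 l f x"
    unfolding crep_def by auto
  have "AE x in lebesgue_on {0..l}. crep 0 l f x = F x" using w(5) c(2) by eventually_elim simp
  then have e: "crep 0 l f x = F x" if "x \<in> {0..l}" for x
    using continuous_AE_unique[OF l c(1) w(3)] that by blast
  have "\<exists>g. L2 0 l g \<and> (\<forall>x\<in>{0..l}. crep 0 l f x = crep 0 l f 0 + integral\<^sup>L (lebesgue_on {0..x}) g)"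
  proof (intro exI[of _ g] conjI ballI w(2))
    fix x assume x: "x \<in> {0..l}"
    have 0: "0 \<in> {0..l}" using l by simp
    show "crep 0 l f x = crep 0 l f 0 + integral\<^sup>L (lebesgue_on {0..x}) g"
      unfolding e[OF x] e[OF 0] by (rule bspec[OF w(4) x])
  qed
  from someI_ex[OF this] show ?thesis
    unfolding wder_def wd_def using w(1) c(2) by blast
qed

lemma wder_crep: "0 < l \<Longrightarrow> wder l f F g \<Longrightarrow> x \<in> {0..l} \<Longrightarrow> crep 0 l f x = F x"
  by (rule wder_unique(1)[OF _ H1_imp_wder[OF _ wder_imp_H1]]) auto

lemma wder_wd: "0 < l \<Longrightarrow> wder l f F g \<Longrightarrow> AE x in lebesgue_on {0..l}. wd 0 l f x = g x"
  by (rule wder_unique(2)[OF _ H1_imp_wder[OF _ wder_imp_H1]]) auto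

lemma wder_cong:
  assumes w: "wder l f F g" and "L2 0 l f'" "AE x in lebesgue_on {0..l}. f x = f' x"
    "L2 0 l g'" and g: "AE x in lebesgue_on {0..l}. g x = g' x" and F: "\<And>x. x \<in> {0..l} \<Longrightarrow> F x = F' x" and "0 \<le> l"
  shows "wder l f' F' g'"
  unfolding wder_def
proof (intro conjI ballI)
  show "AE x in lebesgue_on {0..l}. f' x = F' x"
  proof -
    have "AE x in lebesgue_on {0..l}. F x = F' x" by (rule AE_ivlI) (rule F)
    then show ?thesis using assms(3) wderD(4)[OF w] by eventually_elim simp
  qed
  fix x assume x: "x \<in> {0..l}"
  have "(LINT t|lebesgue_on {0..x}. g t) = (LINT t|lebesgue_on {0..x}. g' t)"
  proof (rule integral_cong_AE)
    show "AE t in lebesgue_on {0..x}. g t = g' t" using g unfolding AE_ivl_iff by eventually_elim (use x in auto)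
    show "g \<in> borel_measurable (lebesgue_on {0..x})" "g' \<in> borel_measurable (lebesgue_on {0..x})"
      using x by (auto intro!: borel_measurable_integrable
          Equivalence_Lebesgue_Henstock_Integration.integrable_subinterval[OF L2_integrable[OF wderD(2)[OF w]]]
          Equivalence_Lebesgue_Henstock_Integration.integrable_subinterval[OF L2_integrable[OF assms(4)]])
  qed
  then show "F' x = F' 0 + (LINT t|lebesgue_on {0..x}. g' t)"
    using wderD(3)[OF w x] F[OF x] F[of 0] \<open>0 \<le> l\<close> by simp
qed fact+

lemma wder_lin:
  assumes w: "wder l f F g" "wder l f' F' g'"
  shows "wder l (\<lambda>x. a * f x + b * f' x) (\<lambda>x. a * F x + b * F' x) (\<lambda>x. a * g x + b * g' x)"
  unfolding wder_def
proof (intro conjI ballI L2_lin wderD(1,2)[OF w(1)] wderD(1,2)[OF w(2)])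
  note i = L2_integrable[OF wderD(2)[OF w(1)]] L2_integrable[OF wderD(2)[OF w(2)]]
  fix x assume x: "x \<in> {0..l}"
  have sub: "integrable (lebesgue_on {0..x}) g" "integrable (lebesgue_on {0..x}) g'"
    using x by (auto intro!: Equivalence_Lebesgue_Henstock_Integration.integrable_subinterval[OF i(1)]
        Equivalence_Lebesgue_Henstock_Integration.integrable_subinterval[OF i(2)])
  have "(LINT t|lebesgue_on {0..x}. a * g t + b * g' t) = a * (LINT t|lebesgue_on {0..x}. g t) + b * (LINT t|lebesgue_on {0..x}. g' t)"
    using sub by (subst Bochner_Integration.integral_add) auto
  then show "a * F x + b * F' x = a * F 0 + b * F' 0 + (LINT t|lebesgue_on {0..x}. a * g t + b * g' t)"
    using wderD(3)[OF w(1) x] wderD(3)[OF w(2) x] by (simp add: algebra_simps)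
next
  show "AE x in lebesgue_on {0..l}. a * f x + b * f' x = a * F x + b * F' x"
    using wderD(4)[OF w(1)] wderD(4)[OF w(2)] by eventually_elim simp
qed

lemma integral_point_zero: "(LINT t|lebesgue_on {0::real}. g t) = (0::complex)"
  by (rule integral_eq_zero_null_sets) (simp add: null_sets_restrict_space)

lemma wder_primitive:
  assumes g: "L2 0 l g"
  shows "wder l (\<lambda>x. c + (LINT t|lebesgue_on {0..x}. g t)) (\<lambda>x. c + (LINT t|lebesgue_on {0..x}. g t)) g"
proof -
  have "L2 0 l (\<lambda>x. c + (LINT t|lebesgue_on {0..x}. g t))"
    by (rule L2_continuous[OF continuous_on_add[OF continuous_on_const integral_initial_continuous[OF L2_integrable[OF g]]]])
  then show ?thesis using g by (simp add: wder_def integral_point_zero)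
qed

lemma ex_primitive:
  assumes "L2 0 l g"
  obtains G where "wder l G G g" "G 0 = c"
  by (rule that[OF wder_primitive[OF assms, of c]]) (simp add: integral_point_zero)

lemma ex_primitive_right:
  assumes "L2 0 l g"
  obtains G where "wder l G G g" "G l = c"
  by (rule that[OF wder_primitive[OF assms, of "c - (LINT t|lebesgue_on {0..l}. g t)"]]) simp

lemma wder_smooth:
  assumes p: "\<And>x. x \<in> {0..l} \<Longrightarrow> (p has_vector_derivative p' x) (at x within {0..l})" and c: "continuous_on {0..l} p'"
  shows "wder l p p p'"
  unfolding wder_def
proof (intro conjI ballI)
  have "continuous_on {0..l} p"
    using p by (meson continuous_on_eq_continuous_within has_vector_derivative_continuous)
  then show "L2 0 l p" by (rule L2_continuous)
  fix x assume x: "x \<in> {0..l}"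
  have i: "integrable (lebesgue_on {0..x}) p'"
    using x c by (intro continuous_imp_integrable_real) (auto elim: continuous_on_subset)
  have "(p' has_integral p x - p 0) {0..x}"
    using x by (intro fundamental_theorem_of_calculus) (auto intro: has_vector_derivative_within_subset[OF p])
  then have "integral {0..x} p' = p x - p 0" by (rule integral_unique)
  then show "p x = p 0 + (LINT t|lebesgue_on {0..x}. p' t)"
    using lebesgue_integral_eq_integral[OF i] by simp
qed (use c in \<open>auto intro: L2_continuous\<close>)

lemma wder_real_smooth:
  assumes "\<And>x. (f has_real_derivative f' x) (at x)" "continuous_on UNIV f'"
  shows "wder l (\<lambda>x. of_real (f x)) (\<lambda>x. of_real (f x)) (\<lambda>x. of_real (f' x))"
proof (rule wder_smooth)
  fix x
  have "(f has_vector_derivative f' x) (at x within {0..l})"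
    by (rule has_vector_derivative_at_within[OF assms(1)[unfolded has_real_derivative_iff_has_vector_derivative]])
  then show "((\<lambda>x. of_real (f x) :: complex) has_vector_derivative of_real (f' x)) (at x within {0..l})"
    by (rule bounded_linear.has_vector_derivative[OF bounded_linear_of_real])
qed (rule continuous_on_of_real[OF continuous_on_subset[OF assms(2) subset_UNIV]])

section \<open>Inner products, integration by parts, products with affine functions\<close>

lemma l2inner_cong:
  assumes "L2 0 l f" "L2 0 l f'" "L2 0 l g" "L2 0 l g'"
    "AE x in lebesgue_on {0..l}. f x = f' x" "AE x in lebesgue_on {0..l}. g x = g' x"
  shows "l2inner 0 l f g = l2inner 0 l f' g'"
  unfolding l2inner_def
proof (rule integral_cong_AE)
  show "(\<lambda>x. f x * cnj (g x)) \<in> borel_measurable (lebesgue_on {0..l})"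
    "(\<lambda>x. f' x * cnj (g' x)) \<in> borel_measurable (lebesgue_on {0..l})"
    using assms(1-4) by (auto simp: L2_def intro!: borel_measurable_times borel_measurable_cnj)
  show "AE x in lebesgue_on {0..l}. f x * cnj (g x) = f' x * cnj (g' x)"
    using assms(5,6) by eventually_elim simp
qed

lemma l2_integrable_mult:
  assumes "L2 0 l f" "L2 0 l g"
  shows "integrable (lebesgue_on {0..l}) (\<lambda>x. f x * cnj (g x))"
proof -
  have "(\<lambda>x. zext l f x * cnj (zext l g x)) = (\<lambda>x. if x \<in> {0..l} then f x * cnj (g x) else 0)"
    by (auto simp: zext_def)
  then show ?thesis
    using sq_integrable_mult[of "zext l f" "zext l g"] assms
      Lebesgue_Measure.integrable_restrict_UNIV[of "{0..l}" "\<lambda>x. f x * cnj (g x)"]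
    by (simp add: L2_iff_sq_integrable)
qed

lemma l2inner_lin_left:
  assumes "L2 0 l f" "L2 0 l f'" "L2 0 l g"
  shows "l2inner 0 l (\<lambda>x. a * f x + b * f' x) g = a * l2inner 0 l f g + b * l2inner 0 l f' g"
  using l2_integrable_mult[OF assms(1,3)] l2_integrable_mult[OF assms(2,3)]
  unfolding l2inner_def by (simp add: distrib_right mult.assoc)

lemma l2inner_commute: "l2inner 0 l g f = cnj (l2inner 0 l f g)"
  unfolding l2inner_def
  using Bochner_Integration.integral_cnj[of "lebesgue_on {0..l}" "\<lambda>x. f x * cnj (g x)"] by (simp add: mult.commute)

text \<open>Primes mark the second function here, not derivatives. Passing to continuous
  representatives and splitting off the constants F 0 and F' 0 leaves a product of two primitives,
  the case of \<open>integral_by_parts_primitive\<close>.\<close>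

lemma wder_parts:
  assumes l: "0 \<le> l" and w: "wder l f F g" "wder l f' F' g'"
  shows "l2inner 0 l g f' + l2inner 0 l f g' = F l * cnj (F' l) - F 0 * cnj (F' 0)"
proof -
  let ?M = "lebesgue_on {0..l}"
  note L = wderD(1,2)[OF w(1)] wderD(1,2)[OF w(2)]
  have LF: "L2 0 l F" "L2 0 l F'" using wder_continuous w L2_continuous by blast+
  define G where "G x = (LINT t|lebesgue_on {0..x}. g t)" for x
  define G' where "G' x = (LINT t|lebesgue_on {0..x}. cnj (g' t))" for x
  have F: "F x = F 0 + G x" "cnj (F' x) = cnj (F' 0) + G' x" if "x \<in> {0..l}" for x
    using wderD(3)[OF w(1) that] wderD(3)[OF w(2) that] by (simp_all add: G_def G'_def)
  have i: "integrable ?M g" "integrable ?M (\<lambda>t. cnj (g' t))" using L by (auto intro: L2_integrable)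
  have "l2inner 0 l g f' + l2inner 0 l f g' = l2inner 0 l g F' + l2inner 0 l F g'"
    using l2inner_cong[OF L(2,2,3) LF(2) _ wderD(4)[OF w(2)]] l2inner_cong[OF L(1) LF(1) L(4,4) wderD(4)[OF w(1)]] by simp
  also have "\<dots> = (LINT x|?M. g x * cnj (F' x) + F x * cnj (g' x))"
    unfolding l2inner_def using l2_integrable_mult[OF L(2) LF(2)] l2_integrable_mult[OF LF(1) L(4)] by simp
  also have "\<dots> = (LINT x|?M. (cnj (F' 0) * g x + F 0 * cnj (g' x)) + (g x * G' x + G x * cnj (g' x)))"
  proof (rule Bochner_Integration.integral_cong[OF refl])
    fix x assume "x \<in> space ?M"
    then have "x \<in> {0..l}" by simp
    from F(1)[OF this] F(2)[OF this]
    show "g x * cnj (F' x) + F x * cnj (g' x) = (cnj (F' 0) * g x + F 0 * cnj (g' x)) + (g x * G' x + G x * cnj (g' x))"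
      by (simp add: algebra_simps)
  qed
  also have "\<dots> = (LINT x|?M. cnj (F' 0) * g x + F 0 * cnj (g' x)) + (LINT x|?M. g x * G' x + G x * cnj (g' x))"
  proof (rule Bochner_Integration.integral_add)
    show a: "integrable ?M (\<lambda>x. cnj (F' 0) * g x + F 0 * cnj (g' x))" using i by simp
    have "integrable ?M (\<lambda>x. (g x * cnj (F' x) + F x * cnj (g' x)) - (cnj (F' 0) * g x + F 0 * cnj (g' x)))"
      by (intro Bochner_Integration.integrable_diff Bochner_Integration.integrable_add
          l2_integrable_mult[OF L(2) LF(2)] l2_integrable_mult[OF LF(1) L(4)] a)
    then show "integrable ?M (\<lambda>x. g x * G' x + G x * cnj (g' x))"
    proof (rule Bochner_Integration.integrable_cong[THEN iffD1, rotated 2])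
      fix x assume "x \<in> space ?M"
      then have "x \<in> {0..l}" by simp
      from F(1)[OF this] F(2)[OF this]
      show "(g x * cnj (F' x) + F x * cnj (g' x)) - (cnj (F' 0) * g x + F 0 * cnj (g' x)) = g x * G' x + G x * cnj (g' x)"
        by (simp add: algebra_simps)
    qed simp
  qed
  also have "(LINT x|?M. g x * G' x + G x * cnj (g' x)) = G l * G' l"
    using integral_by_parts_primitive[OF i] by (simp add: G_def G'_def)
  also have "(LINT x|?M. cnj (F' 0) * g x + F 0 * cnj (g' x)) = cnj (F' 0) * G l + F 0 * G' l"
    using i by (simp add: G_def G'_def)
  also have "cnj (F' 0) * G l + F 0 * G' l + G l * G' l = F l * cnj (F' l) - F 0 * cnj (F' 0)"
    using F[of l] l by (simp add: algebra_simps)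
  finally show ?thesis .
qed

text \<open>The product rule comes from \<open>integral_by_parts_primitive\<close> on [0, x] with
  the densities 1 and g; the constants F 0 and c account for the remaining terms.\<close>

lemma wder_mult_affine:
  assumes w: "wder l f F g"
  shows "wder l (\<lambda>x. of_real (x - c) * f x) (\<lambda>x. of_real (x - c) * F x) (\<lambda>x. f x + of_real (x - c) * g x)"
  unfolding wder_def
proof (intro conjI ballI)
  show "L2 0 l (\<lambda>x. of_real (x - c) * f x)" by (rule L2_affine_mult[OF wderD(1)[OF w]])
  show "L2 0 l (\<lambda>x. f x + of_real (x - c) * g x)"
    using L2_lin[OF wderD(1)[OF w] L2_affine_mult[OF wderD(2)[OF w]], of 1 1] by simp
  show "AE x in lebesgue_on {0..l}. of_real (x - c) * f x = of_real (x - c) * F x"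
    using wderD(4)[OF w] by eventually_elim simp
  fix x assume x: "x \<in> {0..l}"
  let ?M = "lebesgue_on {0..x}"
  have sub: "integrable ?M h" if "integrable (lebesgue_on {0..l}) h" for h :: "real \<Rightarrow> complex"
    using x by (intro Equivalence_Lebesgue_Henstock_Integration.integrable_subinterval[OF that]) auto
  have ig: "integrable ?M g" and if': "integrable ?M f" and ixg: "integrable ?M (\<lambda>t. of_real (t - c) * g t)"
    and iF: "integrable ?M F"
    by (intro sub L2_integrable wderD(1,2)[OF w] L2_affine_mult L2_continuous[OF wder_continuous[OF w]])+
  have one: "(LINT s|lebesgue_on {0..t}. (1::complex)) = of_real t" if "t \<in> {0..x}" for t
    using that by (simp add: measure_restrict_space scaleR_conv_of_real)
  have "(LINT t|?M. 1 * (LINT s|lebesgue_on {0..t}. g s) + (LINT s|lebesgue_on {0..t}. (1::complex)) * g t)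
      = (LINT t|?M. 1) * (LINT t|?M. g t)"
    by (rule integral_by_parts_primitive[OF _ ig]) (intro continuous_imp_integrable_real continuous_intros)
  also have "\<dots> = of_real x * (F x - F 0)" using one[of x] wderD(3)[OF w x] x by simp
  finally have 1: "(LINT t|?M. 1 * (LINT s|lebesgue_on {0..t}. g s) + (LINT s|lebesgue_on {0..t}. (1::complex)) * g t)
      = of_real x * (F x - F 0)" .
  have 2: "(LINT t|?M. 1 * (LINT s|lebesgue_on {0..t}. g s) + (LINT s|lebesgue_on {0..t}. (1::complex)) * g t)
      = (LINT t|?M. (F t + of_real (t - c) * g t) + (of_real c * g t - F 0))"
  proof (rule Bochner_Integration.integral_cong[OF refl])
    fix t assume "t \<in> space ?M"
    then have t: "t \<in> {0..x}" "t \<in> {0..l}" using x by auto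
    show "1 * (LINT s|lebesgue_on {0..t}. g s) + (LINT s|lebesgue_on {0..t}. (1::complex)) * g t
        = (F t + of_real (t - c) * g t) + (of_real c * g t - F 0)"
      using wderD(3)[OF w t(2)] one[OF t(1)] by (simp add: algebra_simps)
  qed
  have 3: "\<dots> = (LINT t|?M. F t + of_real (t - c) * g t) + (of_real c * (F x - F 0) - of_real x * F 0)"
  proof -
    have k: "integrable ?M (\<lambda>t. F 0)" by (intro continuous_imp_integrable_real continuous_intros)
    have "(LINT t|?M. of_real c * g t - F 0) = of_real c * (F x - F 0) - of_real x * F 0"
      using ig k one[of x] wderD(3)[OF w x] x
      by (simp add: measure_restrict_space scaleR_conv_of_real)
    then show ?thesis
      using iF ixg ig k by (subst Bochner_Integration.integral_add) auto
  qed
  have 4: "(LINT t|?M. F t + of_real (t - c) * g t) = (LINT t|?M. f t + of_real (t - c) * g t)"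
  proof (rule integral_cong_AE)
    show "AE t in ?M. F t + of_real (t - c) * g t = f t + of_real (t - c) * g t"
      using wderD(4)[OF w] unfolding AE_ivl_iff by eventually_elim (use x in auto)
  qed (use iF if' ixg in \<open>auto intro!: borel_measurable_add borel_measurable_integrable\<close>)
  show "of_real (x - c) * F x = of_real (0 - c) * F 0 + (LINT t|?M. f t + of_real (t - c) * g t)"
    using 1 2 3 4 by (simp add: algebra_simps)
qed

section \<open>Pointwise bounds and compactness of balls in H1\<close>

lemma integral_const_ivl: "0 \<le> l \<Longrightarrow> (LINT x|lebesgue_on {0..l}. (c::real)) = l * c"
  by (simp add: measure_restrict_space)

lemma l2norm_le:
  assumes "L2 0 l f" "0 \<le> l" "0 \<le> e" and b: "\<And>x. x \<in> {0..l} \<Longrightarrow> cmod (f x) \<le> e"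
  shows "l2norm 0 l f \<le> sqrt l * e"
proof -
  have "(LINT x|lebesgue_on {0..l}. (cmod (f x))\<^sup>2) \<le> (LINT x|lebesgue_on {0..l}. e\<^sup>2)"
  proof (rule integral_mono)
    show "integrable (lebesgue_on {0..l}) (\<lambda>x. (cmod (f x))\<^sup>2)" using assms(1) by (simp add: L2_def)
    show "integrable (lebesgue_on {0..l}) (\<lambda>x. e\<^sup>2)" by (intro continuous_imp_integrable_real continuous_intros)
  qed (use assms in \<open>auto intro!: power_mono\<close>)
  then have "(LINT x|lebesgue_on {0..l}. (cmod (f x))\<^sup>2) \<le> l * e\<^sup>2"
    by (simp only: integral_const_ivl[OF assms(2)])
  then have "l2norm 0 l f \<le> sqrt (l * e\<^sup>2)" unfolding l2norm_def by (rule real_sqrt_le_mono)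
  then show ?thesis using assms by (simp add: real_sqrt_mult)
qed

lemma l2norm_ge:
  assumes "L2 0 l f" "0 \<le> l" "0 \<le> e" and b: "\<And>x. x \<in> {0..l} \<Longrightarrow> e \<le> cmod (f x)"
  shows "sqrt l * e \<le> l2norm 0 l f"
proof -
  have "(LINT x|lebesgue_on {0..l}. e\<^sup>2) \<le> (LINT x|lebesgue_on {0..l}. (cmod (f x))\<^sup>2)"
  proof (rule integral_mono)
    show "integrable (lebesgue_on {0..l}) (\<lambda>x. (cmod (f x))\<^sup>2)" using assms(1) by (simp add: L2_def)
    show "integrable (lebesgue_on {0..l}) (\<lambda>x. e\<^sup>2)" by (intro continuous_imp_integrable_real continuous_intros)
  qed (use assms in \<open>auto intro!: power_mono\<close>)
  then have "l * e\<^sup>2 \<le> (LINT x|lebesgue_on {0..l}. (cmod (f x))\<^sup>2)"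
    by (simp only: integral_const_ivl[OF assms(2)])
  then have "sqrt (l * e\<^sup>2) \<le> l2norm 0 l f" unfolding l2norm_def by (rule real_sqrt_le_mono)
  then show ?thesis using assms by (simp add: real_sqrt_mult)
qed

lemma l2norm_nonneg: "0 \<le> l2norm 0 l f"
  by (simp add: l2norm_def)

lemma wder_holder:
  assumes w: "wder l f F g" and x: "x \<in> {0..l}" "y \<in> {0..l}"
  shows "cmod (F x - F y) \<le> sqrt \<bar>x - y\<bar> * l2norm 0 l g"
proof -
  have *: "cmod (F x - F y) \<le> sqrt (x - y) * l2norm 0 l g" if "y \<le> x" "x \<in> {0..l}" "y \<in> {0..l}" for x y
    using holder_primitive[OF wderD(2)[OF w], of y x] wderD(3)[OF w that(2)] wderD(3)[OF w that(3)] that by simp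
  show ?thesis
    using *[of y x] *[of x y] x by (cases "y \<le> x") (auto simp: norm_minus_commute)
qed

text \<open>If |F x| exceeds sqrt l |g|, a bound for the oscillation of F, then |F| is at least the
  excess e on the whole interval, so sqrt l e is at most the norm of f.\<close>

lemma wder_sup_bound:
  assumes l: "0 < l" and w: "wder l f F g" and x: "x \<in> {0..l}"
  shows "cmod (F x) \<le> l2norm 0 l f / sqrt l + sqrt l * l2norm 0 l g"
proof (cases "cmod (F x) \<le> sqrt l * l2norm 0 l g")
  case False
  define e where "e = cmod (F x) - sqrt l * l2norm 0 l g"
  have LF: "L2 0 l F" using wder_continuous[OF w] by (rule L2_continuous)
  have "sqrt l * e \<le> l2norm 0 l F"
  proof (rule l2norm_ge[OF LF])
    fix y assume y: "y \<in> {0..l}"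
    have "cmod (F x - F y) \<le> sqrt \<bar>x - y\<bar> * l2norm 0 l g" by (rule wder_holder[OF w x y])
    also have "\<dots> \<le> sqrt l * l2norm 0 l g"
      using x y by (intro mult_right_mono real_sqrt_le_mono l2norm_nonneg) auto
    finally show "e \<le> cmod (F y)" using norm_triangle_ineq2[of "F x" "F y"] by (simp add: e_def)
  qed (use False l in \<open>auto simp: e_def\<close>)
  also have "l2norm 0 l F = l2norm 0 l f"
    using wderD(4)[OF w] emb_eq_iff[OF wderD(1)[OF w] LF] emb_norm LF wderD(1)[OF w] by metis
  finally have "e \<le> l2norm 0 l f / sqrt l" using l by (simp add: field_simps)
  then show ?thesis by (simp add: e_def)
next
  case True
  then show ?thesis using l l2norm_nonneg[of l f] by (meson add_increasing divide_nonneg_nonneg real_sqrt_ge_zero less_imp_le order.trans)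
qed

text \<open>Sequential relative compactness: the limit of the subsequence may lie outside the
  set.\<close>

definition relcomp :: "'a::topological_space set \<Rightarrow> bool" where
  "relcomp S \<longleftrightarrow> (\<forall>x::nat \<Rightarrow> 'a. (\<forall>n. x n \<in> S) \<longrightarrow> (\<exists>r k. strict_mono (r :: nat \<Rightarrow> nat) \<and> (\<lambda>n. x (r n)) \<longlonglongrightarrow> k))"

lemma relcomp_Times:
  assumes "relcomp S" "relcomp T"
  shows "relcomp (S \<times> T)"
  unfolding relcomp_def
proof (intro allI impI)
  fix x :: "nat \<Rightarrow> 'a \<times> 'b" assume x: "\<forall>n. x n \<in> S \<times> T"
  then have f: "\<forall>n. fst (x n) \<in> S" and s: "\<And>n. snd (x n) \<in> T" by (auto simp: mem_Times_iff)
  obtain r k where r: "strict_mono (r :: nat \<Rightarrow> nat)" "(\<lambda>n. fst (x (r n))) \<longlonglongrightarrow> k"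
    using assms(1)[unfolded relcomp_def, rule_format, of "\<lambda>n. fst (x n)"] f by auto
  obtain r' k' where r': "strict_mono (r' :: nat \<Rightarrow> nat)" "(\<lambda>n. snd (x (r (r' n)))) \<longlonglongrightarrow> k'"
    using assms(2)[unfolded relcomp_def, rule_format, of "\<lambda>n. snd (x (r n))"] s by auto
  have "(\<lambda>n. fst (x (r (r' n)))) \<longlonglongrightarrow> k" using LIMSEQ_subseq_LIMSEQ[OF r(2) r'(1)] by (simp add: comp_def)
  then have "(\<lambda>n. (fst (x (r (r' n))), snd (x (r (r' n))))) \<longlonglongrightarrow> (k, k')" using r'(2) by (rule tendsto_Pair)
  moreover have "strict_mono (\<lambda>n. r (r' n))" using strict_mono_o[OF r(1) r'(1)] by (simp add: comp_def)
  ultimately show "\<exists>r k. strict_mono (r :: nat \<Rightarrow> nat) \<and> (\<lambda>n. x (r n)) \<longlonglongrightarrow> k" by auto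
qed

lemma relcomp_scaleR:
  assumes "relcomp (S :: 'a::real_normed_vector set)"
  shows "relcomp ((\<lambda>x. c *\<^sub>R x) ` S)"
  unfolding relcomp_def
proof (intro allI impI)
  fix x :: "nat \<Rightarrow> 'a" assume "\<forall>n. x n \<in> (\<lambda>x. c *\<^sub>R x) ` S"
  then have "\<forall>n. \<exists>y. y \<in> S \<and> x n = c *\<^sub>R y" by blast
  then obtain y where y: "\<And>n. y n \<in> S" "\<And>n. x n = c *\<^sub>R y n" by metis
  then obtain r k where r: "strict_mono (r :: nat \<Rightarrow> nat)" "(\<lambda>n. y (r n)) \<longlonglongrightarrow> k"
    using assms unfolding relcomp_def by blast
  have "(\<lambda>n. x (r n)) \<longlonglongrightarrow> c *\<^sub>R k" unfolding y(2) by (intro tendsto_intros r)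
  with r(1) show "\<exists>r k. strict_mono (r :: nat \<Rightarrow> nat) \<and> (\<lambda>n. x (r n)) \<longlonglongrightarrow> k" by blast
qed

text \<open>Rellich compactness in one dimension: the Hoelder estimate makes the representatives
  equicontinuous, Arzela-Ascoli provides a uniformly convergent subsequence, and on a bounded
  interval uniform convergence implies convergence in norm.\<close>

lemma relcomp_H1_ball:
  assumes l: "0 < l"
  shows "relcomp {emb l f | f F g. wder l f F g \<and> l2norm 0 l f \<le> C \<and> l2norm 0 l g \<le> C}"
  unfolding relcomp_def
proof (intro allI impI)
  fix x :: "nat \<Rightarrow> l2" assume "\<forall>n. x n \<in> {emb l f | f F g. wder l f F g \<and> l2norm 0 l f \<le> C \<and> l2norm 0 l g \<le> C}"
  then have "\<forall>n. \<exists>f F g. x n = emb l f \<and> wder l f F g \<and> l2norm 0 l f \<le> C \<and> l2norm 0 l g \<le> C" by blast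
  then obtain f F g where x: "\<And>n. x n = emb l (f n)" and w: "\<And>n. wder l (f n) (F n) (g n)"
    and C: "\<And>n. l2norm 0 l (f n) \<le> C" "\<And>n. l2norm 0 l (g n) \<le> C" by metis
  have C0: "0 \<le> C" using C(1)[of 0] l2norm_nonneg[of l "f 0"] by linarith
  have M: "norm (F n t) \<le> C / sqrt l + sqrt l * C" if "t \<in> {0..l}" for n t
  proof -
    have "cmod (F n t) \<le> l2norm 0 l (f n) / sqrt l + sqrt l * l2norm 0 l (g n)"
      by (rule wder_sup_bound[OF l w that])
    also have "\<dots> \<le> C / sqrt l + sqrt l * C"
      using l by (intro add_mono divide_right_mono mult_left_mono C) auto
    finally show ?thesis .
  qed
  have eq: "\<exists>d. 0 < d \<and> (\<forall>n y. y \<in> {0..l} \<and> norm (t - y) < d \<longrightarrow> norm (F n t - F n y) < e)"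
    if t: "t \<in> {0..l}" and e: "0 < e" for t e
  \<comment> \<open>The square undoes the Hoelder exponent 1/2, and C + 1 covers the case C =
    0.\<close>
  proof (intro exI[of _ "(e / (C + 1))\<^sup>2"] conjI allI impI)
    show "0 < (e / (C + 1))\<^sup>2" using e C0 by simp
    fix n y assume y: "y \<in> {0..l} \<and> norm (t - y) < (e / (C + 1))\<^sup>2"
    have "norm (F n t - F n y) \<le> sqrt \<bar>t - y\<bar> * l2norm 0 l (g n)"
      using wder_holder[OF w t] y by blast
    also have "\<dots> \<le> sqrt \<bar>t - y\<bar> * C" using C by (intro mult_left_mono) auto
    also have "\<dots> \<le> e / (C + 1) * C"
    proof (rule mult_right_mono[OF _ C0])
      have "sqrt \<bar>t - y\<bar> \<le> sqrt ((e / (C + 1))\<^sup>2)" using y by (intro real_sqrt_le_mono) auto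
      then show "sqrt \<bar>t - y\<bar> \<le> e / (C + 1)" using e C0 by simp
    qed
    also have "\<dots> < e" using e C0 by (simp add: field_simps)
    finally show "norm (F n t - F n y) < e" .
  qed
  obtain h k where h: "continuous_on {0..l} h" and k: "strict_mono (k :: nat \<Rightarrow> nat)"
    and u: "\<And>e. 0 < e \<Longrightarrow> \<exists>N. \<forall>n x. n \<ge> N \<and> x \<in> {0..l} \<longrightarrow> norm (F (k n) x - h x) < e"
    using Arzela_Ascoli[of "{0..l}" F, OF _ M eq] by auto
  have "(\<lambda>n. x (k n)) \<longlonglongrightarrow> emb l h"
  proof (rule LIMSEQ_I)
    fix e :: real assume e: "0 < e"
    define e' where "e' = e / (2 * sqrt l)"
    have e': "0 < e'" using e l by (simp add: e'_def)
    then obtain N where N: "\<And>n x. n \<ge> N \<Longrightarrow> x \<in> {0..l} \<Longrightarrow> norm (F (k n) x - h x) < e'" using u by blast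
    have "norm (x (k n) - emb l h) < e" if n: "n \<ge> N" for n
    proof -
      have LF: "L2 0 l (F (k n))" "L2 0 l h" using h wder_continuous[OF w] by (auto intro: L2_continuous)
      have "x (k n) = emb l (F (k n))"
        unfolding x using emb_eq_iff[OF wderD(1)[OF w] LF(1)] wderD(4)[OF w] by blast
      then have d: "x (k n) - emb l h = emb l (\<lambda>t. 1 * F (k n) t + (-1) * h t)"
        unfolding emb_lin[OF LF] using cscale_of_real[of 1 "emb l (F (k n))"] cscale_of_real[of "-1" "emb l h"] by simp
      have "norm (x (k n) - emb l h) = l2norm 0 l (\<lambda>t. 1 * F (k n) t + (-1) * h t)"
        unfolding d by (intro emb_norm L2_lin LF)
      also have "\<dots> \<le> sqrt l * e'"
        using N[OF n] e' l by (intro l2norm_le L2_lin LF) (auto simp: less_imp_le)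
      also have "\<dots> < e" using e l by (simp add: e'_def)
      finally show ?thesis .
    qed
    then show "\<exists>N. \<forall>n\<ge>N. norm (x (k n) - emb l h) < e" by blast
  qed
  with k show "\<exists>r k. strict_mono (r :: nat \<Rightarrow> nat) \<and> (\<lambda>n. x (r n)) \<longlonglongrightarrow> k" by blast
qed

text \<open>An equality of functions, not merely almost everywhere: the predicate under the choice
  depends on f only through its class.\<close>

lemma crep_cong:
  assumes "AE x in lebesgue_on {0..l}. f x = f' x"
  shows "crep 0 l f = crep 0 l f'"
proof -
  have "(AE x in lebesgue_on {0..l}. f x = F x) \<longleftrightarrow> (AE x in lebesgue_on {0..l}. f' x = F x)" for F
    using assms by (auto elim: eventually_elim2)
  then show ?thesis by (simp add: crep_def)
qed

lemma wd_cong: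
  assumes "AE x in lebesgue_on {0..l}. f x = f' x"
  shows "wd 0 l f = wd 0 l f'"
  unfolding wd_def crep_cong[OF assms] ..

section \<open>The string-beam operator\<close>

type_synonym l2_6 = "l2 \<times> l2 \<times> l2 \<times> l2 \<times> l2 \<times> l2"

definition csc :: "complex \<Rightarrow> l2_6 \<Rightarrow> l2_6" where
  "csc c = (\<lambda>(x1, x2, x3, x4, x5, x6). (cscale c x1, cscale c x2, cscale c x3, cscale c x4, cscale c x5, cscale c x6))"

lemma scaleR_cscale: "r *\<^sub>R cscale c x = cscale c (r *\<^sub>R x)"
  by (simp add: scaleR_l2_def cscale_cscale mult.commute)

lemma csc_of_real: "csc (of_real r) x = r *\<^sub>R x"
  by (cases x) (simp add: csc_def cscale_of_real)

lemma csc_add: "csc (c + d) x = csc c x + csc d x"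
  by (cases x) (simp add: csc_def cscale_add)

lemma csc_add_right: "csc c (x + y) = csc c x + csc c y"
  by (cases x, cases y) (simp add: csc_def cscale_add_right)

lemma csc_csc: "csc c (csc d x) = csc (c * d) x"
  by (cases x) (simp add: csc_def cscale_cscale)

lemma csc_scaleR: "csc c (r *\<^sub>R x) = r *\<^sub>R csc c x"
  by (cases x) (simp add: csc_def scaleR_cscale)

lemma norm_csc: "norm (csc c x) = cmod c * norm x"
  by (cases x) (simp add: csc_def norm_Pair norm_cscale power_mult_distrib real_sqrt_mult flip: distrib_left)

lemma csc_decomp: "csc c x = Re c *\<^sub>R x + Im c *\<^sub>R csc \<i> x"
proof -
  have "csc c x = csc (of_real (Re c) + of_real (Im c) * \<i>) x" using complex_eq[of c] by (simp add: mult.commute)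
  then show ?thesis by (simp only: csc_add csc_of_real flip: csc_csc)
qed

lemma inner_cscale_ii: "inner (cscale \<i> x) x = 0"
proof -
  obtain f where f: "sq_integrable f" "x = abs_l2 f" by (rule abs_l2_surj)
  have "inner (cscale \<i> x) x = Re (LINT t|lebesgue. (\<i> * f t) * cnj (f t))"
    unfolding f(2) using f(1) sq_integrable_cmult[OF f(1)] by (simp add: cscale.abs_eq inner_l2.abs_eq)
  also have "(LINT t|lebesgue. (\<i> * f t) * cnj (f t)) = \<i> * (LINT t|lebesgue. f t * cnj (f t))"
    by (simp only: mult.assoc integral_mult_right_zero)
  finally show ?thesis by (simp add: integral_mult_cnj_self)
qed

lemma inner_csc_ii: "inner (csc \<i> x) x = 0"
  by (cases x) (simp add: csc_def inner_cscale_ii)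

lemma bounded_linear_csc: "bounded_linear (csc c)"
  by (rule bounded_linear_intro[where K="cmod c"])
    (simp_all add: csc_add_right csc_scaleR norm_csc mult.commute)

text \<open>A representative of the limit need not vanish off the interval. Cutting it off brings it
  no farther from any \<open>emb l (f n)\<close>, so the cut-off is a limit too and uniqueness
  identifies the two.\<close>

lemma emb_limit:
  assumes f: "\<And>n::nat. L2 0 l (f n)" and lim: "(\<lambda>n. emb l (f n)) \<longlonglongrightarrow> x"
  obtains g where "L2 0 l g" "x = emb l g"
proof -
  obtain g where g: "sq_integrable g" "x = abs_l2 g" by (rule abs_l2_surj)
  have le: "norm (emb l (f n) - emb l g) \<le> norm (emb l (f n) - x)" for n
  proof (rule power2_le_imp_le)
    have s: "sq_integrable (zext l (f n))" "sq_integrable (zext l g)" using f sq_integrable_L2[OF g(1)] by (simp_all add: L2_iff_sq_integrable)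
    have d: "sq_integrable (\<lambda>t. zext l (f n) t - zext l g t)" "sq_integrable (\<lambda>t. zext l (f n) t - g t)"
      by (intro sq_integrable_diff s g)+
    have "(norm (emb l (f n) - emb l g))\<^sup>2 = (LINT t|lebesgue. (cmod (zext l (f n) t - zext l g t))\<^sup>2)"
      unfolding emb_def using s d by (simp add: abs_l2_diff norm_abs_l2)
    also have "\<dots> \<le> (LINT t|lebesgue. (cmod (zext l (f n) t - g t))\<^sup>2)"
      using d by (intro integral_mono) (auto simp: sq_integrable_def zext_def)
    also have "\<dots> = (norm (emb l (f n) - x))\<^sup>2"
      unfolding emb_def g(2) using s g d by (simp add: abs_l2_diff norm_abs_l2)
    finally show "(norm (emb l (f n) - emb l g))\<^sup>2 \<le> (norm (emb l (f n) - x))\<^sup>2" .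
  qed simp
  have "(\<lambda>n. norm (emb l (f n) - x)) \<longlonglongrightarrow> 0" using lim by (simp add: LIM_zero tendsto_norm_zero)
  with always_eventually[OF allI[OF le]] have "(\<lambda>n. emb l (f n) - emb l g) \<longlonglongrightarrow> 0"
    by (rule Lim_null_comparison)
  then have "(\<lambda>n. emb l (f n)) \<longlonglongrightarrow> emb l g" by (rule LIM_zero_cancel)
  then have "x = emb l g" using lim LIMSEQ_unique by blast
  with sq_integrable_L2[OF g(1)] that show ?thesis by blast
qed

lemma l2norm_lin_le:
  assumes "L2 0 l f" "L2 0 l g"
  shows "l2norm 0 l (\<lambda>x. a * f x + b * g x) \<le> cmod a * l2norm 0 l f + cmod b * l2norm 0 l g"
  using norm_triangle_ineq[of "cscale a (emb l f)" "cscale b (emb l g)"]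
  by (simp add: emb_norm[OF L2_lin[OF assms], symmetric] emb_lin[OF assms] norm_cscale emb_norm assms)

lemma l2norm_cmult: "L2 0 l f \<Longrightarrow> l2norm 0 l (\<lambda>x. a * f x) = cmod a * l2norm 0 l f"
  by (simp add: emb_norm[symmetric] L2_cmult emb_cmult norm_cscale)

lemma l2norm_cong:
  assumes "L2 0 l f" "L2 0 l g" "AE x in lebesgue_on {0..l}. f x = g x"
  shows "l2norm 0 l f = l2norm 0 l g"
  using assms emb_eq_iff emb_norm by metis

section \<open>The energy space and its isometric image\<close>

locale wave_beam =
  fixes P :: prm
  assumes pos: "pos_prm P"
begin

abbreviation "la \<equiv> ell1 P"
abbreviation "lb \<equiv> ell2 P"

lemma pos_simps [simp]:
  "0 < la" "0 < lb" "0 < alpha1 P" "0 < alpha2 P" "0 < beta2 P" "0 < gamma2 P" "0 < delta2 P" "0 < tau2 P" "0 < kappa2 P"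
  "0 \<le> la" "0 \<le> lb"
  using pos by (auto simp: pos_prm_def)

lemma nonzero_simps [simp]:
  "la \<noteq> 0" "lb \<noteq> 0" "alpha1 P \<noteq> 0" "alpha2 P \<noteq> 0" "beta2 P \<noteq> 0" "gamma2 P \<noteq> 0" "delta2 P \<noteq> 0" "tau2 P \<noteq> 0" "kappa2 P \<noteq> 0"
  using pos_simps by (metis less_irrefl)+

lemma end_simps [simp]: "0 \<in> {0..la}" "0 \<in> {0..lb}" "la \<in> {0..la}" "lb \<in> {0..lb}"
  using pos_simps by (auto intro: less_imp_le)

lemma H2_wder:
  assumes "0 < l" "H2 0 l f"
  shows "wder l f (crep 0 l f) (wd 0 l f)" "wder l (wd 0 l f) (crep 0 l (wd 0 l f)) (wd 0 l (wd 0 l f))"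
  using assms by (auto simp: H2_def intro: H1_imp_wder)

lemma H2_I:
  assumes l: "0 < l" and w: "wder l f F g" "wder l g G h"
  shows "H2 0 l f" "crep 0 l (wd 0 l f) 0 = G 0" "AE x in lebesgue_on {0..l}. wd 0 l (wd 0 l f) x = h x"
    "wder l (wd 0 l f) G h"
proof -
  have "L2 0 l (wd 0 l f)" using H1_imp_wder[OF l wder_imp_H1[OF w(1)]] by (rule wderD)
  moreover have "AE x in lebesgue_on {0..l}. g x = wd 0 l f x" using wder_wd[OF l w(1)] by eventually_elim simp
  ultimately show w': "wder l (wd 0 l f) G h"
    using l by (intro wder_cong[OF w(2)]) (auto intro: wderD[OF w(2)])
  show "H2 0 l f" using wder_imp_H1[OF w(1)] wder_imp_H1[OF w'] by (simp add: H2_def)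
  show "crep 0 l (wd 0 l f) 0 = G 0" using l by (intro wder_crep[OF l w']) simp
  show "AE x in lebesgue_on {0..l}. wd 0 l (wd 0 l f) x = h x" by (rule wder_wd[OF l w'])
qed

lemma inV_D:
  assumes "inV P f1 f2"
  shows "wder la f1 (crep 0 la f1) (d1 P f1)" "wder lb f2 (crep 0 lb f2) (d2 P f2)"
    "wder lb (d2 P f2) (crep 0 lb (d2 P f2)) (d2 P (d2 P f2))"
    "crep 0 la f1 la = 0" "crep 0 lb f2 lb = 0" "crep 0 la f1 0 = crep 0 lb f2 0" "crep 0 lb (d2 P f2) 0 = 0"
  using assms H2_wder[of lb f2] by (auto simp: inV_def intro: H1_imp_wder)

lemma inV_I:
  assumes w: "wder la f1 F1 g1" "wder lb f2 F2 g2" "wder lb g2 G2 h2"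
    and b: "F1 la = 0" "F2 lb = 0" "F1 0 = F2 0" "G2 0 = 0"
  shows "inV P f1 f2" "AE x in lebesgue_on {0..la}. d1 P f1 x = g1 x"
    "AE x in lebesgue_on {0..lb}. d2 P (d2 P f2) x = h2 x"
proof -
  note H = H2_I[OF _ w(2,3)]
  show "inV P f1 f2"
    unfolding inV_def using wder_imp_H1[OF w(1)] H b wder_crep[OF _ w(1)] wder_crep[OF _ w(2)] by simp
  show "AE x in lebesgue_on {0..la}. d1 P f1 x = g1 x" by (rule wder_wd[OF _ w(1)]) simp
  show "AE x in lebesgue_on {0..lb}. d2 P (d2 P f2) x = h2 x" by (rule H) simp
qed

lemma inV_lin:
  assumes "inV P f1 f2" "inV P g1 g2"
  shows "inV P (\<lambda>x. a * f1 x + b * g1 x) (\<lambda>x. a * f2 x + b * g2 x)"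
    "AE x in lebesgue_on {0..la}. d1 P (\<lambda>x. a * f1 x + b * g1 x) x = a * d1 P f1 x + b * d1 P g1 x"
    "AE x in lebesgue_on {0..lb}. d2 P (d2 P (\<lambda>x. a * f2 x + b * g2 x)) x = a * d2 P (d2 P f2) x + b * d2 P (d2 P g2) x"
proof -
  note f = inV_D[OF assms(1)] and g = inV_D[OF assms(2)]
  note I = inV_I[OF wder_lin[OF f(1) g(1), of a b] wder_lin[OF f(2) g(2), of a b] wder_lin[OF f(3) g(3), of a b]]
  show "inV P (\<lambda>x. a * f1 x + b * g1 x) (\<lambda>x. a * f2 x + b * g2 x)"
    "AE x in lebesgue_on {0..la}. d1 P (\<lambda>x. a * f1 x + b * g1 x) x = a * d1 P f1 x + b * d1 P g1 x"
    "AE x in lebesgue_on {0..lb}. d2 P (d2 P (\<lambda>x. a * f2 x + b * g2 x)) x = a * d2 P (d2 P f2) x + b * d2 P (d2 P g2) x"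
    by (rule I; simp add: f g)+
qed

lemma inV_cong:
  assumes "inV P f1 f2" "L2 0 la g1" "L2 0 lb g2"
    "AE x in lebesgue_on {0..la}. f1 x = g1 x" "AE x in lebesgue_on {0..lb}. f2 x = g2 x"
  shows "inV P g1 g2"
proof -
  note f = inV_D[OF assms(1)]
  have "wder la g1 (crep 0 la f1) (d1 P f1)"
    by (rule wder_cong[OF f(1) assms(2,4) wderD(2)[OF f(1)]]) auto
  moreover have "wder lb g2 (crep 0 lb f2) (d2 P f2)"
    by (rule wder_cong[OF f(2) assms(3,5) wderD(2)[OF f(2)]]) auto
  ultimately show ?thesis by (rule inV_I(1)[OF _ _ f(3)]) (use f in auto)
qed

lemma inH_D:
  assumes "inH P y"
  shows "inV P (cu1 y) (cu2 y)" "L2 0 la (d1 P (cu1 y))" "L2 0 la (cv1 y)" "L2 0 lb (d2 P (d2 P (cu2 y)))"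
    "L2 0 lb (cv2 y)" "L2 0 lb (cth y)" "L2 0 lb (cq y)"
  using assms wderD(2)[OF inV_D(1)] wderD(2)[OF inV_D(3)] by (auto simp: inH_def)

definition "w1 = sqrt (alpha1 P)"
definition "w3 = sqrt (delta2 P / beta2 P * alpha2 P)"
definition "w4 = sqrt (delta2 P / beta2 P)"
definition "w6 = sqrt (gamma2 P * tau2 P / kappa2 P)"

lemma weight_pos [simp]: "0 < w1" "0 < w3" "0 < w4" "0 < w6"
  by (simp_all add: w1_def w3_def w4_def w6_def)

lemma weight_sq: "w1 * w1 = alpha1 P" "w3 * w3 = delta2 P / beta2 P * alpha2 P" "w4 * w4 = delta2 P / beta2 P"
  "w6 * w6 = gamma2 P * tau2 P / kappa2 P"
  by (simp_all add: w1_def w3_def w4_def w6_def less_imp_le)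

text \<open>The weights absorb the constants of the norm, so that \<open>Phi\<close> identifies the energy space modulo
  \<open>Heq P\<close> isometrically with a closed subspace of a Hilbert space type not depending on \<open>P\<close>.\<close>

definition Phi :: "st \<Rightarrow> l2_6" where
  "Phi y = (w1 *\<^sub>R emb la (d1 P (cu1 y)), emb la (cv1 y), w3 *\<^sub>R emb lb (d2 P (d2 P (cu2 y))),
     w4 *\<^sub>R emb lb (cv2 y), emb lb (cth y), w6 *\<^sub>R emb lb (cq y))"

lemma inner_Phi:
  assumes "inH P y" "inH P z"
  shows "inner (Phi y) (Phi z) = Re (Hinner P y z)"
proof -
  note y = inH_D[OF assms(1)] and z = inH_D[OF assms(2)]
  have "inner (Phi y) (Phi z) = (w1 * w1) * Re (l2inner 0 la (d1 P (cu1 y)) (d1 P (cu1 z))) + Re (l2inner 0 la (cv1 y) (cv1 z))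
    + (w3 * w3) * Re (l2inner 0 lb (d2 P (d2 P (cu2 y))) (d2 P (d2 P (cu2 z)))) + (w4 * w4) * Re (l2inner 0 lb (cv2 y) (cv2 z))
    + Re (l2inner 0 lb (cth y) (cth z)) + (w6 * w6) * Re (l2inner 0 lb (cq y) (cq z))"
    using y z by (simp add: Phi_def emb_inner)
  then show ?thesis unfolding weight_sq
    by (simp add: Hinner_def algebra_simps flip: of_real_divide of_real_mult)
qed

lemma Hnorm_Phi:
  assumes "inH P y"
  shows "Hnorm P y = norm (Phi y)"
proof -
  have "Re (Hinner P y y) = alpha1 P * (l2norm 0 la (d1 P (cu1 y)))\<^sup>2 + (l2norm 0 la (cv1 y))\<^sup>2
     + delta2 P / beta2 P * (alpha2 P * (l2norm 0 lb (d2 P (d2 P (cu2 y))))\<^sup>2 + (l2norm 0 lb (cv2 y))\<^sup>2)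
     + (l2norm 0 lb (cth y))\<^sup>2 + gamma2 P * tau2 P / kappa2 P * (l2norm 0 lb (cq y))\<^sup>2"
    unfolding Hinner_def l2inner_self by (simp flip: of_real_power of_real_mult of_real_divide of_real_add)
  then show ?thesis by (simp add: norm_eq_sqrt_inner inner_Phi[OF assms assms] Hnorm_def)
qed

lemma Phi_lin:
  assumes "inH P y" "inH P z"
  shows "inH P (st_lin a y b z)" "Phi (st_lin a y b z) = csc a (Phi y) + csc b (Phi z)"
proof -
  note y = inH_D[OF assms(1)] and z = inH_D[OF assms(2)]
  note V = inV_lin[OF y(1) z(1), of a b]
  show H: "inH P (st_lin a y b z)"
    unfolding inH_def st_lin_def using V y z by (simp add: L2_lin)
  note h = inH_D[OF H]
  have "emb la (d1 P (cu1 (st_lin a y b z))) = emb la (\<lambda>x. a * d1 P (cu1 y) x + b * d1 P (cu1 z) x)"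
    using emb_eq_iff[OF h(2) L2_lin[OF y(2) z(2)]] V(2) by (simp add: st_lin_def)
  moreover have "emb lb (d2 P (d2 P (cu2 (st_lin a y b z)))) = emb lb (\<lambda>x. a * d2 P (d2 P (cu2 y)) x + b * d2 P (d2 P (cu2 z)) x)"
    using emb_eq_iff[OF h(4) L2_lin[OF y(4) z(4)]] V(3) by (simp add: st_lin_def)
  ultimately show "Phi (st_lin a y b z) = csc a (Phi y) + csc b (Phi z)"
    using y z by (simp add: Phi_def csc_def emb_lin scaleR_add_right scaleR_cscale) (simp add: st_lin_def emb_lin scaleR_add_right scaleR_cscale)
qed

text \<open>Positive definiteness of the energy norm: u1 is recovered from u1' and its zero at
  \<open>la\<close>, u2' from u2'' and its zero at 0, then u2 from u2' and its zero at
  \<open>lb\<close>.\<close>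

lemma inV_zero_of_derivs:
  assumes "inV P f1 f2" "inV P g1 g2" "AE x in lebesgue_on {0..la}. d1 P f1 x = d1 P g1 x"
    "AE x in lebesgue_on {0..lb}. d2 P (d2 P f2) x = d2 P (d2 P g2) x"
  shows "AE x in lebesgue_on {0..la}. f1 x = g1 x" "AE x in lebesgue_on {0..lb}. f2 x = g2 x"
proof -
  have *: "\<forall>x\<in>{0..l}. F x = G x"
    if l: "0 \<le> l" and w: "wder l f F f'" "wder l g G g'" and ae: "AE x in lebesgue_on {0..l}. f' x = g' x" and c: "c \<in> {0..l}" "F c = G c"
    for l f F f' g G g' c
  proof -
    have "wder l g G f'" using l ae
      by (intro wder_cong[OF w(2)]) (auto intro: wderD[OF w(2)] wderD[OF w(1)] elim: eventually_mono)
    note e = wderD(3)[OF w(1)] wderD(3)[OF this]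
    have "F 0 = G 0" using e(1)[OF c(1)] e(2)[OF c(1)] c(2) by simp
    then show ?thesis using e by metis
  qed
  note f = inV_D[OF assms(1)] and g = inV_D[OF assms(2)]
  have "\<forall>x\<in>{0..la}. crep 0 la f1 x = crep 0 la g1 x"
    by (rule *[OF _ f(1) g(1) assms(3), of la]) (use f g in auto)
  then have "AE x in lebesgue_on {0..la}. crep 0 la f1 x = crep 0 la g1 x" by (intro AE_ivlI) blast
  then show "AE x in lebesgue_on {0..la}. f1 x = g1 x"
    using wderD(4)[OF f(1)] wderD(4)[OF g(1)] by eventually_elim simp
  have "\<forall>x\<in>{0..lb}. crep 0 lb (d2 P f2) x = crep 0 lb (d2 P g2) x"
    by (rule *[OF _ f(3) g(3) assms(4), of 0]) (use f g in auto)
  then have "AE x in lebesgue_on {0..lb}. crep 0 lb (d2 P f2) x = crep 0 lb (d2 P g2) x" by (intro AE_ivlI) blast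
  then have ae: "AE x in lebesgue_on {0..lb}. d2 P f2 x = d2 P g2 x"
    using wderD(4)[OF f(3)] wderD(4)[OF g(3)] by eventually_elim simp
  have "\<forall>x\<in>{0..lb}. crep 0 lb f2 x = crep 0 lb g2 x"
    by (rule *[OF _ f(2) g(2) ae, of lb]) (use f g in auto)
  then have "AE x in lebesgue_on {0..lb}. crep 0 lb f2 x = crep 0 lb g2 x" by (intro AE_ivlI) blast
  then show "AE x in lebesgue_on {0..lb}. f2 x = g2 x"
    using wderD(4)[OF f(2)] wderD(4)[OF g(2)] by eventually_elim simp
qed

lemma Phi_eq_iff:
  assumes "inH P y" "inH P z"
  shows "Phi y = Phi z \<longleftrightarrow> Heq P y z"
proof -
  note y = inH_D[OF assms(1)] and z = inH_D[OF assms(2)]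
  have "w1 \<noteq> 0" "w3 \<noteq> 0" "w4 \<noteq> 0" "w6 \<noteq> 0" using weight_pos by (metis less_irrefl)+
  then have "Phi y = Phi z \<longleftrightarrow>
     (AE x in lebesgue_on {0..la}. d1 P (cu1 y) x = d1 P (cu1 z) x) \<and> (AE x in lebesgue_on {0..la}. cv1 y x = cv1 z x)
   \<and> (AE x in lebesgue_on {0..lb}. d2 P (d2 P (cu2 y)) x = d2 P (d2 P (cu2 z)) x)
   \<and> (AE x in lebesgue_on {0..lb}. cv2 y x = cv2 z x) \<and> (AE x in lebesgue_on {0..lb}. cth y x = cth z x)
   \<and> (AE x in lebesgue_on {0..lb}. cq y x = cq z x)"
    using y z by (simp add: Phi_def emb_eq_iff)
  moreover have "(AE x in lebesgue_on {0..la}. d1 P (cu1 y) x = d1 P (cu1 z) x) \<and>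
      (AE x in lebesgue_on {0..lb}. d2 P (d2 P (cu2 y)) x = d2 P (d2 P (cu2 z)) x)
    \<longleftrightarrow> (AE x in lebesgue_on {0..la}. cu1 y x = cu1 z x) \<and> (AE x in lebesgue_on {0..lb}. cu2 y x = cu2 z x)"
    (is "?A \<and> ?B \<longleftrightarrow> ?C \<and> ?E")
  proof
    assume "?A \<and> ?B"
    then show "?C \<and> ?E" using inV_zero_of_derivs[OF y(1) z(1)] by blast
  next
    assume c: "?C \<and> ?E"
    have "d1 P (cu1 y) = d1 P (cu1 z)" "d2 P (cu2 y) = d2 P (cu2 z)" using c by (auto intro!: wd_cong)
    then show "?A \<and> ?B" by simp
  qed
  ultimately show ?thesis unfolding Heq_def by blast
qed

text \<open>Phrased for arbitrary representatives and derivatives, so that explicit primitives and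
  linear combinations can be inserted without evaluating the choices behind \<open>crep\<close> and
  \<open>wd\<close>. The function w is given apart from s and th, because only this combination is
  required to have a second derivative.\<close>

lemma inD_I:
  assumes u: "wder la u1 U1 p" "wder la p Pc p'" "wder lb u2 U2 r" "wder lb r R s" "wder lb s Sc s'"
    and ub: "U1 la = 0" "U2 lb = 0" "U1 0 = U2 0" "R 0 = 0" "Sc lb = 0"
    and v: "inV P v1 v2" and th: "wder lb th T t" "T 0 = 0" "T lb = 0" and q: "wder lb q Q q'"
    and w: "wder lb w W w'" "wder lb w' W' w''"
    and we: "AE x in lebesgue_on {0..lb}. w x = of_real (alpha2 P) * s x - of_real (beta2 P) * th x"
    and wb: "of_real (delta2 P / beta2 P) * W' 0 = of_real (alpha1 P) * Pc 0"
  shows "inD P (St u1 u2 v1 v2 th q)"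
    "AE x in lebesgue_on {0..la}. d1 P (d1 P u1) x = p' x"
    "AE x in lebesgue_on {0..lb}. d2 P (d2 P (wfun P (St u1 u2 v1 v2 th q))) x = w'' x"
    "AE x in lebesgue_on {0..lb}. d2 P q x = q' x" "AE x in lebesgue_on {0..lb}. d2 P th x = t x"
proof -
  let ?y = "St u1 u2 v1 v2 th q"
  note V = inV_I[OF u(1,3,4) ub(1-4)] and H1 = H2_I[OF pos_simps(1) u(1,2)] and H2 = H2_I[OF pos_simps(2) u(3,4)]
  have s: "AE x in lebesgue_on {0..lb}. s x = d2 P (d2 P u2) x" using V(3) by eventually_elim simp
  have LS: "L2 0 lb (d2 P (d2 P u2))" using wderD(2)[OF inV_D(3)[OF V(1)]] .
  have s': "wder lb (d2 P (d2 P u2)) Sc s'"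
    by (rule wder_cong[OF u(5) LS s wderD(2)[OF u(5)]]) auto
  have wf: "wder lb (wfun P ?y) W w'"
  proof (rule wder_cong[OF w(1) _ _ wderD(2)[OF w(1)]])
    show "L2 0 lb (wfun P ?y)"
      using L2_lin[OF LS wderD(1)[OF th(1)], of "of_real (alpha2 P)" "- of_real (beta2 P)"] by (simp add: wfun_def)
    show "AE x in lebesgue_on {0..lb}. w x = wfun P ?y x"
      using we s by eventually_elim (simp add: wfun_def)
  qed auto
  note HW = H2_I[OF pos_simps(2) wf w(2)]
  have "crep 0 lb (d2 P (d2 P u2)) lb = 0" using wder_crep[OF _ s', of lb] ub by simp
  moreover have "crep 0 lb th 0 = 0" "crep 0 lb th lb = 0" using wder_crep[OF _ th(1)] th by auto
  ultimately show "inD P ?y"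
    unfolding inD_def inH_def H10_def
    using V(1) v H1(1) wder_imp_H1[OF th(1)] wder_imp_H1[OF q] HW(1) wderD(1)[OF th(1)] wderD(1)[OF q]
      wderD(1)[OF inV_D(1)[OF v]] wderD(1)[OF inV_D(2)[OF v]] HW(2) H1(2) wb by simp
  show "AE x in lebesgue_on {0..la}. d1 P (d1 P u1) x = p' x" by (rule H1)
  show "AE x in lebesgue_on {0..lb}. d2 P (d2 P (wfun P ?y)) x = w'' x" by (rule HW)
  show "AE x in lebesgue_on {0..lb}. d2 P q x = q' x" by (rule wder_wd[OF _ q]) simp
  show "AE x in lebesgue_on {0..lb}. d2 P th x = t x" by (rule wder_wd[OF _ th(1)]) simp
qed

text \<open>The domain does not state regularity of u2'' by itself; it follows from u2'' = (w +
  beta2 theta) / alpha2 with both terms in H1. As theta = 0 at \<open>lb\<close>, the condition u2''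
  = 0 there passes to w.\<close>

lemma inD_D:
  assumes "inD P y"
  shows "inH P y" "inV P (cu1 y) (cu2 y)" "inV P (cv1 y) (cv2 y)"
    "wder la (d1 P (cu1 y)) (crep 0 la (d1 P (cu1 y))) (d1 P (d1 P (cu1 y)))"
    "wder lb (cth y) (crep 0 lb (cth y)) (d2 P (cth y))" "crep 0 lb (cth y) 0 = 0" "crep 0 lb (cth y) lb = 0"
    "wder lb (cq y) (crep 0 lb (cq y)) (d2 P (cq y))"
    "wder lb (wfun P y) (crep 0 lb (wfun P y)) (d2 P (wfun P y))"
    "wder lb (d2 P (wfun P y)) (crep 0 lb (d2 P (wfun P y))) (d2 P (d2 P (wfun P y)))"
    "wder lb (d2 P (d2 P (cu2 y)))
       (\<lambda>x. of_real (1 / alpha2 P) * crep 0 lb (wfun P y) x + of_real (beta2 P / alpha2 P) * crep 0 lb (cth y) x)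
       (\<lambda>x. of_real (1 / alpha2 P) * d2 P (wfun P y) x + of_real (beta2 P / alpha2 P) * d2 P (cth y) x)"
    "crep 0 lb (wfun P y) lb = 0"
    "of_real (delta2 P / beta2 P) * crep 0 lb (d2 P (wfun P y)) 0 = of_real (alpha1 P) * crep 0 la (d1 P (cu1 y)) 0"
proof -
  show "inH P y" "inV P (cu1 y) (cu2 y)" "inV P (cv1 y) (cv2 y)"
    "wder la (d1 P (cu1 y)) (crep 0 la (d1 P (cu1 y))) (d1 P (d1 P (cu1 y)))"
    and th: "wder lb (cth y) (crep 0 lb (cth y)) (d2 P (cth y))" and th0: "crep 0 lb (cth y) 0 = 0" "crep 0 lb (cth y) lb = 0"
    and "wder lb (cq y) (crep 0 lb (cq y)) (d2 P (cq y))"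
    and wf: "wder lb (wfun P y) (crep 0 lb (wfun P y)) (d2 P (wfun P y))"
    and "wder lb (d2 P (wfun P y)) (crep 0 lb (d2 P (wfun P y))) (d2 P (d2 P (wfun P y)))"
    and "of_real (delta2 P / beta2 P) * crep 0 lb (d2 P (wfun P y)) 0 = of_real (alpha1 P) * crep 0 la (d1 P (cu1 y)) 0"
    using assms H2_wder[of lb "wfun P y"] H2_wder[of la "cu1 y"]
    by (auto simp: inD_def inH_def H10_def intro: H1_imp_wder)
  have e: "(\<lambda>x. of_real (1 / alpha2 P) * wfun P y x + of_real (beta2 P / alpha2 P) * cth y x) = d2 P (d2 P (cu2 y))"
    by (auto simp: wfun_def fun_eq_iff field_simps)
  show s: "wder lb (d2 P (d2 P (cu2 y)))
       (\<lambda>x. of_real (1 / alpha2 P) * crep 0 lb (wfun P y) x + of_real (beta2 P / alpha2 P) * crep 0 lb (cth y) x)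
       (\<lambda>x. of_real (1 / alpha2 P) * d2 P (wfun P y) x + of_real (beta2 P / alpha2 P) * d2 P (cth y) x)"
    using wder_lin[OF wf th, of "of_real (1 / alpha2 P)" "of_real (beta2 P / alpha2 P)"] unfolding e .
  have "crep 0 lb (d2 P (d2 P (cu2 y))) lb = 0" using assms by (simp add: inD_def)
  then show "crep 0 lb (wfun P y) lb = 0" using wder_crep[OF _ s, of lb] th0 by simp
qed

lemma A2_inH: "inD P y \<Longrightarrow> inH P (A2 P y)"
proof -
  assume y: "inD P y"
  note d = inD_D[OF y]
  have "L2 0 lb (\<lambda>x. - of_real (delta2 P) * d2 P (d2 P (cv2 y)) x - of_real (gamma2 P) * d2 P (cq y) x)"
    using L2_lin[OF wderD(2)[OF inV_D(3)[OF d(3)]] wderD(2)[OF d(8)], of "- of_real (delta2 P)" "- of_real (gamma2 P)"] by simp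
  moreover have "L2 0 lb (\<lambda>x. - of_real (1 / tau2 P) * cq y x - of_real (kappa2 P / tau2 P) * d2 P (cth y) x)"
    using L2_lin[OF wderD(1)[OF d(8)] wderD(2)[OF d(5)], of "- of_real (1 / tau2 P)" "- of_real (kappa2 P / tau2 P)"] by simp
  moreover have "L2 0 lb (\<lambda>x. - d2 P (d2 P (wfun P y)) x)"
    using L2_cmult[OF wderD(2)[OF d(10)], of "-1"] by simp
  ultimately show ?thesis using d(3) L2_cmult[OF wderD(2)[OF d(4)]] by (simp add: inH_def A2_def)
qed

lemma inD_lin:
  assumes "inD P y" "inD P z"
  shows "inD P (st_lin a y b z)" "Heq P (A2 P (st_lin a y b z)) (st_lin a (A2 P y) b (A2 P z))"
proof -
  note y = inD_D[OF assms(1)] and z = inD_D[OF assms(2)]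
  note yV = inV_D[OF y(2)] and zV = inV_D[OF z(2)]
  note I = inD_I[OF wder_lin[OF yV(1) zV(1), of a b] wder_lin[OF y(4) z(4), of a b] wder_lin[OF yV(2) zV(2), of a b]
      wder_lin[OF yV(3) zV(3), of a b] wder_lin[OF y(11) z(11), of a b] _ _ _ _ _ inV_lin(1)[OF y(3) z(3), of a b]
      wder_lin[OF y(5) z(5), of a b] _ _ wder_lin[OF y(8) z(8), of a b] wder_lin[OF y(9) z(9), of a b] wder_lin[OF y(10) z(10), of a b]]
  have we: "AE x in lebesgue_on {0..lb}. a * wfun P y x + b * wfun P z x
      = of_real (alpha2 P) * (a * d2 P (d2 P (cu2 y)) x + b * d2 P (d2 P (cu2 z)) x) - of_real (beta2 P) * (a * cth y x + b * cth z x)"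
    by (rule AE_ivlI) (simp add: wfun_def algebra_simps)
  have wb: "of_real (delta2 P / beta2 P) * (a * crep 0 lb (d2 P (wfun P y)) 0 + b * crep 0 lb (d2 P (wfun P z)) 0)
      = of_real (alpha1 P) * (a * crep 0 la (d1 P (cu1 y)) 0 + b * crep 0 la (d1 P (cu1 z)) 0)"
    using arg_cong2[OF y(13) z(13), of "\<lambda>u v. a * u + b * v"] by (simp only: distrib_left mult.left_commute)
  note I' = I[OF _ _ _ _ _ _ _ we wb]
  have c: "a * crep 0 la (cu1 y) la + b * crep 0 la (cu1 z) la = 0" "a * crep 0 lb (cu2 y) lb + b * crep 0 lb (cu2 z) lb = 0"
    "a * crep 0 la (cu1 y) 0 + b * crep 0 la (cu1 z) 0 = a * crep 0 lb (cu2 y) 0 + b * crep 0 lb (cu2 z) 0"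
    "a * crep 0 lb (d2 P (cu2 y)) 0 + b * crep 0 lb (d2 P (cu2 z)) 0 = 0"
    "a * (of_real (1 / alpha2 P) * crep 0 lb (wfun P y) lb + of_real (beta2 P / alpha2 P) * crep 0 lb (cth y) lb)
      + b * (of_real (1 / alpha2 P) * crep 0 lb (wfun P z) lb + of_real (beta2 P / alpha2 P) * crep 0 lb (cth z) lb) = 0"
    "a * crep 0 lb (cth y) 0 + b * crep 0 lb (cth z) 0 = 0" "a * crep 0 lb (cth y) lb + b * crep 0 lb (cth z) lb = 0"
    using yV zV y z by simp_all
  note R = I'[OF c]
  show "inD P (st_lin a y b z)" using R(1) by (simp add: st_lin_def)
  show "Heq P (A2 P (st_lin a y b z)) (st_lin a (A2 P y) b (A2 P z))"
    unfolding Heq_def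
  proof (intro conjI)
    show "AE x in lebesgue_on {0..la}. cv1 (A2 P (st_lin a y b z)) x = cv1 (st_lin a (A2 P y) b (A2 P z)) x"
      using R(2) by eventually_elim (simp add: A2_def st_lin_def algebra_simps)
    show "AE x in lebesgue_on {0..lb}. cv2 (A2 P (st_lin a y b z)) x = cv2 (st_lin a (A2 P y) b (A2 P z)) x"
      using R(3) by eventually_elim (simp add: A2_def st_lin_def algebra_simps)
    show "AE x in lebesgue_on {0..lb}. cth (A2 P (st_lin a y b z)) x = cth (st_lin a (A2 P y) b (A2 P z)) x"
      using R(4) inV_lin(3)[OF y(3) z(3), of a b] by eventually_elim (simp add: A2_def st_lin_def algebra_simps)
    show "AE x in lebesgue_on {0..lb}. cq (A2 P (st_lin a y b z)) x = cq (st_lin a (A2 P y) b (A2 P z)) x"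
      using R(5) by eventually_elim (simp add: A2_def st_lin_def field_simps)
  qed (auto simp: A2_def st_lin_def)
qed

text \<open>The operator is to act on classes. \<open>wd\<close> returns the same function for
  equivalent arguments, so only the membership conditions have to be transported.\<close>

lemma inD_cong:
  assumes "inD P y" "inH P z" "Heq P y z"
  shows "inD P z" "Heq P (A2 P y) (A2 P z)"
proof -
  note y = inD_D[OF assms(1)] and z = inH_D[OF assms(2)]
  note yV = inV_D[OF y(2)] and h = assms(3)[unfolded Heq_def]
  have z': "z = St (cu1 z) (cu2 z) (cv1 z) (cv2 z) (cth z) (cq z)" by simp
  have eqs: "wd 0 la (cu1 z) = wd 0 la (cu1 y)" "wd 0 lb (cu2 z) = wd 0 lb (cu2 y)" "wd 0 lb (cv2 z) = wd 0 lb (cv2 y)"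
     "wd 0 lb (cth z) = wd 0 lb (cth y)" "wd 0 lb (cq z) = wd 0 lb (cq y)"
    using h by (auto intro!: wd_cong elim: eventually_mono)
  have wz: "AE x in lebesgue_on {0..lb}. wfun P y x = of_real (alpha2 P) * d2 P (d2 P (cu2 y)) x - of_real (beta2 P) * cth z x"
    using h by (auto simp: wfun_def elim: eventually_mono)
  have Vz: "inV P (cu1 z) (cu2 z)" by (rule z)
  have 1: "wder la (cu1 z) (crep 0 la (cu1 y)) (d1 P (cu1 y))"
    using h by (intro wder_cong[OF yV(1) _ _ wderD(2)[OF yV(1)]]) (auto intro: wderD[OF inV_D(1)[OF Vz]])
  have 2: "wder lb (cu2 z) (crep 0 lb (cu2 y)) (d2 P (cu2 y))"
    using h by (intro wder_cong[OF yV(2) _ _ wderD(2)[OF yV(2)]]) (auto intro: wderD[OF inV_D(2)[OF Vz]])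
  have 3: "inV P (cv1 z) (cv2 z)" using h z by (intro inV_cong[OF y(3)]) auto
  have 4: "wder lb (cth z) (crep 0 lb (cth y)) (d2 P (cth y))"
    using h z by (intro wder_cong[OF y(5) _ _ wderD(2)[OF y(5)]]) auto
  have 5: "wder lb (cq z) (crep 0 lb (cq y)) (d2 P (cq y))"
    using h z by (intro wder_cong[OF y(8) _ _ wderD(2)[OF y(8)]]) auto
  have 6: "of_real (1 / alpha2 P) * crep 0 lb (wfun P y) lb + of_real (beta2 P / alpha2 P) * crep 0 lb (cth y) lb = 0"
    using y by simp
  have R: "inD P (St (cu1 z) (cu2 z) (cv1 z) (cv2 z) (cth z) (cq z))"
    by (rule inD_I(1)[OF 1 y(4) 2 yV(3) y(11) yV(4-7) 6 3 4 y(6,7) 5 y(9,10) wz y(13)])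
  then show "inD P z" by simp
  have "AE x in lebesgue_on {0..lb}. wfun P z x = wfun P y x"
    using h by (auto simp: wfun_def eqs elim: eventually_mono)
  then have "wd 0 lb (wfun P z) = wd 0 lb (wfun P y)" by (rule wd_cong)
  then show "Heq P (A2 P y) (A2 P z)"
    using h unfolding Heq_def A2_def by (auto simp: eqs elim: eventually_mono)
qed

text \<open>Everything cancels in pairs except the flux term. The weight delta2/beta2 of the beam
  makes the pairing of theta with v2'' cancel, the weight gamma2 tau2/kappa2 the pairing of theta
  with q, and the transmission condition the boundary terms at the joint.\<close>

lemma dissipation:
  assumes y: "inD P y"
  shows "Re (Hinner P (A2 P y) y) = - (gamma2 P / kappa2 P) * (l2norm 0 lb (cq y))\<^sup>2"
proof -
  note d = inD_D[OF y]
  note u = inV_D[OF d(2)] and v = inV_D[OF d(3)]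
  define p where "p = d1 P (cu1 y)"
  define p' where "p' = d1 P p"
  define s where "s = d2 P (d2 P (cu2 y))"
  define v1' where "v1' = d1 P (cv1 y)"
  define v2'' where "v2'' = d2 P (d2 P (cv2 y))"
  define w where "w = wfun P y"
  define ww where "ww = d2 P (d2 P w)"
  define q' where "q' = d2 P (cq y)"
  define t' where "t' = d2 P (cth y)"
  define V0 where "V0 = crep 0 la (cv1 y) 0"
  define W0 where "W0 = crep 0 lb (d2 P w) 0"
  define P0 where "P0 = crep 0 la p 0"
  note defs = p_def p'_def s_def v1'_def v2''_def w_def ww_def q'_def t'_def V0_def W0_def P0_def
  have L: "L2 0 la p" "L2 0 la p'" "L2 0 lb s" "L2 0 la v1'" "L2 0 lb v2''" "L2 0 lb w" "L2 0 lb ww" "L2 0 lb q'" "L2 0 lb t'"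
    "L2 0 la (cv1 y)" "L2 0 lb (cv2 y)" "L2 0 lb (cth y)" "L2 0 lb (cq y)"
    unfolding defs using wderD(1,2)[OF u(1)] wderD(1,2)[OF d(4)] wderD(1,2)[OF u(3)] wderD(1,2)[OF v(1)] wderD(1,2)[OF v(3)] wderD(1,2)[OF d(9)]
      wderD(1,2)[OF d(10)] wderD(1,2)[OF d(8)] wderD(1,2)[OF d(5)] wderD(1)[OF v(2)] by auto
  \<comment> \<open>Boundary terms survive only at the joint: v1 vanishes at \<open>la\<close> and
    v2 at \<open>lb\<close> in \<open>E1\<close> and \<open>E2\<close>, v2' at 0 and w at
    \<open>lb\<close> in \<open>E3\<close>, theta at both ends in \<open>E4\<close>.\<close>
  have E1: "l2inner 0 la v1' p + l2inner 0 la (cv1 y) p' = - V0 * cnj P0"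
    using wder_parts[OF _ v(1) d(4)] v(4) by (simp add: defs)
  have E2: "l2inner 0 lb (d2 P (cv2 y)) (d2 P w) + l2inner 0 lb (cv2 y) ww = - V0 * cnj W0"
    using wder_parts[OF _ v(2) d(10)] v(5,6) by (simp add: defs)
  have E3: "l2inner 0 lb v2'' w + l2inner 0 lb (d2 P (cv2 y)) (d2 P w) = 0"
    using wder_parts[OF _ v(3) d(9)] v(7) d(12) by (simp add: defs)
  have E4: "l2inner 0 lb t' (cq y) + l2inner 0 lb (cth y) q' = 0"
    using wder_parts[OF _ d(5) d(8)] d(6,7) by (simp add: defs)
  have "l2inner 0 lb w v2'' = of_real (alpha2 P) * l2inner 0 lb s v2'' + (- of_real (beta2 P)) * l2inner 0 lb (cth y) v2''"
    using l2inner_lin_left[OF L(3,12,5), of "of_real (alpha2 P)" "- of_real (beta2 P)"] by (simp add: defs wfun_def)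
  then have "cnj (l2inner 0 lb w v2'') = cnj (of_real (alpha2 P) * l2inner 0 lb s v2'' + (- of_real (beta2 P)) * l2inner 0 lb (cth y) v2'')"
    by simp
  then have E5: "l2inner 0 lb v2'' w = of_real (alpha2 P) * l2inner 0 lb v2'' s - of_real (beta2 P) * l2inner 0 lb v2'' (cth y)"
    using l2inner_commute[of lb v2'' w] l2inner_commute[of lb v2'' s] l2inner_commute[of lb v2'' "cth y"] by simp
  have E6: "of_real (delta2 P / beta2 P) * W0 = of_real (alpha1 P) * P0" using d(13) by (simp add: defs)
  have Hin: "Hinner P (A2 P y) y = of_real (alpha1 P) * l2inner 0 la v1' p + of_real (alpha1 P) * l2inner 0 la p' (cv1 y)
     + of_real (delta2 P / beta2 P) * (of_real (alpha2 P) * l2inner 0 lb v2'' s - l2inner 0 lb ww (cv2 y))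
     + (- of_real (delta2 P) * l2inner 0 lb v2'' (cth y) - of_real (gamma2 P) * l2inner 0 lb q' (cth y))
     + of_real (gamma2 P * tau2 P / kappa2 P) *
        (- of_real (1 / tau2 P) * l2inner 0 lb (cq y) (cq y) - of_real (kappa2 P / tau2 P) * l2inner 0 lb t' (cq y))"
    using l2inner_lin_left[OF L(2,2,10), of "of_real (alpha1 P)" 0]
      l2inner_lin_left[OF L(7,7,11), of "-1" 0]
      l2inner_lin_left[OF L(5,8,12), of "- of_real (delta2 P)" "- of_real (gamma2 P)"]
      l2inner_lin_left[OF L(13,9,13), of "- of_real (1 / tau2 P)" "- of_real (kappa2 P / tau2 P)"]
    unfolding Hinner_def by (simp add: A2_def defs)
  have R1: "Re (l2inner 0 la p' (cv1 y)) = Re (l2inner 0 la (cv1 y) p')"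
    "Re (l2inner 0 lb ww (cv2 y)) = Re (l2inner 0 lb (cv2 y) ww)" "Re (l2inner 0 lb q' (cth y)) = Re (l2inner 0 lb (cth y) q')"
  proof -
    have rc: "Re (l2inner 0 l g f) = Re (l2inner 0 l f g)" for l f g by (subst l2inner_commute) simp
    show "Re (l2inner 0 la p' (cv1 y)) = Re (l2inner 0 la (cv1 y) p')"
      "Re (l2inner 0 lb ww (cv2 y)) = Re (l2inner 0 lb (cv2 y) ww)" "Re (l2inner 0 lb q' (cth y)) = Re (l2inner 0 lb (cth y) q')"
      by (rule rc)+
  qed
  have RR: "Re (of_real c * z) = c * Re z" for c z by simp
  have E6': "(delta2 P / beta2 P) * Re (V0 * cnj W0) = alpha1 P * Re (V0 * cnj P0)"
  proof -
    have "of_real (delta2 P / beta2 P) * (V0 * cnj W0) = of_real (alpha1 P) * (V0 * cnj P0)"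
      using arg_cong[OF E6, of "\<lambda>z. V0 * cnj z"]
      by (simp only: complex_cnj_mult complex_cnj_complex_of_real mult.left_commute[of V0])
    from arg_cong[OF this, of Re] show ?thesis by (simp only: RR)
  qed
  have e1: "alpha1 P * Re (l2inner 0 la v1' p) + alpha1 P * Re (l2inner 0 la (cv1 y) p') = - alpha1 P * Re (V0 * cnj P0)"
    using arg_cong[OF arg_cong[OF E1, of Re], of "(*) (alpha1 P)"] by (simp add: algebra_simps)
  have e2: "Re (l2inner 0 lb (cv2 y) ww) = - Re (V0 * cnj W0) + alpha2 P * Re (l2inner 0 lb v2'' s) - beta2 P * Re (l2inner 0 lb v2'' (cth y))"
    using arg_cong[OF E2, of Re] arg_cong[OF E3, of Re] arg_cong[OF E5, of Re] by (simp add: algebra_simps)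
  have e3: "Re (l2inner 0 lb (cth y) q') = - Re (l2inner 0 lb t' (cq y))" using arg_cong[OF E4, of Re] by simp
  have "Re (Hinner P (A2 P y) y) = alpha1 P * Re (l2inner 0 la v1' p) + alpha1 P * Re (l2inner 0 la (cv1 y) p')
     + (delta2 P / beta2 P) * (alpha2 P * Re (l2inner 0 lb v2'' s) - Re (l2inner 0 lb (cv2 y) ww))
     - delta2 P * Re (l2inner 0 lb v2'' (cth y)) - gamma2 P * Re (l2inner 0 lb (cth y) q')
     + (gamma2 P * tau2 P / kappa2 P) *
        (- (1 / tau2 P) * (l2norm 0 lb (cq y))\<^sup>2 - (kappa2 P / tau2 P) * Re (l2inner 0 lb t' (cq y)))"
    unfolding Hin l2inner_self
    by (simp only: plus_complex.sel minus_complex.sel uminus_complex.sel RR mult_minus_left Re_complex_of_real R1 of_real_minus[symmetric])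
  also have "\<dots> = - alpha1 P * Re (V0 * cnj P0) + (delta2 P / beta2 P) * Re (V0 * cnj W0)
     + (delta2 P / beta2 P) * (beta2 P * Re (l2inner 0 lb v2'' (cth y))) - delta2 P * Re (l2inner 0 lb v2'' (cth y))
     + gamma2 P * Re (l2inner 0 lb t' (cq y)) + (gamma2 P * tau2 P / kappa2 P) *
        (- (1 / tau2 P) * (l2norm 0 lb (cq y))\<^sup>2 - (kappa2 P / tau2 P) * Re (l2inner 0 lb t' (cq y)))"
    unfolding e1 e2 e3 by (simp add: algebra_simps)
  also have "\<dots> = - (gamma2 P / kappa2 P) * (l2norm 0 lb (cq y))\<^sup>2"
    unfolding E6' by (simp add: field_simps)
  finally show ?thesis .
qed

end

section \<open>Surjectivity of the operator, closedness of the image, compactness\<close>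

lemma wder_affine: "wder l (\<lambda>x. of_real (x - c)) (\<lambda>x. of_real (x - c)) (\<lambda>x. 1)"
proof -
  have "((\<lambda>x. x - c) has_real_derivative 1) (at x)" for x by (auto intro!: derivative_eq_intros)
  from wder_real_smooth[OF this continuous_on_const] show ?thesis by (simp only: of_real_1)
qed

context wave_beam
begin

lemma weight_abs [simp]: "\<bar>w1\<bar> = w1" "\<bar>w3\<bar> = w3" "\<bar>w4\<bar> = w4" "\<bar>w6\<bar> = w6" "\<bar>alpha1 P\<bar> = alpha1 P"
  "\<bar>alpha2 P\<bar> = alpha2 P" "\<bar>beta2 P\<bar> = beta2 P" "\<bar>gamma2 P\<bar> = gamma2 P" "\<bar>delta2 P\<bar> = delta2 P"
  "\<bar>tau2 P\<bar> = tau2 P" "\<bar>kappa2 P\<bar> = kappa2 P"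
  by (simp_all add: abs_of_pos)

lemma prm_nonneg [simp]: "0 \<le> alpha1 P" "0 \<le> alpha2 P" "0 \<le> beta2 P" "0 \<le> gamma2 P" "0 \<le> delta2 P" "0 \<le> tau2 P" "0 \<le> kappa2 P"
  by (simp_all add: less_imp_le)

text \<open>The equations are triangular: v is read off, q' and theta' are integrated in turn, w''
  gives w, and w with theta gives u2'', while u1 is integrated on its own. The boundary conditions
  then determine three constants: q0 for the flux, c = w'(0) and e = u1'(0).\<close>

lemma A2_onto:
  assumes F: "inH P F"
  shows "\<exists>y. inD P y \<and> Heq P (A2 P y) F"
proof -
  note FD = inH_D[OF F] and FV = inV_D[OF inH_D(1)[OF F]]
  define h2 where "h2 = d2 P (d2 P (cu2 F))"
  let ?r = "of_real :: real \<Rightarrow> complex"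
  let ?a1 = "?r (alpha1 P)" and ?a = "?r (alpha2 P)" and ?b = "?r (beta2 P)" and ?g = "?r (gamma2 P)" and ?d = "?r (delta2 P)"
    and ?t = "?r (tau2 P)" and ?k = "?r (kappa2 P)" and ?la = "?r la" and ?lb = "?r lb"
  have Lh2: "L2 0 lb h2" using FD by (simp add: h2_def)
  have one: "wder l (\<lambda>x. 1) (\<lambda>x. 1) (\<lambda>x. 0)" for l
    using wder_real_smooth[of "\<lambda>x. 1" "\<lambda>x. 0" l] by simp
  have lin: "wder l (\<lambda>x. ?r (x - c)) (\<lambda>x. ?r (x - c)) (\<lambda>x. 1)" for l c
    by (rule wder_affine)
  \<comment> \<open>Successive primitives of x - lb, normalised so that the first, used for u2',
    vanishes at 0 and the second, used for u2, vanishes at \<open>lb\<close>.\<close>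
  have quad: "wder l (\<lambda>x. ?r (((x - lb)^2 - lb^2) / 2)) (\<lambda>x. ?r (((x - lb)^2 - lb^2) / 2)) (\<lambda>x. ?r (x - lb))" for l
    by (rule wder_real_smooth) (auto intro!: derivative_eq_intros continuous_intros)
  have cub: "wder l (\<lambda>x. ?r ((x - lb)^3 / 6 - lb^2 * x / 2 + lb^3 / 2)) (\<lambda>x. ?r ((x - lb)^3 / 6 - lb^2 * x / 2 + lb^3 / 2))
      (\<lambda>x. ?r (((x - lb)^2 - lb^2) / 2))" for l
    by (rule wder_real_smooth) (auto intro!: derivative_eq_intros continuous_intros simp: field_simps)
  obtain Q0 where Q0: "wder lb Q0 Q0 (\<lambda>x. (- ?d / ?g) * h2 x + (- 1 / ?g) * cth F x)"
    by (rule ex_primitive[OF L2_lin[OF Lh2 FD(6)]])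
  obtain T0 where T0: "wder lb T0 T0 (\<lambda>x. (- ?t / ?k) * cq F x + (- 1 / ?k) * Q0 x)" "T0 0 = 0"
    by (rule ex_primitive[OF L2_lin[OF FD(7) wderD(1)[OF Q0]], where c=0])
  \<comment> \<open>The constant part of the flux is fixed by theta = 0 at
    \<open>lb\<close>.\<close>
  define q0 where "q0 = ?k / ?lb * T0 lb"
  note th = wder_lin[OF T0(1) lin[of lb 0], of 1 "- q0 / ?k"]
  note q = wder_lin[OF Q0 one[of lb], of 1 q0]
  define TH where "TH x = 1 * T0 x + (- q0 / ?k) * ?r (x - 0)" for x
  have TH0: "TH 0 = 0" "TH lb = 0" by (simp_all add: TH_def T0 q0_def)
  obtain K where K: "wder lb K K (\<lambda>x. (-1) * cv2 F x)" "K 0 = 0"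
    by (rule ex_primitive[OF L2_cmult[OF FD(5)], where c=0])
  obtain k where k: "wder lb k k K" "k lb = 0" by (rule ex_primitive_right[OF wderD(1)[OF K(1)], where c=0])
  note s0 = wder_lin[OF k(1) th, of "1 / ?a" "?b / ?a"]
  obtain r0 where r0: "wder lb r0 r0 (\<lambda>x. 1 / ?a * k x + ?b / ?a * TH x)" "r0 0 = 0"
    unfolding TH_def by (rule ex_primitive[OF wderD(1)[OF s0], where c=0])
  obtain u20 where u20: "wder lb u20 u20 r0" "u20 lb = 0" by (rule ex_primitive_right[OF wderD(1)[OF r0(1)], where c=0])
  obtain m where m: "wder la m m (\<lambda>x. (1 / ?a1) * cv1 F x)" "m 0 = 0" by (rule ex_primitive[OF L2_cmult[OF FD(3)], where c=0])
  obtain u10 where u10: "wder la u10 u10 m" "u10 la = 0" by (rule ex_primitive_right[OF wderD(1)[OF m(1)], where c=0])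
  \<comment> \<open>With e tied to c by the transmission condition, u1 = u2 at 0 reads c N = u10(0)
    - u20(0). The first term of N is the cubic at 0 divided by alpha2, the second the effect of the
    slope e over the length of the string; both are positive, so c exists.\<close>
  define N where "N = lb^3 / (3 * alpha2 P) + delta2 P * la / (beta2 P * alpha1 P)"
  have N: "N > 0" unfolding N_def by (intro add_pos_pos divide_pos_pos mult_pos_pos) auto
  define c where "c = (u10 0 - u20 0) / ?r N"
  define e where "e = ?d / (?b * ?a1) * c"
  have cN: "c * ?r N = u10 0 - u20 0" using N by (simp add: c_def)
  have cN': "c * ?r N = c / ?a * (?lb^3 / 3) + e * ?la"
    by (simp add: N_def e_def field_simps)
  note u1 = wder_lin[OF u10(1) lin[of la la], of 1 e] and p = wder_lin[OF m(1) one[of la], of 1 e]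
  note u2 = wder_lin[OF u20(1) cub, of 1 "c / ?a"] and r = wder_lin[OF r0(1) quad, of 1 "c / ?a"]
  note s = wder_lin[OF s0[folded TH_def] lin[of lb lb], of 1 "c / ?a"]
  note w = wder_lin[OF k(1) lin[of lb lb], of 1 c] and w' = wder_lin[OF K(1) one[of lb], of 1 c]
  note R = inD_I[OF u1 p u2 r s _ _ _ _ _ inH_D(1)[OF F] th[folded TH_def] TH0 q w w']
  have b: "1 * u10 la + e * ?r (la - la) = 0" "1 * u20 lb + c / ?a * ?r ((lb - lb)^3 / 6 - lb^2 * lb / 2 + lb^3 / 2) = 0"
    "1 * u10 0 + e * ?r (0 - la) = 1 * u20 0 + c / ?a * ?r ((0 - lb)^3 / 6 - lb^2 * 0 / 2 + lb^3 / 2)"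
    "1 * r0 0 + c / ?a * ?r (((0 - lb)^2 - lb^2) / 2) = 0"
    "1 * (1 / ?a * k lb + ?b / ?a * TH lb) + c / ?a * ?r (lb - lb) = 0"
  proof -
    show "1 * u10 la + e * ?r (la - la) = 0" by (simp add: u10)
    show "1 * u20 lb + c / ?a * ?r ((lb - lb)^3 / 6 - lb^2 * lb / 2 + lb^3 / 2) = 0"
      by (simp add: u20 power2_eq_square power3_eq_cube)
    have "?r ((0 - lb)^3 / 6 - lb^2 * 0 / 2 + lb^3 / 2) = ?lb^3 / 3"
    proof -
      have "(0 - lb)^3 / 6 - lb^2 * 0 / 2 + lb^3 / 2 = lb^3 / 3" by (simp add: power3_eq_cube)
      then show ?thesis by simp
    qed
    then show "1 * u10 0 + e * ?r (0 - la) = 1 * u20 0 + c / ?a * ?r ((0 - lb)^3 / 6 - lb^2 * 0 / 2 + lb^3 / 2)"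
      using cN cN' by (simp add: algebra_simps)
    show "1 * r0 0 + c / ?a * ?r (((0 - lb)^2 - lb^2) / 2) = 0" by (simp add: r0)
    show "1 * (1 / ?a * k lb + ?b / ?a * TH lb) + c / ?a * ?r (lb - lb) = 0" by (simp add: k TH0)
  qed
  have we: "AE x in lebesgue_on {0..lb}. 1 * k x + c * ?r (x - lb)
      = ?a * (1 * (1 / ?a * k x + ?b / ?a * TH x) + c / ?a * ?r (x - lb)) - ?b * TH x"
    by (rule AE_ivlI) (simp add: field_simps)
  have wb: "?r (delta2 P / beta2 P) * (1 * K 0 + c * 1) = ?a1 * (1 * m 0 + e * 1)"
    by (simp add: K m e_def)
  note R' = R[OF b we wb]
  define y where "y = St (\<lambda>x. 1 * u10 x + e * ?r (x - la)) (\<lambda>x. 1 * u20 x + c / ?a * ?r ((x - lb)^3 / 6 - lb^2 * x / 2 + lb^3 / 2))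
    (cu1 F) (cu2 F) TH (\<lambda>x. 1 * Q0 x + q0 * 1)"
  note R'' = R'[folded y_def]
  have "Heq P (A2 P y) F"
    unfolding Heq_def
  proof (intro conjI)
    show "AE x in lebesgue_on {0..la}. cv1 (A2 P y) x = cv1 F x"
      using R'(2) by eventually_elim (simp add: A2_def y_def)
    show "AE x in lebesgue_on {0..lb}. cv2 (A2 P y) x = cv2 F x"
      using R''(3) by eventually_elim (simp add: A2_def)
    show "AE x in lebesgue_on {0..lb}. cth (A2 P y) x = cth F x"
      using R'(4) by eventually_elim (simp add: A2_def y_def h2_def field_simps, algebra)
    show "AE x in lebesgue_on {0..lb}. cq (A2 P y) x = cq F x"
    proof -
      have alg: "- ?r (1 / tau2 P) * (1 * Q + q0 * 1) - ?r (kappa2 P / tau2 P) * (1 * ((- ?t / ?k) * f + (- 1 / ?k) * Q) + (- q0 / ?k) * 1) = f"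
        for Q f by (simp add: field_simps)
      show ?thesis using R'(5) by eventually_elim (simp only: A2_def y_def st.sel alg)
    qed
  qed (simp_all add: A2_def y_def)
  with R''(1) show ?thesis by blast
qed

text \<open>Both traces at 0 are integrals of the variables seen by the energy norm, so matching at
  the joint is a continuous linear constraint on the pair (u1', u2''). It is the only constraint on
  the image of \<open>Phi\<close>; the other boundary conditions are absorbed in the choice of
  primitives.\<close>

lemma V_constraint:
  assumes f1: "wder la f1 F1 p" "F1 la = 0" and f2: "wder lb f2 F2 r" "F2 lb = 0" and r: "wder lb r R s" "R 0 = 0"
  shows "F1 0 = F2 0 \<longleftrightarrow> l2inner 0 la p (\<lambda>x. 1) + l2inner 0 lb s (\<lambda>x. of_real (x - lb)) = 0"
proof -
  have "wder lb (\<lambda>x. of_real (x - lb)) (\<lambda>x. of_real (x - lb)) (\<lambda>x. 1)"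
    by (rule wder_affine)
  from wder_parts[OF _ r(1) this] have "l2inner 0 lb s (\<lambda>x. of_real (x - lb)) + l2inner 0 lb r (\<lambda>x. 1) = 0"
    using r by simp
  moreover have "F1 0 = - l2inner 0 la p (\<lambda>x. 1)"
    using wderD(3)[OF f1(1), of la] f1(2) by (simp add: l2inner_def add_eq_0_iff2)
  moreover have "F2 0 = - l2inner 0 lb r (\<lambda>x. 1)"
    using wderD(3)[OF f2(1), of lb] f2(2) by (simp add: l2inner_def add_eq_0_iff2)
  ultimately show ?thesis by (metis add.commute add.inverse_inverse add_eq_0_iff)
qed

text \<open>Limits are taken componentwise and integrated back to u1 and u2. Continuity at the
  joint, which primitives do not provide by themselves, is inherited through
  \<open>V_constraint\<close>.\<close>

lemma closed_Phi: "closed (Phi ` Collect (inH P))"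
  unfolding closed_sequential_limits
proof (intro allI impI, elim conjE)
  fix X x assume "\<forall>n. X n \<in> Phi ` Collect (inH P)" and lim: "X \<longlonglongrightarrow> x"
  then have "\<forall>n. \<exists>y. inH P y \<and> X n = Phi y" by blast
  then obtain y where y: "\<And>n. inH P (y n)" "\<And>n. X n = Phi (y n)" by metis
  note H = inH_D[OF y(1)]
  obtain x1 x2 x3 x4 x5 x6 where x: "x = (x1, x2, x3, x4, x5, x6)" by (cases x) auto
  have l1: "(\<lambda>n. w1 *\<^sub>R emb la (d1 P (cu1 (y n)))) \<longlonglongrightarrow> x1"
    using tendsto_fst[OF lim] by (simp add: y(2) x Phi_def)
  have l2: "(\<lambda>n. emb la (cv1 (y n))) \<longlonglongrightarrow> x2"
    using tendsto_fst[OF tendsto_snd[OF lim]] by (simp add: y(2) x Phi_def)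
  have l3: "(\<lambda>n. w3 *\<^sub>R emb lb (d2 P (d2 P (cu2 (y n))))) \<longlonglongrightarrow> x3"
    using tendsto_fst[OF tendsto_snd[OF tendsto_snd[OF lim]]] by (simp add: y(2) x Phi_def)
  have l4: "(\<lambda>n. w4 *\<^sub>R emb lb (cv2 (y n))) \<longlonglongrightarrow> x4"
    using tendsto_fst[OF tendsto_snd[OF tendsto_snd[OF tendsto_snd[OF lim]]]] by (simp add: y(2) x Phi_def)
  have l5: "(\<lambda>n. emb lb (cth (y n))) \<longlonglongrightarrow> x5"
    using tendsto_fst[OF tendsto_snd[OF tendsto_snd[OF tendsto_snd[OF tendsto_snd[OF lim]]]]] by (simp add: y(2) x Phi_def)
  have l6: "(\<lambda>n. w6 *\<^sub>R emb lb (cq (y n))) \<longlonglongrightarrow> x6"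
    using tendsto_snd[OF tendsto_snd[OF tendsto_snd[OF tendsto_snd[OF tendsto_snd[OF lim]]]]] by (simp add: y(2) x Phi_def)
  have sc: "(\<lambda>n. emb l (f n)) \<longlonglongrightarrow> (1 / c) *\<^sub>R z" if "(\<lambda>n. c *\<^sub>R emb l (f n)) \<longlonglongrightarrow> z" "0 < c" for c l f z
  proof -
    have "(\<lambda>n. (1 / c) *\<^sub>R (c *\<^sub>R emb l (f n))) \<longlonglongrightarrow> (1 / c) *\<^sub>R z" by (intro tendsto_intros that)
    then show ?thesis using that(2) by simp
  qed
  obtain p where p: "L2 0 la p" "(1 / w1) *\<^sub>R x1 = emb la p" using emb_limit[OF H(2) sc[OF l1]] by auto
  obtain v1 where v1: "L2 0 la v1" "x2 = emb la v1" using emb_limit[OF H(3) l2] by auto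
  obtain s where s: "L2 0 lb s" "(1 / w3) *\<^sub>R x3 = emb lb s" using emb_limit[OF H(4) sc[OF l3]] by auto
  obtain v2 where v2: "L2 0 lb v2" "(1 / w4) *\<^sub>R x4 = emb lb v2" using emb_limit[OF H(5) sc[OF l4]] by auto
  obtain th where th: "L2 0 lb th" "x5 = emb lb th" using emb_limit[OF H(6) l5] by auto
  obtain q where q: "L2 0 lb q" "(1 / w6) *\<^sub>R x6 = emb lb q" using emb_limit[OF H(7) sc[OF l6]] by auto
  have Lm: "L2 0 lb (\<lambda>x. c * of_real (x - lb))" "L2 0 la (\<lambda>x. c)" for c
    by (intro L2_continuous continuous_intros)+
  \<comment> \<open>The constraint is complex while limits are taken in the real inner product, so
    it is tested with an arbitrary factor d; d = 1 and d = - i recover its real and imaginary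
    parts.\<close>
  have con: "Re (d * (l2inner 0 la p (\<lambda>x. 1) + l2inner 0 lb s (\<lambda>x. of_real (x - lb)))) = 0" for d
  proof -
    have e: "inner (emb la p) (emb la (\<lambda>x. cnj d)) + inner (emb lb s) (emb lb (\<lambda>x. cnj d * of_real (x - lb)))
        = Re (d * (l2inner 0 la p (\<lambda>x. 1) + l2inner 0 lb s (\<lambda>x. of_real (x - lb))))"
      if "L2 0 la p" "L2 0 lb s" for p s
    proof -
      have "l2inner 0 la p (\<lambda>x. cnj d) = d * l2inner 0 la p (\<lambda>x. 1)"
        by (simp add: l2inner_def mult.commute)
      moreover have "l2inner 0 lb s (\<lambda>x. cnj d * of_real (x - lb)) = d * l2inner 0 lb s (\<lambda>x. of_real (x - lb))"
        unfolding l2inner_def by (simp only: complex_cnj_mult complex_cnj_cnj mult.left_commute[of _ d] integral_mult_right_zero)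
      ultimately show ?thesis using that Lm by (simp add: emb_inner distrib_left)
    qed
    have "(\<lambda>n. inner (emb la (d1 P (cu1 (y n)))) (emb la (\<lambda>x. cnj d)) + inner (emb lb (d2 P (d2 P (cu2 (y n))))) (emb lb (\<lambda>x. cnj d * of_real (x - lb))))
       \<longlonglongrightarrow> inner (emb la p) (emb la (\<lambda>x. cnj d)) + inner (emb lb s) (emb lb (\<lambda>x. cnj d * of_real (x - lb)))"
      using sc[OF l1] sc[OF l3] p s by (intro tendsto_intros) auto
    moreover have "inner (emb la (d1 P (cu1 (y n)))) (emb la (\<lambda>x. cnj d)) + inner (emb lb (d2 P (d2 P (cu2 (y n))))) (emb lb (\<lambda>x. cnj d * of_real (x - lb))) = 0" for n
    proof -
      have "l2inner 0 la (d1 P (cu1 (y n))) (\<lambda>x. 1) + l2inner 0 lb (d2 P (d2 P (cu2 (y n)))) (\<lambda>x. of_real (x - lb)) = 0"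
        using V_constraint[OF inV_D(1)[OF H(1)[of n]] inV_D(4)[OF H(1)[of n]] inV_D(2)[OF H(1)[of n]]
          inV_D(5)[OF H(1)[of n]] inV_D(3)[OF H(1)[of n]] inV_D(7)[OF H(1)[of n]]] inV_D(6)[OF H(1)[of n]] by blast
      then show ?thesis unfolding e[OF H(2) H(4)] by (simp only: mult_zero_right zero_complex.sel)
    qed
    ultimately have "inner (emb la p) (emb la (\<lambda>x. cnj d)) + inner (emb lb s) (emb lb (\<lambda>x. cnj d * of_real (x - lb))) = 0"
      by (simp only: LIMSEQ_const_iff)
    then show ?thesis unfolding e[OF p(1) s(1)] .
  qed
  have c0: "l2inner 0 la p (\<lambda>x. 1) + l2inner 0 lb s (\<lambda>x. of_real (x - lb)) = 0"
    using con[of 1] con[of "- \<i>"] by (intro complex_eqI) simp_all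
  obtain u1 where u1: "wder la u1 u1 p" "u1 la = 0" by (rule ex_primitive_right[OF p(1)])
  obtain r where r: "wder lb r r s" "r 0 = 0" by (rule ex_primitive[OF s(1)])
  obtain u2 where u2: "wder lb u2 u2 r" "u2 lb = 0" by (rule ex_primitive_right[OF wderD(1)[OF r(1)]])
  have "u1 0 = u2 0" using V_constraint[OF u1 u2 r] c0 by simp
  note V = inV_I[OF u1(1) u2(1) r(1) u1(2) u2(2) this r(2)]
  have Hz: "inH P (St u1 u2 v1 v2 th q)" using V v1 v2 th q by (simp add: inH_def)
  have "emb la (d1 P u1) = emb la p" using emb_eq_iff[OF inH_D(2)[OF Hz] ] p V(2) by simp
  moreover have "emb lb (d2 P (d2 P u2)) = emb lb s" using emb_eq_iff[OF inH_D(4)[OF Hz]] s V(3) by simp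
  moreover have "w1 *\<^sub>R emb la p = x1" "w3 *\<^sub>R emb lb s = x3" "w4 *\<^sub>R emb lb v2 = x4" "w6 *\<^sub>R emb lb q = x6"
    using weight_pos by (simp_all add: p(2)[symmetric] s(2)[symmetric] v2(2)[symmetric] q(2)[symmetric] less_imp_neq[symmetric])
  ultimately have "Phi (St u1 u2 v1 v2 th q) = x" by (simp add: Phi_def x v1 th)
  then show "x \<in> Phi ` Collect (inH P)" using Hz by blast
qed

lemma Phi_comp_bounds:
  assumes H: "inH P y" and C: "norm (Phi y) \<le> C"
  shows "l2norm 0 la (d1 P (cu1 y)) \<le> C / w1" "l2norm 0 la (cv1 y) \<le> C" "l2norm 0 lb (d2 P (d2 P (cu2 y))) \<le> C / w3"
    "l2norm 0 lb (cv2 y) \<le> C / w4" "l2norm 0 lb (cth y) \<le> C" "l2norm 0 lb (cq y) \<le> C / w6"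
proof -
  note h = inH_D[OF H]
  have f: "norm a \<le> C" "norm b \<le> C" if "norm (a, b) \<le> C" for a :: "'x::real_normed_vector" and b :: "'y::real_normed_vector"
    using that norm_fst_le[of a b] norm_snd_le[of b a] by linarith+
  note c1 = f[OF C[unfolded Phi_def]]
  note c2 = f[OF c1(2)]
  note c3 = f[OF c2(2)]
  note c4 = f[OF c3(2)]
  note c5 = f[OF c4(2)]
  show "l2norm 0 la (d1 P (cu1 y)) \<le> C / w1" "l2norm 0 la (cv1 y) \<le> C" "l2norm 0 lb (d2 P (d2 P (cu2 y))) \<le> C / w3"
    "l2norm 0 lb (cv2 y) \<le> C / w4" "l2norm 0 lb (cth y) \<le> C" "l2norm 0 lb (cq y) \<le> C / w6"
    using c1(1) c2(1) c3(1) c4(1) c5 h by (simp_all add: emb_norm pos_le_divide_eq mult.commute)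
qed

text \<open>The set K has to depend on C alone. The constants come from solving the components of A2
  y for their leading derivatives; v2' and w', which do not occur in the norm of A2 y, are treated
  separately.\<close>

lemma relcomp_graph_ball:
  "\<exists>K. relcomp K \<and> (\<forall>y. inD P y \<longrightarrow> norm (Phi y) \<le> C \<longrightarrow> norm (Phi (A2 P y)) \<le> C \<longrightarrow> Phi y \<in> K)"
proof -
  define cp where "cp = C / alpha1 P"
  define cq' where "cq' = 1 / gamma2 P * C + delta2 P / gamma2 P * (C / w3)"
  define ct' where "ct' = tau2 P / kappa2 P * (C / w6) + 1 / kappa2 P * (C / w6)"
  define cv' where "cv' = sqrt lb * (sqrt lb * (C / w3))"
  define cw0 where "cw0 = alpha1 P * beta2 P / delta2 P * (C / w1 / sqrt la + sqrt la * cp)"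
  define cw where "cw = sqrt lb * (cw0 + sqrt lb * (C / w4))"
  define cs where "cs = 1 / alpha2 P * cw + beta2 P / alpha2 P * ct'"
  define E where "E l B = {emb l f | f F g. wder l f F g \<and> l2norm 0 l f \<le> B \<and> l2norm 0 l g \<le> B}" for l B
  define K where "K = (\<lambda>x. w1 *\<^sub>R x) ` E la (max (C / w1) cp) \<times> E la (max C (C / w1)) \<times> (\<lambda>x. w3 *\<^sub>R x) ` E lb (max (C / w3) cs)
    \<times> (\<lambda>x. w4 *\<^sub>R x) ` E lb (max (C / w4) cv') \<times> E lb (max C ct') \<times> (\<lambda>x. w6 *\<^sub>R x) ` E lb (max (C / w6) cq')"
  have EI: "emb l f \<in> E l (max a b)" if "wder l f F g" "l2norm 0 l f \<le> a" "l2norm 0 l g \<le> b" for l f F g a b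
    unfolding E_def using that by (auto simp: le_max_iff_disj)
  have "relcomp K"
    unfolding K_def E_def by (intro relcomp_Times relcomp_scaleR relcomp_H1_ball pos_simps)
  moreover have "Phi y \<in> K" if y: "inD P y" and C: "norm (Phi y) \<le> C" "norm (Phi (A2 P y)) \<le> C" for y
  proof -
    note d = inD_D[OF y]
    note u = inV_D[OF d(2)] and v = inV_D[OF d(3)]
    note b = Phi_comp_bounds[OF d(1) C(1)]
    note bA = Phi_comp_bounds[OF A2_inH[OF y] C(2)]
    have C0: "0 \<le> C" using C(1) norm_ge_zero order.trans by blast
    have p': "l2norm 0 la (d1 P (d1 P (cu1 y))) \<le> cp"
      using bA(2) wderD(2)[OF d(4)] by (simp add: A2_def l2norm_cmult cp_def pos_le_divide_eq mult.commute)
    have v1': "l2norm 0 la (d1 P (cv1 y)) \<le> C / w1" using bA(1) by (simp add: A2_def)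
    have v2'': "l2norm 0 lb (d2 P (d2 P (cv2 y))) \<le> C / w3" using bA(3) by (simp add: A2_def)
    have q': "l2norm 0 lb (d2 P (cq y)) \<le> cq'"
    proof -
      let ?f = "\<lambda>x. - of_real (delta2 P) * d2 P (d2 P (cv2 y)) x - of_real (gamma2 P) * d2 P (cq y) x"
      have L: "L2 0 lb ?f" using inH_D(6)[OF A2_inH[OF y]] by (simp add: A2_def)
      have eq: "d2 P (cq y) = (\<lambda>x. of_real (- 1 / gamma2 P) * ?f x + of_real (- delta2 P / gamma2 P) * d2 P (d2 P (cv2 y)) x)"
        by (auto simp: fun_eq_iff field_simps)
      have "l2norm 0 lb (d2 P (cq y)) \<le> cmod (of_real (- 1 / gamma2 P)) * l2norm 0 lb ?f
          + cmod (of_real (- delta2 P / gamma2 P)) * l2norm 0 lb (d2 P (d2 P (cv2 y)))"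
        by (rule order.trans[OF eq_refl[OF arg_cong[OF eq, where f="l2norm 0 lb"]] l2norm_lin_le[OF L wderD(2)[OF v(3)]]])
      also have "\<dots> \<le> 1 / gamma2 P * C + delta2 P / gamma2 P * (C / w3)"
        unfolding norm_of_real using bA(5) v2''
        by (intro add_mono mult_mono) (auto simp: A2_def l2norm_nonneg)
      finally show ?thesis by (simp add: cq'_def)
    qed
    have t': "l2norm 0 lb (d2 P (cth y)) \<le> ct'"
    proof -
      let ?f = "\<lambda>x. - of_real (1 / tau2 P) * cq y x - of_real (kappa2 P / tau2 P) * d2 P (cth y) x"
      have L: "L2 0 lb ?f" using inH_D(7)[OF A2_inH[OF y]] by (simp add: A2_def)
      have eq: "d2 P (cth y) = (\<lambda>x. of_real (- tau2 P / kappa2 P) * ?f x + of_real (- 1 / kappa2 P) * cq y x)"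
        by (auto simp: fun_eq_iff field_simps)
      have "l2norm 0 lb (d2 P (cth y)) \<le> cmod (of_real (- tau2 P / kappa2 P)) * l2norm 0 lb ?f
          + cmod (of_real (- 1 / kappa2 P)) * l2norm 0 lb (cq y)"
        by (rule order.trans[OF eq_refl[OF arg_cong[OF eq, where f="l2norm 0 lb"]] l2norm_lin_le[OF L wderD(1)[OF d(8)]]])
      also have "\<dots> \<le> tau2 P / kappa2 P * (C / w6) + 1 / kappa2 P * (C / w6)"
        unfolding norm_of_real using bA(6) b(6)
        by (intro add_mono mult_mono) (auto simp: A2_def l2norm_nonneg)
      finally show ?thesis by (simp add: ct'_def)
    qed
    \<comment> \<open>Obtained from v2'' and the clamping condition v2' = 0 at 0.\<close>
    have v2': "l2norm 0 lb (d2 P (cv2 y)) \<le> cv'"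
    proof -
      let ?G = "crep 0 lb (d2 P (cv2 y))"
      have "cmod (?G x) \<le> sqrt lb * (C / w3)" if "x \<in> {0..lb}" for x
      proof -
        have "cmod (?G x - ?G 0) \<le> sqrt \<bar>x - 0\<bar> * l2norm 0 lb (d2 P (d2 P (cv2 y)))"
          using that by (intro wder_holder[OF v(3)]) auto
        also have "\<dots> \<le> sqrt lb * (C / w3)"
          using that v2'' by (intro mult_mono real_sqrt_le_mono) (auto simp: l2norm_nonneg)
        finally show ?thesis using v(7) by simp
      qed
      then have "l2norm 0 lb ?G \<le> cv'"
        unfolding cv'_def using C0 by (intro l2norm_le L2_continuous[OF wder_continuous[OF v(3)]]) (auto simp: less_imp_le)
      moreover have "l2norm 0 lb (d2 P (cv2 y)) = l2norm 0 lb ?G"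
        by (rule l2norm_cong[OF wderD(1)[OF v(3)] L2_continuous[OF wder_continuous[OF v(3)]] wderD(4)[OF v(3)]])
      ultimately show ?thesis by simp
    qed
    have ww: "l2norm 0 lb (d2 P (d2 P (wfun P y))) \<le> C / w4"
    proof -
      have "l2norm 0 lb (\<lambda>x. (-1) * d2 P (d2 P (wfun P y)) x) \<le> C / w4" using bA(4) by (simp add: A2_def)
      then show ?thesis by (simp only: l2norm_cmult[OF wderD(2)[OF d(10)]] norm_minus_cancel norm_one mult_1)
    qed
    \<comment> \<open>Bounded through w'' and the value of w' at 0. The transmission condition
      expresses that value by u1' at the joint, a trace controlled by the H1 norm of u1'.\<close>
    have w': "l2norm 0 lb (d2 P (wfun P y)) \<le> cw"
    proof -
      let ?W = "crep 0 lb (d2 P (wfun P y))" and ?Pc = "crep 0 la (d1 P (cu1 y))"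
      have "cmod (?Pc 0) \<le> l2norm 0 la (d1 P (cu1 y)) / sqrt la + sqrt la * l2norm 0 la (d1 P (d1 P (cu1 y)))"
        by (rule wder_sup_bound[OF _ d(4)]) auto
      also have "\<dots> \<le> C / w1 / sqrt la + sqrt la * cp"
        using b(1) p' by (intro add_mono divide_right_mono mult_left_mono) auto
      finally have Pc: "cmod (?Pc 0) \<le> C / w1 / sqrt la + sqrt la * cp" .
      have "?W 0 = of_real (alpha1 P * beta2 P / delta2 P) * ?Pc 0" using d(13) by (simp add: field_simps)
      then have "cmod (?W 0) = alpha1 P * beta2 P / delta2 P * cmod (?Pc 0)"
        by (simp only: norm_mult norm_of_real) (simp add: abs_of_pos)
      also have "\<dots> \<le> cw0" unfolding cw0_def using Pc by (intro mult_left_mono) auto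
      finally have W0: "cmod (?W 0) \<le> cw0" .
      have "cmod (?W x) \<le> cw0 + sqrt lb * (C / w4)" if "x \<in> {0..lb}" for x
      proof -
        have "cmod (?W x - ?W 0) \<le> sqrt \<bar>x - 0\<bar> * l2norm 0 lb (d2 P (d2 P (wfun P y)))"
          using that by (intro wder_holder[OF d(10)]) auto
        also have "\<dots> \<le> sqrt lb * (C / w4)"
          using that ww by (intro mult_mono real_sqrt_le_mono) (auto simp: l2norm_nonneg)
        finally show ?thesis using W0 norm_triangle_ineq2[of "?W x" "?W 0"] by linarith
      qed
      moreover have "0 \<le> cw0 + sqrt lb * (C / w4)"
      proof (rule add_nonneg_nonneg)
        show "0 \<le> cw0" using W0 norm_ge_zero[of "?W 0"] by linarith
        show "0 \<le> sqrt lb * (C / w4)" using C0 by (simp add: less_imp_le)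
      qed
      ultimately have "l2norm 0 lb ?W \<le> cw"
        unfolding cw_def by (intro l2norm_le L2_continuous[OF wder_continuous[OF d(10)]]) auto
      moreover have "l2norm 0 lb (d2 P (wfun P y)) = l2norm 0 lb ?W"
        by (rule l2norm_cong[OF wderD(1)[OF d(10)] L2_continuous[OF wder_continuous[OF d(10)]] wderD(4)[OF d(10)]])
      ultimately show ?thesis by simp
    qed
    have s': "l2norm 0 lb (\<lambda>x. of_real (1 / alpha2 P) * d2 P (wfun P y) x + of_real (beta2 P / alpha2 P) * d2 P (cth y) x) \<le> cs"
    proof (rule order.trans[OF l2norm_lin_le[OF wderD(2)[OF d(9)] wderD(2)[OF d(5)]]])
      show "cmod (of_real (1 / alpha2 P)) * l2norm 0 lb (d2 P (wfun P y)) + cmod (of_real (beta2 P / alpha2 P)) * l2norm 0 lb (d2 P (cth y)) \<le> cs"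
        unfolding cs_def norm_of_real using w' t' by (intro add_mono mult_mono) (auto simp: l2norm_nonneg)
    qed
    show ?thesis
      unfolding Phi_def K_def
      by (intro SigmaI imageI EI[OF d(4) b(1) p'] EI[OF v(1) b(2) v1'] EI[OF d(11) b(3) s'] EI[OF v(2) b(4) v2']
          EI[OF d(5) b(5) t'] EI[OF d(8) b(6) q'])
  qed
  ultimately show ?thesis by blast
qed

end

section \<open>Strong stability\<close>

text \<open>With d the difference quotient at 0, expanding |x + t d|^2 = |x|^2 gives inner (d t) x =
  - (t/2) |d t|^2, which tends to 0.\<close>

lemma (in m_dissipative) isometric_orbit_inner_zero:
  assumes x: "x \<in> D" and iso: "\<And>t. 0 \<le> t \<Longrightarrow> norm (S t x) = norm x"
  shows "inner (A x) x = 0"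
proof -
  define d where "d t = (1/t) *\<^sub>R (S t x - x)" for t
  have lim: "(d \<longlongrightarrow> A x) (at_right 0)" unfolding d_def by (rule S_generator[OF x])
  have "((\<lambda>t. inner (d t) x) \<longlongrightarrow> inner (A x) x) (at_right 0)" by (intro tendsto_intros lim)
  moreover have "((\<lambda>t. - (t / 2) * (norm (d t))\<^sup>2) \<longlongrightarrow> - (0 / 2) * (norm (A x))\<^sup>2) (at_right 0)"
    by (intro tendsto_intros lim) auto
  moreover have "\<forall>\<^sub>F t in at_right 0. - (t / 2) * (norm (d t))\<^sup>2 = inner (d t) x"
    using eventually_at_right_less[of "0::real"]
  proof eventually_elim
    case (elim t)
    have "S t x = x + t *\<^sub>R d t" using elim by (simp add: d_def)
    then have "(norm (x + t *\<^sub>R d t))\<^sup>2 = (norm x)\<^sup>2" using iso[of t] elim by simp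
    then have "inner x x + 2 * t * inner (d t) x + t * (t * inner (d t) (d t)) = inner x x"
      unfolding power2_norm_eq_inner
      by (simp add: inner_add_left inner_add_right inner_commute[of x "d t"] algebra_simps)
    then have "t * (2 * inner (d t) x + t * inner (d t) (d t)) = 0" by (simp add: algebra_simps)
    then have "2 * inner (d t) x + t * inner (d t) (d t) = 0" using elim by simp
    then show ?case by (simp add: power2_norm_eq_inner)
  qed
  ultimately have "((\<lambda>t. inner (d t) x) \<longlongrightarrow> 0) (at_right 0)" "((\<lambda>t. inner (d t) x) \<longlongrightarrow> inner (A x) x) (at_right 0)"
    using tendsto_cong[of "\<lambda>t. - (t / 2) * (norm (d t))\<^sup>2" "\<lambda>t. inner (d t) x" "at_right 0" 0] by simp_all
  then show ?thesis using tendsto_unique[OF trivial_limit_at_right_real] by blast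
qed

text \<open>Differentiation at time 0. This is how the vanishing of one component along an orbit
  turns into the next equation.\<close>

lemma (in m_dissipative) annihilated_orbit:
  assumes x: "x \<in> D" and f: "bounded_linear f" and z: "\<And>t. 0 \<le> t \<Longrightarrow> f (S t x) = 0"
  shows "f (A x) = 0"
proof -
  interpret f: bounded_linear f by fact
  have "((\<lambda>t. f ((1/t) *\<^sub>R (S t x - x))) \<longlongrightarrow> f (A x)) (at_right 0)"
    by (intro f.tendsto S_generator x)
  moreover have "\<forall>\<^sub>F t in at_right 0. f ((1/t) *\<^sub>R (S t x - x)) = 0"
    using eventually_at_right_less[of "0::real"]
  proof eventually_elim
    case (elim t)
    then show ?case using z[of t] z[of 0] by (simp add: f.scaleR f.diff S_0)
  qed
  ultimately have "((\<lambda>t::real. 0) \<longlongrightarrow> f (A x)) (at_right 0)"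
    using tendsto_cong[of "\<lambda>t. f ((1/t) *\<^sub>R (S t x - x))" "\<lambda>t. 0" "at_right 0" "f (A x)"] by blast
  then show ?thesis by (simp add: tendsto_const_iff)
qed

lemma sq_integrable_affine: "sq_integrable f \<Longrightarrow> sq_integrable (zext l (\<lambda>x. of_real (x - l) * f x))"
  using L2_affine_mult[OF sq_integrable_L2] by (simp add: L2_iff_sq_integrable)

text \<open>The multiplier x - l as an operator on classes, so that functionals containing it can be
  differentiated along orbits; the cut-off to [0, l] makes it bounded.\<close>

lift_definition affine_mult :: "real \<Rightarrow> l2 \<Rightarrow> l2" is "\<lambda>l f. zext l (\<lambda>x. of_real (x - l) * f x)"
proof -
  fix l :: real and f g :: "real \<Rightarrow> complex"
  assume *: "sq_integrable f \<and> sq_integrable g \<and> (AE x in lebesgue. f x = g x)"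
  then have "AE x in lebesgue. zext l (\<lambda>x. of_real (x - l) * f x) x = zext l (\<lambda>x. of_real (x - l) * g x) x"
    by (auto simp: zext_def elim: eventually_mono)
  with * show "sq_integrable (zext l (\<lambda>x. of_real (x - l) * f x)) \<and> sq_integrable (zext l (\<lambda>x. of_real (x - l) * g x)) \<and>
      (AE x in lebesgue. zext l (\<lambda>x. of_real (x - l) * f x) x = zext l (\<lambda>x. of_real (x - l) * g x) x)"
    using sq_integrable_affine by blast
qed

lemma norm_affine_mult:
  assumes "0 \<le> l"
  shows "norm (affine_mult l x) \<le> l * norm x"
proof (rule power2_le_imp_le)
  obtain f where f: "sq_integrable f" "x = abs_l2 f" by (rule abs_l2_surj)
  have e: "affine_mult l x = abs_l2 (zext l (\<lambda>x. of_real (x - l) * f x))" using f by (simp add: affine_mult.abs_eq)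
  have "(norm (affine_mult l x))\<^sup>2 = (LINT t|lebesgue. (cmod (zext l (\<lambda>x. of_real (x - l) * f x) t))\<^sup>2)"
    unfolding e by (rule norm_abs_l2[OF sq_integrable_affine[OF f(1)]])
  also have "\<dots> \<le> (LINT t|lebesgue. l\<^sup>2 * (cmod (f t))\<^sup>2)"
  proof (rule integral_mono)
    show "integrable lebesgue (\<lambda>t. (cmod (zext l (\<lambda>x. of_real (x - l) * f x) t))\<^sup>2)"
      using sq_integrable_affine[OF f(1)] by (simp add: sq_integrable_def)
    show "integrable lebesgue (\<lambda>t. l\<^sup>2 * (cmod (f t))\<^sup>2)" using f(1) by (simp add: sq_integrable_def)
    fix t :: real
    show "(cmod (zext l (\<lambda>x. of_real (x - l) * f x) t))\<^sup>2 \<le> l\<^sup>2 * (cmod (f t))\<^sup>2"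
    proof (cases "t \<in> {0..l}")
      case True
      then have "\<bar>t - l\<bar>\<^sup>2 \<le> l\<^sup>2" by (intro power_mono) auto
      then show ?thesis using True
        by (simp add: zext_def norm_mult power_mult_distrib mult_right_mono norm_of_real del: of_real_diff)
    qed (auto simp: zext_def)
  qed
  also have "\<dots> = (l * norm x)\<^sup>2" using f by (simp add: norm_abs_l2 power_mult_distrib)
  finally show "(norm (affine_mult l x))\<^sup>2 \<le> (l * norm x)\<^sup>2" .
qed (use assms in simp)

lemma bounded_linear_affine_mult:
  assumes "0 \<le> l"
  shows "bounded_linear (affine_mult l)"
proof (rule bounded_linear_intro[where K=l])
  let ?m = "\<lambda>f. zext l (\<lambda>x. of_real (x - l) * f x)"
  fix x y :: l2 and r :: real
  obtain f where f: "sq_integrable f" "x = abs_l2 f" by (rule abs_l2_surj)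
  obtain g where g: "sq_integrable g" "y = abs_l2 g" by (rule abs_l2_surj)
  note m = affine_mult.abs_eq
  have "affine_mult l (x + y) = abs_l2 (?m (\<lambda>t. f t + g t))"
    unfolding f g using f g sq_integrable_add[OF f(1) g(1)] by (simp only: plus_l2.abs_eq m simp_thms AE_I2)
  also have "?m (\<lambda>t. f t + g t) = (\<lambda>t. ?m f t + ?m g t)" by (auto simp: zext_def distrib_left)
  also have "abs_l2 (\<lambda>t. ?m f t + ?m g t) = affine_mult l x + affine_mult l y"
    unfolding f g using f g sq_integrable_affine[OF f(1), of l] sq_integrable_affine[OF g(1), of l]
    by (simp only: plus_l2.abs_eq m simp_thms AE_I2)
  finally show "affine_mult l (x + y) = affine_mult l x + affine_mult l y" .
  have "affine_mult l (r *\<^sub>R x) = abs_l2 (?m (\<lambda>t. of_real r * f t))"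
    unfolding f scaleR_l2_def using f sq_integrable_cmult[OF f(1), of "of_real r"]
    by (simp only: cscale.abs_eq m simp_thms AE_I2)
  also have "?m (\<lambda>t. of_real r * f t) = (\<lambda>t. of_real r * ?m f t)" by (auto simp: zext_def)
  also have "abs_l2 (\<lambda>t. of_real r * ?m f t) = r *\<^sub>R affine_mult l x"
    unfolding f scaleR_l2_def using f sq_integrable_affine[OF f(1), of l]
    by (simp only: cscale.abs_eq m simp_thms AE_I2)
  finally show "affine_mult l (r *\<^sub>R x) = r *\<^sub>R affine_mult l x" .
  show "norm (affine_mult l x) \<le> norm x * l" using norm_affine_mult[OF assms] by (simp add: mult.commute)
qed

lemma affine_mult_emb:
  assumes "L2 0 l f"
  shows "affine_mult l (emb l f) = emb l (\<lambda>x. of_real (x - l) * f x)"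
proof -
  have "affine_mult l (emb l f) = abs_l2 (zext l (\<lambda>x. of_real (x - l) * zext l f x))"
    unfolding emb_def using assms by (intro affine_mult.abs_eq) (simp add: L2_iff_sq_integrable)
  also have "zext l (\<lambda>x. of_real (x - l) * zext l f x) = zext l (\<lambda>x. of_real (x - l) * f x)"
    by (auto simp: zext_def)
  finally show ?thesis by (simp add: emb_def)
qed

lemma emb_zero_iff:
  assumes "L2 0 l f"
  shows "emb l f = 0 \<longleftrightarrow> (AE x in lebesgue_on {0..l}. f x = 0)"
proof -
  have "emb l (\<lambda>x. 0 * f x) = 0" using emb_cmult[OF assms, of 0] cscale_of_real[of 0 "emb l f"] by simp
  then show ?thesis using emb_eq_iff[OF assms L2_cmult[OF assms, of 0]] by simp
qed

lemma wder_zero: "wder l (\<lambda>x. 0) (\<lambda>x. 0) (\<lambda>x. 0)"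
  using wder_real_smooth[of "\<lambda>x. 0" "\<lambda>x. 0" l] by simp

lemma wder_vanish:
  assumes l: "0 \<le> l" and w: "wder l f F g" and g: "AE x in lebesgue_on {0..l}. g x = 0" and c: "c \<in> {0..l}" "F c = 0"
  shows "x \<in> {0..l} \<Longrightarrow> F x = 0" "AE x in lebesgue_on {0..l}. f x = 0"
proof -
  have w': "wder l f F (\<lambda>x. 0)"
    by (rule wder_cong[OF w wderD(1)[OF w] _ wderD(2)[OF wder_zero] g _ l]) auto
  have F0: "F x = F 0" if "x \<in> {0..l}" for x using wderD(3)[OF w' that] by simp
  then have F: "F x = 0" if "x \<in> {0..l}" for x using F0[OF that] F0[OF c(1)] c(2) by simp
  then show "x \<in> {0..l} \<Longrightarrow> F x = 0" .
  have "AE x in lebesgue_on {0..l}. F x = 0" by (rule AE_ivlI) (rule F)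
  then show "AE x in lebesgue_on {0..l}. f x = 0" using wderD(4)[OF w] by eventually_elim simp
qed

lemma wder_AE_zero:
  assumes l: "0 < l" and w: "wder l f F g" and f: "AE x in lebesgue_on {0..l}. f x = 0"
  shows "x \<in> {0..l} \<Longrightarrow> F x = 0" "AE x in lebesgue_on {0..l}. g x = 0"
  using wder_unique[OF l w wder_zero f] by auto

text \<open>Rellich-type identity for the multiplier \<open>x - l\<close>: no boundary term survives, at \<open>l\<close> because the
  multiplier vanishes and at \<open>0\<close> because \<open>F\<close> does.\<close>

lemma multiplier_identity:
  assumes l: "0 \<le> l" and w: "wder l f F g" and F0: "F 0 = 0"
  shows "Re (l2inner 0 l (\<lambda>x. of_real (x - l) * g x) f) = - (1/2) * (l2norm 0 l f)\<^sup>2"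
    "Re (l2inner 0 l (\<lambda>x. of_real (x - l) * f x) g) = - (1/2) * (l2norm 0 l f)\<^sup>2"
proof -
  note L = wderD(1,2)[OF w]
  have "l2inner 0 l (\<lambda>x. f x + of_real (x - l) * g x) f + l2inner 0 l (\<lambda>x. of_real (x - l) * f x) g = 0"
    using wder_parts[OF l wder_mult_affine[OF w, of l] w] F0 by simp
  moreover have "l2inner 0 l (\<lambda>x. f x + of_real (x - l) * g x) f = l2inner 0 l f f + l2inner 0 l (\<lambda>x. of_real (x - l) * g x) f"
    using l2inner_lin_left[OF L(1) L2_affine_mult[OF L(2)] L(1), of 1 1] by simp
  moreover have c: "l2inner 0 l (\<lambda>x. of_real (x - l) * f x) g = cnj (l2inner 0 l (\<lambda>x. of_real (x - l) * g x) f)"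
    unfolding l2inner_def
    using Bochner_Integration.integral_cnj[of "lebesgue_on {0..l}" "\<lambda>x. of_real (x - l) * g x * cnj (f x)"]
    by (simp add: mult.commute mult.left_commute)
  ultimately have z: "l2inner 0 l f f + l2inner 0 l (\<lambda>x. of_real (x - l) * g x) f + cnj (l2inner 0 l (\<lambda>x. of_real (x - l) * g x) f) = 0"
    by simp
  have "Re (l2inner 0 l f f) = (l2norm 0 l f)\<^sup>2" by (simp add: l2inner_self)
  with arg_cong[OF z, of Re] show 1: "Re (l2inner 0 l (\<lambda>x. of_real (x - l) * g x) f) = - (1/2) * (l2norm 0 l f)\<^sup>2" by simp
  have "Re (l2inner 0 l (\<lambda>x. of_real (x - l) * f x) g) = Re (l2inner 0 l (\<lambda>x. of_real (x - l) * g x) f)"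
    unfolding c by simp
  with 1 show "Re (l2inner 0 l (\<lambda>x. of_real (x - l) * f x) g) = - (1/2) * (l2norm 0 l f)\<^sup>2" by simp
qed

section \<open>The operator on the image of the energy space\<close>

context wave_beam
begin

definition "XX = Phi ` Collect (inH P)"
definition "DD = Phi ` Collect (inD P)"
definition "AA x = Phi (A2 P (SOME y. inD P y \<and> Phi y = x))"

text \<open>The choice in \<open>AA\<close> is harmless: preimages of the same point agree up to
  \<open>Heq P\<close>, which A2 respects.\<close>

lemma AA_Phi:
  assumes y: "inD P y"
  shows "AA (Phi y) = Phi (A2 P y)"
proof -
  define z where "z = (SOME z. inD P z \<and> Phi z = Phi y)"
  have z: "inD P z" "Phi z = Phi y" unfolding z_def using someI[of "\<lambda>z. inD P z \<and> Phi z = Phi y" y] y by auto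
  have "Heq P z y" using Phi_eq_iff[OF inD_D(1)[OF z(1)] inD_D(1)[OF y]] z(2) by simp
  from inD_cong(2)[OF z(1) inD_D(1)[OF y] this] have "Phi (A2 P z) = Phi (A2 P y)"
    using Phi_eq_iff[OF A2_inH[OF z(1)] A2_inH[OF y]] by simp
  then show ?thesis by (simp add: AA_def z_def)
qed

lemma DD_lin:
  assumes "x \<in> DD" "z \<in> DD"
  shows "csc a x + csc b z \<in> DD" "AA (csc a x + csc b z) = csc a (AA x) + csc b (AA z)"
proof -
  obtain y where y: "inD P y" "x = Phi y" using assms(1) by (auto simp: DD_def)
  obtain y' where y': "inD P y'" "z = Phi y'" using assms(2) by (auto simp: DD_def)
  note h = inD_D(1)[OF y(1)] inD_D(1)[OF y'(1)]
  have e: "csc a x + csc b z = Phi (st_lin a y b y')" using Phi_lin(2)[OF h] by (simp add: y y')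
  show "csc a x + csc b z \<in> DD" unfolding e DD_def using inD_lin(1)[OF y(1) y'(1)] by blast
  have "Phi (A2 P (st_lin a y b y')) = Phi (st_lin a (A2 P y) b (A2 P y'))"
    using Phi_eq_iff[OF A2_inH[OF inD_lin(1)[OF y(1) y'(1)]] Phi_lin(1)[OF A2_inH[OF y(1)] A2_inH[OF y'(1)]]]
      inD_lin(2)[OF y(1) y'(1)] by blast
  also have "\<dots> = csc a (AA x) + csc b (AA z)"
    unfolding y(2) y'(2) AA_Phi[OF y(1)] AA_Phi[OF y'(1)] by (rule Phi_lin(2)[OF A2_inH[OF y(1)] A2_inH[OF y'(1)]])
  finally show "AA (csc a x + csc b z) = csc a (AA x) + csc b (AA z)"
    by (simp only: e AA_Phi[OF inD_lin(1)[OF y(1) y'(1)]])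
qed

lemma XX_lin:
  assumes "x \<in> XX" "z \<in> XX"
  shows "csc a x + csc b z \<in> XX"
proof -
  obtain y y' where y: "inH P y" "x = Phi y" "inH P y'" "z = Phi y'" using assms by (auto simp: XX_def)
  then have "csc a x + csc b z = Phi (st_lin a y b y')" using Phi_lin(2) by simp
  then show ?thesis unfolding XX_def using Phi_lin(1)[OF y(1,3)] by blast
qed

lemma csc_simps: "csc 1 x = x" "csc 0 x = 0"
  using csc_of_real[of 1 x] csc_of_real[of 0 x] by simp_all

lemma DD_XX: "DD \<subseteq> XX"
  using inD_D(1) by (auto simp: DD_def XX_def)

lemma DD_nonempty: "\<exists>x. x \<in> DD"
proof -
  have "inH P (St (\<lambda>x. 0) (\<lambda>x. 0) (\<lambda>x. 0) (\<lambda>x. 0) (\<lambda>x. 0) (\<lambda>x. 0))"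
    using inV_I(1)[OF wder_zero wder_zero wder_zero] wderD(1)[OF wder_zero] by (simp add: inH_def)
  from A2_onto[OF this] show ?thesis by (auto simp: DD_def)
qed

lemma subspace_lin:
  assumes "\<And>a b x z. x \<in> Y \<Longrightarrow> z \<in> Y \<Longrightarrow> csc a x + csc b z \<in> Y" "x \<in> Y"
  shows "subspace Y"
proof (rule subspaceI)
  show "0 \<in> Y" using assms(1)[OF assms(2,2), of 0 0] by (simp add: csc_simps)
  show "u + v \<in> Y" if "u \<in> Y" "v \<in> Y" for u v using assms(1)[OF that, of 1 1] by (simp add: csc_simps)
  show "r *\<^sub>R u \<in> Y" if "u \<in> Y" for r u using assms(1)[OF that that, of "of_real r" 0] by (simp add: csc_simps csc_of_real)
qed

sublocale cd: compact_dissipative XX DD AA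
proof
  obtain x0 where x0: "x0 \<in> DD" using DD_nonempty by blast
  show "subspace XX" using subspace_lin[OF XX_lin] x0 DD_XX by blast
  show "subspace DD" by (rule subspace_lin[OF DD_lin(1) x0])
  show "closed XX" unfolding XX_def by (rule closed_Phi)
  show "DD \<subseteq> XX" by (rule DD_XX)
  fix x assume x: "x \<in> DD"
  then obtain y where y: "inD P y" "x = Phi y" by (auto simp: DD_def)
  show "AA x \<in> XX" unfolding y AA_Phi[OF y(1)] XX_def using A2_inH[OF y(1)] by blast
  show "AA (x + z) = AA x + AA z" if "z \<in> DD" for z using DD_lin(2)[OF x that, of 1 1] by (simp add: csc_simps)
  show "AA (r *\<^sub>R x) = r *\<^sub>R AA x" for r using DD_lin(2)[OF x x, of "of_real r" 0] by (simp add: csc_simps csc_of_real)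
  have "inner (AA x) x = - (gamma2 P / kappa2 P) * (l2norm 0 lb (cq y))\<^sup>2"
    unfolding y AA_Phi[OF y(1)] inner_Phi[OF A2_inH[OF y(1)] inD_D(1)[OF y(1)]] by (rule dissipation[OF y(1)])
  then show "inner (AA x) x \<le> 0" by simp
next
  fix f assume "f \<in> XX"
  then obtain F where F: "inH P F" "f = Phi F" by (auto simp: XX_def)
  obtain y where y: "inD P y" "Heq P (A2 P y) F" using A2_onto[OF F(1)] by blast
  have "AA (Phi y) = f" unfolding AA_Phi[OF y(1)] F using Phi_eq_iff[OF A2_inH[OF y(1)] F(1)] y(2) by simp
  then show "\<exists>x\<in>DD. AA x = f" using y(1) by (auto simp: DD_def)
next
  fix x :: "nat \<Rightarrow> l2_6" and C
  assume x: "\<And>n. x n \<in> DD" "\<And>n. norm (x n) \<le> C" "\<And>n. norm (AA (x n)) \<le> C"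
  obtain K where K: "relcomp K" "\<And>y. inD P y \<Longrightarrow> norm (Phi y) \<le> C \<Longrightarrow> norm (Phi (A2 P y)) \<le> C \<Longrightarrow> Phi y \<in> K"
    using relcomp_graph_ball by blast
  have "x n \<in> K" for n
  proof -
    obtain y where y: "inD P y" "x n = Phi y" using x(1)[of n] by (auto simp: DD_def)
    then show ?thesis using K(2)[OF y(1)] x(2)[of n] x(3)[of n] AA_Phi[OF y(1)] by simp
  qed
  then show "\<exists>r l. strict_mono (r :: nat \<Rightarrow> nat) \<and> (x \<circ> r) \<longlonglongrightarrow> l"
    using K(1) by (simp add: relcomp_def comp_def)
qed

section \<open>Orbits of constant norm\<close>

abbreviation "p1 \<equiv> \<lambda>x::l2_6. fst x"
abbreviation "p2 \<equiv> \<lambda>x::l2_6. fst (snd x)"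
abbreviation "p3 \<equiv> \<lambda>x::l2_6. fst (snd (snd x))"
abbreviation "p4 \<equiv> \<lambda>x::l2_6. fst (snd (snd (snd x)))"
abbreviation "p5 \<equiv> \<lambda>x::l2_6. fst (snd (snd (snd (snd x))))"
abbreviation "p6 \<equiv> \<lambda>x::l2_6. snd (snd (snd (snd (snd x))))"

lemmas bl_snd = bounded_linear_snd bounded_linear_snd_comp[OF bounded_linear_snd]
  bounded_linear_snd_comp[OF bounded_linear_snd_comp[OF bounded_linear_snd]]
  bounded_linear_snd_comp[OF bounded_linear_snd_comp[OF bounded_linear_snd_comp[OF bounded_linear_snd]]]
  bounded_linear_snd_comp[OF bounded_linear_snd_comp[OF bounded_linear_snd_comp[OF bounded_linear_snd_comp[OF bounded_linear_snd]]]]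

text \<open>Invariance under the flow lets facts proved at time 0 spread over the whole
  orbit.\<close>

definition iso :: "l2_6 \<Rightarrow> bool" where
  "iso x \<longleftrightarrow> x \<in> DD \<and> (\<forall>t\<ge>0. norm (cd.S t x) = norm x)"

lemma iso_S: "iso x \<Longrightarrow> 0 \<le> s \<Longrightarrow> iso (cd.S s x)"
  unfolding iso_def
proof (intro conjI allI impI, elim conjE)
  assume x: "x \<in> DD" and s: "0 \<le> s"
  then show "cd.S s x \<in> DD" by (intro cd.S_D)
next
  fix t :: real assume x: "x \<in> DD \<and> (\<forall>t\<ge>0. norm (cd.S t x) = norm x)" and s: "0 \<le> s" and t: "0 \<le> t"
  have "x \<in> XX" using x DD_XX by blast
  then have "cd.S t (cd.S s x) = cd.S (t + s) x" using cd.S_semigroup[OF t s] by simp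
  then show "norm (cd.S t (cd.S s x)) = norm (cd.S s x)" using x s t by simp
qed

lemma iso_annihilated:
  assumes "bounded_linear f" "\<And>x. iso x \<Longrightarrow> f x = 0" "iso x"
  shows "f (AA x) = 0"
  using cd.annihilated_orbit[of x f] assms iso_S[OF assms(3)] by (auto simp: iso_def)

text \<open>A constant norm makes the inner product of A x with x vanish, and the dissipation
  identity equates it with a negative multiple of the flux norm squared.\<close>

lemma iso_p6: assumes "iso x" shows "p6 x = 0"
proof -
  obtain y where y: "inD P y" "x = Phi y" using assms by (auto simp: iso_def DD_def)
  have "inner (AA x) x = 0" using cd.isometric_orbit_inner_zero[of x] assms by (auto simp: iso_def)
  then have "Re (Hinner P (A2 P y) y) = 0"
    unfolding y AA_Phi[OF y(1)] inner_Phi[OF A2_inH[OF y(1)] inD_D(1)[OF y(1)]] .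
  then have "l2norm 0 lb (cq y) = 0" unfolding dissipation[OF y(1)] by simp
  then have "emb lb (cq y) = 0" using emb_norm[OF inH_D(7)[OF inD_D(1)[OF y(1)]]] by simp
  then show ?thesis by (simp add: y Phi_def)
qed

lemma w_nonzero [simp]: "w1 \<noteq> 0" "w3 \<noteq> 0" "w4 \<noteq> 0" "w6 \<noteq> 0"
  using weight_pos by (metis less_irrefl)+

text \<open>Two rounds of differentiation: q = 0 reduces the flux equation to theta' = 0, then theta
  = 0 reduces the heat equation to v2'' = 0. The conditions theta = 0 and v2' = 0 at 0 and v2 = 0 at
  \<open>lb\<close> integrate these to zero, and v1 inherits its zero at the joint from v2.\<close>

lemma iso_facts:
  assumes x: "iso x" and y: "inD P y" "x = Phi y"
  shows "AE t in lebesgue_on {0..lb}. cth y t = 0" "AE t in lebesgue_on {0..lb}. d2 P (d2 P (cv2 y)) t = 0"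
    "AE t in lebesgue_on {0..lb}. cv2 y t = 0" "crep 0 la (cv1 y) 0 = 0"
proof -
  \<comment> \<open>Proved for every isometric point, because \<open>iso_annihilated\<close> in the
    second round needs theta = 0 along the whole orbit.\<close>
  have th: "AE t in lebesgue_on {0..lb}. cth y t = 0" if x: "iso x" and y: "inD P y" "x = Phi y" for x y
  proof -
    note d = inD_D[OF y(1)] and h = inH_D[OF inD_D(1)[OF y(1)]] and hA = inH_D[OF A2_inH[OF y(1)]]
    have "AA x = Phi (A2 P y)" by (simp only: y(2) AA_Phi[OF y(1)])
    then have "p6 (Phi y) = 0" "p6 (Phi (A2 P y)) = 0"
      using iso_p6[OF x] iso_annihilated[OF bl_snd(5) iso_p6 x] y(2) by auto
    then have "emb lb (cq y) = 0" "emb lb (cq (A2 P y)) = 0" by (simp_all add: Phi_def)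
    then have "AE t in lebesgue_on {0..lb}. cq y t = 0" "AE t in lebesgue_on {0..lb}. cq (A2 P y) t = 0"
      using emb_zero_iff h(7) hA(7) by blast+
    then have "AE t in lebesgue_on {0..lb}. d2 P (cth y) t = 0"
      by eventually_elim (simp add: A2_def)
    from wder_vanish(2)[OF _ d(5) this, of 0] d(6) show ?thesis by simp
  qed
  have p5: "p5 x = 0" if x: "iso x" for x
  proof -
    obtain y where y: "inD P y" "x = Phi y" using x by (auto simp: iso_def DD_def)
    have "emb lb (cth y) = 0" using th[OF x y] emb_zero_iff[OF inH_D(6)[OF inD_D(1)[OF y(1)]]] by blast
    then show ?thesis by (simp add: y Phi_def)
  qed
  show "AE t in lebesgue_on {0..lb}. cth y t = 0" by (rule th[OF x y])
  note d = inD_D[OF y(1)] and h = inH_D[OF inD_D(1)[OF y(1)]] and hA = inH_D[OF A2_inH[OF y(1)]]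
  note v = inV_D[OF d(3)]
  have "AA x = Phi (A2 P y)" by (simp only: y(2) AA_Phi[OF y(1)])
  then have "p6 (Phi y) = 0" "p5 (Phi (A2 P y)) = 0"
    using iso_p6[OF x] iso_annihilated[OF bounded_linear_fst_comp[OF bl_snd(4)] p5 x] y(2) by auto
  then have "emb lb (cq y) = 0" "emb lb (cth (A2 P y)) = 0" by (simp_all add: Phi_def)
  then have q: "AE t in lebesgue_on {0..lb}. cq y t = 0" and c: "AE t in lebesgue_on {0..lb}. cth (A2 P y) t = 0"
    using emb_zero_iff h(7) hA(6) by blast+
  have "AE t in lebesgue_on {0..lb}. d2 P (cq y) t = 0" by (rule wder_AE_zero(2)[OF _ d(8) q]) simp
  with c show v2'': "AE t in lebesgue_on {0..lb}. d2 P (d2 P (cv2 y)) t = 0" by eventually_elim (simp add: A2_def)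
  have v2': "AE t in lebesgue_on {0..lb}. d2 P (cv2 y) t = 0"
    by (rule wder_vanish(2)[OF _ v(3) v2'', of 0]) (simp_all add: v(7))
  show "AE t in lebesgue_on {0..lb}. cv2 y t = 0"
    by (rule wder_vanish(2)[OF _ v(2) v2', of lb]) (simp_all add: v(5))
  have "crep 0 lb (cv2 y) 0 = 0"
    by (rule wder_vanish(1)[OF _ v(2) v2', of lb]) (simp_all add: v(5))
  then show "crep 0 la (cv1 y) 0 = 0" using v(6) by simp
qed

text \<open>The time derivative of u2'' is v2'' = 0. This gives a constant bending, not yet a
  vanishing one.\<close>

lemma iso_p3:
  assumes x: "iso x" and t: "0 \<le> t"
  shows "p3 (cd.S t x) = p3 x"
proof -
  have bl: "bounded_linear p3" by (rule bounded_linear_fst_comp[OF bl_snd(2)])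
  have z: "p3 (AA u) = 0" if u: "iso u" for u
  proof -
    obtain y where y: "inD P y" "u = Phi y" using u by (auto simp: iso_def DD_def)
    have "emb lb (d2 P (d2 P (cv2 y))) = 0"
      using iso_facts(2)[OF u y] emb_zero_iff[OF wderD(2)[OF inV_D(3)[OF inD_D(3)[OF y(1)]]]] by blast
    then have "p3 (Phi (A2 P y)) = 0" by (simp add: Phi_def A2_def)
    then show ?thesis by (simp only: y(2) AA_Phi[OF y(1)])
  qed
  have xD: "x \<in> DD" using x by (simp add: iso_def)
  have "((\<lambda>t. p3 (cd.S t x)) has_vector_derivative 0) (at s within {0..})" if "s \<in> {0..}" for s
  proof -
    have s: "0 \<le> s" using that by simp
    have "((\<lambda>t. p3 (cd.S t x)) has_vector_derivative p3 (cd.S s (AA x))) (at s within {0..})"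
      by (rule bounded_linear.has_vector_derivative[OF bl cd.S_has_derivative[OF xD s]])
    then show ?thesis using z[OF iso_S[OF x s]] cd.S_D(2)[OF s xD] by simp
  qed
  from has_vector_derivative_zero_constant[OF convex_real_interval(1) this]
  obtain c where c: "\<And>s. s \<in> {0..} \<Longrightarrow> p3 (cd.S s x) = c" by metis
  then show ?thesis using c[of t] c[of 0] t by (simp add: cd.S_0)
qed

text \<open>Up to the factor \<open>w1\<close>, the multiplier functional: the real part of the
  integral of (x - la) u1' conj(v1) over the string.\<close>

definition rho :: "l2_6 \<Rightarrow> real" where
  "rho x = inner (affine_mult la (p1 x)) (p2 x)"

text \<open>With u2'' = 0 and theta = 0 also w = 0, so the transmission condition gives u1' = 0 at
  the joint, and v1 = 0 there by \<open>iso_facts\<close>: these are the traces that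
  \<open>multiplier_identity\<close> asks for. As the beam components vanish, the energy of the
  string is the whole norm.\<close>

lemma iso_multiplier:
  assumes x: "iso x" and p3: "p3 x = 0"
  shows "inner (affine_mult la (p1 x)) (p2 (AA x)) + inner (affine_mult la (p1 (AA x))) (p2 x) = - (w1 / 2) * (norm x)\<^sup>2"
proof -
  obtain y where y: "inD P y" "x = Phi y" using x by (auto simp: iso_def DD_def)
  note d = inD_D[OF y(1)] and h = inH_D[OF inD_D(1)[OF y(1)]] and hA = inH_D[OF A2_inH[OF y(1)]]
  note u = inV_D[OF d(2)] and v = inV_D[OF d(3)] and f = iso_facts[OF x y]
  have s: "AE t in lebesgue_on {0..lb}. d2 P (d2 P (cu2 y)) t = 0"
    using p3 emb_zero_iff[OF h(4)] by (simp add: y Phi_def)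
  have "AE t in lebesgue_on {0..lb}. wfun P y t = 0" using s f(1) by eventually_elim (simp add: wfun_def)
  from wder_AE_zero(2)[OF _ d(9) this] have "AE t in lebesgue_on {0..lb}. d2 P (wfun P y) t = 0" by simp
  from wder_AE_zero(1)[OF _ d(10) this, of 0] have "crep 0 lb (d2 P (wfun P y)) 0 = 0" by simp
  then have P0: "crep 0 la (d1 P (cu1 y)) 0 = 0" using d(13) by simp
  let ?p = "d1 P (cu1 y)"
  have Lp: "L2 0 la ?p" "L2 0 la (d1 P ?p)" "L2 0 la (cv1 y)" "L2 0 la (d1 P (cv1 y))"
    using wderD(1,2)[OF d(4)] wderD(1,2)[OF v(1)] by auto
  have z: "emb lb (d2 P (d2 P (cu2 y))) = 0" "emb lb (cv2 y) = 0" "emb lb (cth y) = 0" "emb lb (cq y) = 0"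
    using s f emb_zero_iff[OF h(4)] emb_zero_iff[OF h(5)] emb_zero_iff[OF h(6)] iso_p6[OF x] by (simp_all add: y Phi_def)
  have "(norm x)\<^sup>2 = (w1 * l2norm 0 la ?p)\<^sup>2 + (l2norm 0 la (cv1 y))\<^sup>2"
    by (simp add: y Phi_def z norm_Pair emb_norm Lp)
  then have n: "(norm x)\<^sup>2 = alpha1 P * (l2norm 0 la ?p)\<^sup>2 + (l2norm 0 la (cv1 y))\<^sup>2"
    by (simp add: power2_eq_square weight_sq[symmetric])
  interpret M: bounded_linear "affine_mult la" by (rule bounded_linear_affine_mult) simp
  have M: "affine_mult la (emb la ?p) = emb la (\<lambda>x. of_real (x - la) * ?p x)"
    "affine_mult la (emb la (d1 P (cv1 y))) = emb la (\<lambda>x. of_real (x - la) * d1 P (cv1 y) x)"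
    by (rule affine_mult_emb[OF Lp(1)], rule affine_mult_emb[OF Lp(4)])
  have "inner (affine_mult la (p1 x)) (p2 (AA x)) = w1 * inner (emb la (\<lambda>x. of_real (x - la) * ?p x)) (emb la (\<lambda>x. of_real (alpha1 P) * d1 P ?p x))"
    unfolding y AA_Phi[OF y(1)] by (simp add: Phi_def A2_def M.scaleR M)
  also have "emb la (\<lambda>x. of_real (alpha1 P) * d1 P ?p x) = alpha1 P *\<^sub>R emb la (d1 P ?p)"
    by (simp add: emb_cmult[OF Lp(2)] cscale_of_real)
  also have "w1 * inner (emb la (\<lambda>x. of_real (x - la) * ?p x)) (alpha1 P *\<^sub>R emb la (d1 P ?p))
      = w1 * (alpha1 P * Re (l2inner 0 la (\<lambda>x. of_real (x - la) * ?p x) (d1 P ?p)))"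
    by (simp only: inner_scaleR_right emb_inner[OF L2_affine_mult[OF Lp(1)] Lp(2)])
  also have "\<dots> = w1 * (alpha1 P * (- (1/2) * (l2norm 0 la ?p)\<^sup>2))"
    unfolding multiplier_identity(2)[OF pos_simps(10) d(4) P0] ..
  finally have e1: "inner (affine_mult la (p1 x)) (p2 (AA x)) = w1 * (alpha1 P * (- (1/2) * (l2norm 0 la ?p)\<^sup>2))" .
  have "inner (affine_mult la (p1 (AA x))) (p2 x) = w1 * inner (emb la (\<lambda>x. of_real (x - la) * d1 P (cv1 y) x)) (emb la (cv1 y))"
    unfolding y AA_Phi[OF y(1)] by (simp add: Phi_def A2_def M.scaleR M)
  also have "\<dots> = w1 * Re (l2inner 0 la (\<lambda>x. of_real (x - la) * d1 P (cv1 y) x) (cv1 y))"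
    by (simp only: emb_inner[OF L2_affine_mult[OF Lp(4)] Lp(3)])
  also have "\<dots> = w1 * (- (1/2) * (l2norm 0 la (cv1 y))\<^sup>2)"
    unfolding multiplier_identity(1)[OF pos_simps(10) v(1) f(4)] ..
  finally show ?thesis unfolding e1 n by (simp add: algebra_simps)
qed

text \<open>Along the orbit \<open>rho\<close> falls at the constant speed k, yet it stays bounded
  by la |x|^2.\<close>

lemma iso_zero_of_p3:
  assumes x: "iso x" and p3: "p3 x = 0"
  shows "x = 0"
proof (rule ccontr)
  assume nz: "x \<noteq> 0"
  define k where "k = (w1 / 2) * (norm x)\<^sup>2"
  have k: "k > 0" using nz by (simp add: k_def)
  have xD: "x \<in> DD" using x by (simp add: iso_def)
  have "((\<lambda>t. rho (cd.S t x) + k * t) has_vector_derivative 0) (at t within {0..})" if "t \<in> {0..}" for t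
  proof -
    have t: "0 \<le> t" using that by simp
    note dS = cd.S_has_derivative[OF xD t] and it = iso_S[OF x t]
    note d1' = bounded_linear.has_vector_derivative[OF bounded_linear_fst dS]
    note d2' = bounded_linear.has_vector_derivative[OF bounded_linear_fst_comp[OF bl_snd(1)] dS]
    note dM = bounded_linear.has_vector_derivative[OF bounded_linear_affine_mult[OF pos_simps(10)] d1']
    have "((\<lambda>t. rho (cd.S t x)) has_vector_derivative
        inner (affine_mult la (p1 (cd.S t x))) (p2 (cd.S t (AA x))) + inner (affine_mult la (p1 (cd.S t (AA x)))) (p2 (cd.S t x)))
        (at t within {0..})"
      unfolding rho_def by (rule bounded_bilinear.has_vector_derivative[OF bounded_bilinear_inner dM d2'])
    moreover have "inner (affine_mult la (p1 (cd.S t x))) (p2 (cd.S t (AA x))) + inner (affine_mult la (p1 (cd.S t (AA x)))) (p2 (cd.S t x)) = - k"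
      using iso_multiplier[OF it] iso_p3[OF x t] p3 cd.S_D(2)[OF t xD] x t by (simp add: k_def iso_def)
    moreover have "((\<lambda>t. k * t) has_vector_derivative k) (at t within {0..})"
      by (auto intro!: derivative_eq_intros simp flip: has_real_derivative_iff_has_vector_derivative)
    ultimately have "((\<lambda>t. rho (cd.S t x) + k * t) has_vector_derivative (- k + k)) (at t within {0..})"
      using has_vector_derivative_add by fastforce
    then show ?thesis by simp
  qed
  from has_vector_derivative_zero_constant[OF convex_real_interval(1) this]
  obtain c where c: "\<And>t. t \<in> {0..} \<Longrightarrow> rho (cd.S t x) + k * t = c" by metis
  have b: "\<bar>rho (cd.S t x)\<bar> \<le> la * (norm x)\<^sup>2" if t: "0 \<le> t" for t
  proof -
    let ?u = "cd.S t x"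
    have nu: "norm ?u = norm x" using x t by (simp add: iso_def)
    have "\<bar>rho ?u\<bar> \<le> norm (affine_mult la (p1 ?u)) * norm (p2 ?u)" unfolding rho_def by (rule Cauchy_Schwarz_ineq2)
    also have "\<dots> \<le> (la * norm (p1 ?u)) * norm (p2 ?u)" by (intro mult_right_mono norm_affine_mult) auto
    also have "\<dots> \<le> (la * norm ?u) * norm ?u"
    proof (intro mult_mono mult_left_mono)
      show "norm (p1 ?u) \<le> norm ?u" by (metis norm_fst_le prod.collapse)
      show "norm (p2 ?u) \<le> norm ?u" by (metis norm_fst_le norm_snd_le order.trans prod.collapse)
    qed auto
    finally show ?thesis by (simp add: nu power2_eq_square)
  qed
  \<comment> \<open>A time at which the drop k T exceeds 2 la |x|^2, the largest variation that the
    bound allows.\<close>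
  define T where "T = (2 * la * (norm x)\<^sup>2 + 1) / k"
  have T: "0 \<le> T" using k by (simp add: T_def)
  have "k * T = rho (cd.S 0 x) - rho (cd.S T x)" using c[of 0] c[of T] T by simp
  also have "\<dots> \<le> 2 * la * (norm x)\<^sup>2" using b[of 0] b[OF T] by (simp add: abs_le_iff)
  finally show False using k by (simp add: T_def)
qed

text \<open>The increment S s z - z has constant norm by \<open>S_isometric_diff\<close> and no
  bending by \<open>iso_p3\<close>, so it is zero. Hence z is stationary, A z = 0, and
  \<open>limit_in_kernel\<close> with a constant sequence gives z = 0.\<close>

lemma observability:
  assumes "z \<in> DD" "\<And>t. 0 \<le> t \<Longrightarrow> norm (cd.S t z) = norm z"
  shows "z = 0"
proof -
  have z: "iso z" using assms by (simp add: iso_def)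
  have zX: "z \<in> XX" using assms DD_XX by blast
  have fix_z: "cd.S s z = z" if s: "0 \<le> s" for s
  proof -
    have "iso (cd.S s z - z)"
      unfolding iso_def
    proof (intro conjI allI impI)
      show "cd.S s z - z \<in> DD" using cd.S_D(1)[OF s assms(1)] assms(1) cd.subD by (intro subspace_diff)
      fix t :: real assume t: "0 \<le> t"
      show "norm (cd.S t (cd.S s z - z)) = norm (cd.S s z - z)"
        using iso_S[OF z s] t s z zX cd.S_X[OF s zX] by (intro cd.S_isometric_diff) (auto simp: iso_def)
    qed
    moreover have "p3 (cd.S s z - z) = 0" using iso_p3[OF z s] by simp
    ultimately have "cd.S s z - z = 0" by (rule iso_zero_of_p3)
    then show ?thesis by simp
  qed
  have "id (AA z) = 0"
  proof -
    have "((\<lambda>t. (1/t) *\<^sub>R (cd.S t z - z)) \<longlongrightarrow> AA z) (at_right 0)" by (rule cd.S_generator[OF assms(1)])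
    moreover have "\<forall>\<^sub>F t in at_right 0. (1/t) *\<^sub>R (cd.S t z - z) = 0"
      using eventually_at_right_less[of "0::real"] by eventually_elim (simp add: fix_z)
    ultimately have "((\<lambda>t::real. 0) \<longlongrightarrow> AA z) (at_right 0)"
      using tendsto_cong[of "\<lambda>t. (1/t) *\<^sub>R (cd.S t z - z)" "\<lambda>t. 0" "at_right 0" "AA z"] by blast
    then show ?thesis by (simp add: tendsto_const_iff)
  qed
  then show ?thesis using cd.limit_in_kernel[of "\<lambda>n. z" z] assms(1) by simp
qed

section \<open>Return to functions: stability, resolvent set and semigroup\<close>

lemma stable: "x \<in> XX \<Longrightarrow> ((\<lambda>t. norm (cd.S t x)) \<longlongrightarrow> 0) at_top"
  by (rule cd.strongly_stable_of_observability[OF observability])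

lemma csc_ii_facts:
  shows "norm (csc \<i> x) = norm x" "x \<in> XX \<Longrightarrow> csc \<i> x \<in> XX" "x \<in> DD \<Longrightarrow> csc \<i> x \<in> DD"
    "x \<in> DD \<Longrightarrow> AA (csc \<i> x) = csc \<i> (AA x)"
  using XX_lin[of x x \<i> 0] DD_lin[of x x \<i> 0] by (auto simp: norm_csc csc_simps)

lemmas J_rules = stable bounded_linear_csc[of \<i>] csc_ii_facts(1) inner_csc_ii csc_ii_facts(2-4)

text \<open>Real linearity of the flow and commutation with i together give complex
  linearity.\<close>

lemma S_csc:
  assumes "0 \<le> t" "x \<in> XX"
  shows "cd.S t (csc a x) = csc a (cd.S t x)"
proof -
  have "cd.S t (csc \<i> x) = csc \<i> (cd.S t x)"
    by (rule cd.S_commute[OF J_rules assms])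
  moreover have "csc \<i> x \<in> XX" by (rule csc_ii_facts(2)[OF assms(2)])
  moreover from this have "Re a *\<^sub>R x \<in> XX" "Im a *\<^sub>R csc \<i> x \<in> XX"
    using assms cd.subX by (simp_all only: subspace_scale)
  ultimately show ?thesis
    using assms by (simp add: csc_decomp[of a] cd.S_add cd.S_scale)
qed

lemma resolvent_imaginary: "in_resolvent P (\<i> * of_real w)"
  unfolding in_resolvent_def
proof (intro conjI allI impI)
  have e: "Phi (st_lin (\<i> * of_real w) y (-1) (A2 P y)) = w *\<^sub>R csc \<i> (Phi y) - AA (Phi y)"
    and H: "inH P (st_lin (\<i> * of_real w) y (-1) (A2 P y))" if "inD P y" for y
  proof -
    have "csc (\<i> * of_real w) (Phi y) = w *\<^sub>R csc \<i> (Phi y)"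
      using csc_csc[of "of_real w" \<i> "Phi y"] by (simp add: csc_of_real mult.commute)
    moreover have "csc (-1) u = - u" for u using csc_of_real[of "-1" u] by simp
    ultimately show "Phi (st_lin (\<i> * of_real w) y (-1) (A2 P y)) = w *\<^sub>R csc \<i> (Phi y) - AA (Phi y)"
      using Phi_lin(2)[OF inD_D(1)[OF that] A2_inH[OF that], of "\<i> * of_real w" "-1"] AA_Phi[OF that] by simp
    show "inH P (st_lin (\<i> * of_real w) y (-1) (A2 P y))"
      by (rule Phi_lin(1)[OF inD_D(1)[OF that] A2_inH[OF that]])
  qed
  show "\<exists>y. inD P y \<and> Heq P (st_lin (\<i> * of_real w) y (-1) (A2 P y)) F" if F: "inH P F" for F
  proof -
    have "Phi F \<in> XX" using F by (simp add: XX_def)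
    from cd.imaginary_onto[OF J_rules this, of w]
    obtain x where x: "x \<in> DD" "w *\<^sub>R csc \<i> x - AA x = Phi F" by blast
    then obtain y where y: "inD P y" "x = Phi y" by (auto simp: DD_def)
    have "Phi (st_lin (\<i> * of_real w) y (-1) (A2 P y)) = Phi F" using e[OF y(1)] x(2) y(2) by simp
    then show ?thesis using Phi_eq_iff[OF H[OF y(1)] F] y(1) by blast
  qed
  obtain C where "\<forall>x\<in>DD. norm x \<le> C * norm (w *\<^sub>R csc \<i> x - AA x)"
    using cd.imaginary_bounded_below[OF J_rules, of w] by blast
  then have "Hnorm P y \<le> C * Hnorm P (st_lin (\<i> * of_real w) y (-1) (A2 P y))" if "inD P y" for y
    using that Hnorm_Phi[OF inD_D(1)[OF that]] Hnorm_Phi[OF H[OF that]] e[OF that] by (auto simp: DD_def)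
  then show "\<exists>C. \<forall>y. inD P y \<longrightarrow> Hnorm P y \<le> C * Hnorm P (st_lin (\<i> * of_real w) y (-1) (A2 P y))" by blast
qed

text \<open>The flow acts on classes; on functions a representative is chosen, so the semigroup laws
  hold up to \<open>Heq P\<close>.\<close>

definition Tst :: "real \<Rightarrow> st \<Rightarrow> st" where
  "Tst t y = (SOME z. inH P z \<and> Phi z = cd.S t (Phi y))"

lemma Tst:
  assumes "0 \<le> t" "inH P y"
  shows "inH P (Tst t y)" "Phi (Tst t y) = cd.S t (Phi y)"
proof -
  have "cd.S t (Phi y) \<in> XX" using assms by (intro cd.S_X) (auto simp: XX_def)
  then have "\<exists>z. inH P z \<and> Phi z = cd.S t (Phi y)" by (auto simp: XX_def)
  from someI_ex[OF this] show "inH P (Tst t y)" "Phi (Tst t y) = cd.S t (Phi y)" by (auto simp: Tst_def)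
qed

lemma Hnorm_diff:
  assumes "inH P y" "inH P z"
  shows "Hnorm P (st_diff y z) = norm (Phi y - Phi z)"
proof -
  have "csc (-1) u = - u" for u using csc_of_real[of "-1" u] by simp
  then show ?thesis
    using Hnorm_Phi[OF Phi_lin(1)[OF assms, of 1 "-1"]] Phi_lin(2)[OF assms, of 1 "-1"]
    by (simp add: st_diff_def csc_simps)
qed

lemma Hnorm_quotient:
  assumes y: "inH P y" and z: "inH P z" and t: "0 < t"
  shows "Hnorm P (st_diff (st_lin (of_real (1/t)) (Tst t y) (- of_real (1/t)) y) z)
    = norm ((1/t) *\<^sub>R (cd.S t (Phi y) - Phi y) - Phi z)"
proof -
  have T: "inH P (Tst t y)" "Phi (Tst t y) = cd.S t (Phi y)" using Tst[of t y] t y by auto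
  have "Phi (st_lin (of_real (1/t)) (Tst t y) (of_real (- (1/t))) y) = (1/t) *\<^sub>R (cd.S t (Phi y) - Phi y)"
    unfolding Phi_lin(2)[OF T(1) y] csc_of_real T(2) by (simp add: scaleR_diff_right)
  then show ?thesis
    using Hnorm_diff[OF Phi_lin(1)[OF T(1) y, of "of_real (1/t)" "of_real (- (1/t))"] z] by simp
qed

lemma Hnorm_quotient_tendsto:
  assumes y: "inH P y" and z: "inH P z"
  shows "((\<lambda>t. Hnorm P (st_diff (st_lin (of_real (1/t)) (Tst t y) (- of_real (1/t)) y) z)) \<longlongrightarrow> 0) (at_right 0)
    \<longleftrightarrow> ((\<lambda>t. (1/t) *\<^sub>R (cd.S t (Phi y) - Phi y)) \<longlongrightarrow> Phi z) (at_right 0)"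
proof -
  have "\<forall>\<^sub>F t in at_right 0. Hnorm P (st_diff (st_lin (of_real (1/t)) (Tst t y) (- of_real (1/t)) y) z)
      = norm ((1/t) *\<^sub>R (cd.S t (Phi y) - Phi y) - Phi z)"
    using eventually_at_right_less[of "0::real"] by eventually_elim (rule Hnorm_quotient[OF y z])
  then have "((\<lambda>t. Hnorm P (st_diff (st_lin (of_real (1/t)) (Tst t y) (- of_real (1/t)) y) z)) \<longlongrightarrow> 0) (at_right 0)
    \<longleftrightarrow> ((\<lambda>t. norm ((1/t) *\<^sub>R (cd.S t (Phi y) - Phi y) - Phi z)) \<longlongrightarrow> 0) (at_right 0)" by (rule tendsto_cong)
  then show ?thesis by (simp only: tendsto_norm_zero_iff LIM_zero_iff)
qed

lemma Tst_semigroup: "C0_contraction_semigroup_gen P Tst"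
  unfolding C0_contraction_semigroup_gen_def
proof (intro conjI allI impI)
  have X: "Phi y \<in> XX" if "inH P y" for y using that by (simp add: XX_def)
  show "inH P (Tst t y)" if "0 \<le> t" "inH P y" for t y using that by (rule Tst)
  show "Heq P (Tst t y) (Tst t z)" if "0 \<le> t" "inH P y" "inH P z" "Heq P y z" for t y z
    using that Tst(2)[OF that(1,2)] Tst(2)[OF that(1,3)] Phi_eq_iff[OF that(2,3)]
      Phi_eq_iff[OF Tst(1)[OF that(1,2)] Tst(1)[OF that(1,3)]] by simp
  show "Heq P (Tst t (st_lin a y b z)) (st_lin a (Tst t y) b (Tst t z))" if "0 \<le> t" "inH P y" "inH P z" for t a b y z
  proof -
    note Ty = Tst[OF that(1,2)] and Tz = Tst[OF that(1,3)] and L = Phi_lin[OF that(2,3), of a b]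
    note TL = Tst[OF that(1) L(1)]
    have "csc a (Phi y) \<in> XX" "csc b (Phi z) \<in> XX"
      using XX_lin[OF X[OF that(2)] X[OF that(2)], of a 0] XX_lin[OF X[OF that(3)] X[OF that(3)], of b 0] by (simp_all add: csc_simps)
    then have "Phi (Tst t (st_lin a y b z)) = Phi (st_lin a (Tst t y) b (Tst t z))"
      unfolding TL(2) L(2) Phi_lin(2)[OF Ty(1) Tz(1)] Ty(2) Tz(2)
      using that X by (simp add: cd.S_add S_csc)
    then show ?thesis using Phi_eq_iff[OF TL(1) Phi_lin(1)[OF Ty(1) Tz(1)]] by blast
  qed
  show "Heq P (Tst 0 y) y" if "inH P y" for y
    using Tst[of 0 y] that Phi_eq_iff[of "Tst 0 y" y] by (simp add: cd.S_0)
  show "Heq P (Tst (t + s) y) (Tst t (Tst s y))" if "0 \<le> t" "0 \<le> s" "inH P y" for t s y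
  proof -
    note a = Tst[OF that(2,3)]
    note b = Tst[OF that(1) a(1)] and c = Tst[OF add_nonneg_nonneg[OF that(1,2)] that(3)]
    have "Phi (Tst (t + s) y) = Phi (Tst t (Tst s y))"
      unfolding b(2) c(2) a(2) by (rule cd.S_semigroup[OF that(1,2) X[OF that(3)]])
    then show ?thesis using Phi_eq_iff[OF c(1) b(1)] by blast
  qed
  show "Hnorm P (Tst t y) \<le> Hnorm P y" if "0 \<le> t" "inH P y" for t y
    using Tst[OF that] Hnorm_Phi that cd.S_contraction[OF that(1) X[OF that(2)]] by simp
  show "((\<lambda>t. Hnorm P (st_diff (Tst t y) y)) \<longlongrightarrow> 0) (at_right 0)" if y: "inH P y" for y
  proof -
    have "\<forall>\<^sub>F t in at_right 0. Hnorm P (st_diff (Tst t y) y) = norm (cd.S t (Phi y) - Phi y)"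
      using eventually_at_right_less[of "0::real"]
    proof eventually_elim
      case (elim t)
      then have "0 \<le> t" by simp
      from Tst[OF this y] show ?case using Hnorm_diff[of "Tst t y" y] y by simp
    qed
    then have "((\<lambda>t. Hnorm P (st_diff (Tst t y) y)) \<longlongrightarrow> 0) (at_right 0)
        \<longleftrightarrow> ((\<lambda>t. norm (cd.S t (Phi y) - Phi y)) \<longlongrightarrow> 0) (at_right 0)" by (rule tendsto_cong)
    moreover have "((\<lambda>t. norm (cd.S t (Phi y) - Phi y)) \<longlongrightarrow> 0) (at_right 0)"
      unfolding tendsto_norm_zero_iff LIM_zero_iff by (rule cd.S_continuous_at_0[OF X[OF y]])
    ultimately show ?thesis by blast
  qed
  have gen: "((\<lambda>t. Hnorm P (st_diff (st_lin (of_real (1/t)) (Tst t y) (- of_real (1/t)) y) (A2 P y))) \<longlongrightarrow> 0) (at_right 0)"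
    if y: "inD P y" for y
  proof -
    have "Phi y \<in> DD" using y by (simp add: DD_def)
    from cd.S_generator[OF this] show ?thesis
      unfolding Hnorm_quotient_tendsto[OF inD_D(1)[OF y] A2_inH[OF y]] AA_Phi[OF y] .
  qed
  then show "((\<lambda>t. Hnorm P (st_diff (st_lin (of_real (1/t)) (Tst t y) (- of_real (1/t)) y) (A2 P y))) \<longlongrightarrow> 0) (at_right 0)"
    if "inD P y" for y using that .
  show "(\<exists>z. inH P z \<and> ((\<lambda>t. Hnorm P (st_diff (st_lin (of_real (1/t)) (Tst t y) (- of_real (1/t)) y) z)) \<longlongrightarrow> 0) (at_right 0))
      \<longleftrightarrow> inD P y" if y: "inH P y" for y
  proof
    assume "inD P y"
    then show "\<exists>z. inH P z \<and> ((\<lambda>t. Hnorm P (st_diff (st_lin (of_real (1/t)) (Tst t y) (- of_real (1/t)) y) z)) \<longlongrightarrow> 0) (at_right 0)"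
      using gen A2_inH by blast
  next
    assume "\<exists>z. inH P z \<and> ((\<lambda>t. Hnorm P (st_diff (st_lin (of_real (1/t)) (Tst t y) (- of_real (1/t)) y) z)) \<longlongrightarrow> 0) (at_right 0)"
    then obtain z where z: "inH P z" "((\<lambda>t. Hnorm P (st_diff (st_lin (of_real (1/t)) (Tst t y) (- of_real (1/t)) y) z)) \<longlongrightarrow> 0) (at_right 0)" by blast
    have "Phi y \<in> DD"
      by (rule cd.S_generator_domain[OF X[OF y] X[OF z(1)] z(2)[unfolded Hnorm_quotient_tendsto[OF y z(1)]]])
    \<comment> \<open>Membership in \<open>DD\<close> concerns the class of y and yields some
      representative u in the domain; \<open>inD_cong\<close> transfers this to y itself.\<close>
    then obtain u where u: "inD P u" "Phi y = Phi u" by (auto simp: DD_def)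
    have "Heq P u y" using Phi_eq_iff[OF inD_D(1)[OF u(1)] y] u(2) by simp
    then show "inD P y" by (rule inD_cong(1)[OF u(1) y])
  qed
qed

lemma Tst_stable: "strongly_stable P Tst"
  unfolding strongly_stable_def
proof (intro allI impI)
  fix y assume y: "inH P y"
  then have "((\<lambda>t. norm (cd.S t (Phi y))) \<longlongrightarrow> 0) at_top" by (intro stable) (simp add: XX_def)
  moreover have "\<forall>\<^sub>F t in at_top. Hnorm P (Tst t y) = norm (cd.S t (Phi y))"
    using eventually_ge_at_top[of 0] by eventually_elim (use y Tst Hnorm_Phi in simp)
  ultimately show "((\<lambda>t. Hnorm P (Tst t y)) \<longlongrightarrow> 0) at_top" using tendsto_cong by fastforce
qed

end

theorem mainTheorem4:
  fixes P :: prm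
  assumes "pos_prm P"
  shows "(\<forall>y. inD P y \<longrightarrow> Re (Hinner P (A2 P y) y) \<le> 0)
       \<and> (\<forall>y. inD P y \<longrightarrow>
            Re (Hinner P (A2 P y) y) = - (gamma2 P / kappa2 P) * (l2norm 0 (ell2 P) (cq y))\<^sup>2)
       \<and> in_resolvent P 0
       \<and> (\<forall>\<omega>::real. in_resolvent P (\<i> * of_real \<omega>))
       \<and> (\<exists>S. C0_contraction_semigroup_gen P S \<and> strongly_stable P S)"
proof -
  interpret wave_beam P by unfold_locales fact
  have "in_resolvent P 0" using resolvent_imaginary[of 0] by simp
  then show ?thesis using dissipation resolvent_imaginary Tst_semigroup Tst_stable by auto
qed

end
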